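(* Let $\ell\ge1$ and $t>0$, and let $Z$ be a centred Gaussian process (Gaussian random element of $L^2(\mathbb S^2)$) with the same covariance operator as $T_{\ell;t}$. Then $$d_{3,L^2(\mathbb S^2)}(T_{\ell;t},Z)\le\left(\frac14+\sqrt\pi\right)\sqrt{\frac{4\pi}{\nu_t}}.$$
   Context: Let $\mu$ be the Lebesgue (surface) measure on the unit sphere $\mathbb S^2\subset\mathbb R^3$, so $\mu(\mathbb S^2)=4\pi$; $L^2(\mathbb S^2)=L^2(\mathbb S^2,\mu)$. For $t>0$ let $\nu_t>0$ be the rate and let $N_t$ be a Poisson random measure on $\mathbb S^2$ with intensity measure $\nu_t\,\mu$. Let $P_\ell$ be the Legendre polynomial of degree $\ell$ (normalized by $P_\ell(1)=1$). The Poisson spherical random wave is $$T_{\ell;t}(x)=\frac{1}{\sqrt{\nu_t}}\int_{\mathbb S^2}\sqrt{\frac{2\ell+1}{4\pi}}\,P_\ell(\langle x,\xi\rangle)\,dN_t(\xi),\qquad x\in\mathbb S^2,$$ regarded as a random element of $L^2(\mathbb S^2)$. The covariance operator of a centred $K$-valued random variable $X$ ($K$ a separable Hilbert space, $\mathbb E\|X\|_K^2<\infty$) is $Su=\mathbb E[\langle X,u\rangle_KX]$. For a Hilbert space $K$, $C_b^3(K)$ is the class of real-valued functions on $K$ with bounded Fréchet derivatives up to order three, with $\|h\|_{C_b^3(K)}=\sup_{j=1,2,3}\sup_{x\in K}\|D^jh(x)\|_{K^{\otimes j}}$. For random elements $X,Y$ of $K$, $$d_{3,K}(X,Y)=\sup\{|\mathbb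 E[h(X)]-\mathbb E[h(Y)]|:h\in C_b^3(K),\ \|h\|_{C_b^3(K)}\le1\}.$$ *)

theory Defs
  imports "HOL-Probability.Probability" "HOL-Computational_Algebra.Polynomial"
begin

section \<open>Surface measure on the unit sphere\<close>

text \<open>
  The surface measure is given by polar decomposition of Lebesgue measure in dimension three:
  the mass of a set \<open>A\<close> of unit vectors is three times the volume of the cone
  \<open>{r *\<^sub>R x | r x. 0 < r \<and> r < 1 \<and> x \<in> A}\<close>.
\<close>

definition sphere_measure :: "(real^3) measure" where
  "sphere_measure =
     distr (scale_measure 3 (restrict_space lborel (ball 0 1 - {0})))
       (restrict_space borel (sphere 0 1)) (\<lambda>x. x /\<^sub>R norm x)"

lemma space_sphere_measure [simp]: "space sphere_measure = sphere 0 1"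
  by (simp add: sphere_measure_def space_restrict_space)

lemma sets_sphere_measure [measurable_cong]:
  "sets sphere_measure = sets (restrict_space borel (sphere 0 1))"
  by (simp add: sphere_measure_def)

lemma emeasure_sphere_measure_space: "emeasure sphere_measure (sphere 0 1) = ennreal (4 * pi)"
proof -
  let ?B = "ball (0 :: real^3) 1 - {0}"
  have B: "?B \<in> sets lborel" by simp
  have m0: "(\<lambda>x :: real^3. x /\<^sub>R norm x) \<in> restrict_space lborel ?B \<rightarrow>\<^sub>M restrict_space borel (sphere 0 1)"
    by (intro measurable_restrict_space2 measurable_restrict_space1)
       (auto simp: space_restrict_space)
  have m: "(\<lambda>x :: real^3. x /\<^sub>R norm x) \<in> scale_measure 3 (restrict_space lborel ?B) \<rightarrow>\<^sub>M restrict_space borel (sphere 0 1)"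
    using m0 by (simp cong: measurable_cong_sets)
  have vimage: "(\<lambda>x :: real^3. x /\<^sub>R norm x) -` sphere 0 1 \<inter> ?B = ?B"
    by auto
  have "emeasure sphere_measure (sphere 0 1) = 3 * emeasure lborel ?B"
    unfolding sphere_measure_def
    by (subst emeasure_distr[OF m])
       (auto simp: sets_restrict_space space_restrict_space space_scale_measure
          emeasure_restrict_space vimage)
  also have "emeasure lborel ?B = emeasure lborel (ball (0 :: real^3) 1)"
    by (rule emeasure_Diff_null_set) auto
  also have "\<dots> = ennreal (4 / 3 * pi)"
    by (simp add: emeasure_ball unit_ball_vol_3)
  also have "3 * ennreal (4 / 3 * pi) = ennreal (4 * pi)"
    using ennreal_mult'[of 3 "4 / 3 * pi"] by simp
  finally show ?thesis .
qed

interpretation sphere_measure: finite_measure sphere_measure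
  by standard (simp add: emeasure_sphere_measure_space)


section \<open>The Hilbert space of square-integrable functions on the sphere\<close>

definition square_integrable_sphere :: "(real^3 \<Rightarrow> real) \<Rightarrow> bool" where
  "square_integrable_sphere f \<longleftrightarrow>
     f \<in> borel_measurable sphere_measure \<and> integrable sphere_measure (\<lambda>x. (f x)\<^sup>2)"

definition ae_eq_sphere :: "(real^3 \<Rightarrow> real) \<Rightarrow> (real^3 \<Rightarrow> real) \<Rightarrow> bool" where
  "ae_eq_sphere f g \<longleftrightarrow>
     square_integrable_sphere f \<and> square_integrable_sphere g \<and> (AE x in sphere_measure. f x = g x)"

lemma ae_eq_sphere_refl: "ae_eq_sphere f f \<longleftrightarrow> square_integrable_sphere f"
  by (simp add: ae_eq_sphere_def)

quotient_type sphere_L2 = "real^3 \<Rightarrow> real" / partial: ae_eq_sphere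
proof (rule part_equivpI)
  show "\<exists>f. ae_eq_sphere f f"
    by (auto simp: ae_eq_sphere_def square_integrable_sphere_def intro!: exI[of _ "\<lambda>_. 0"])
  show "symp ae_eq_sphere"
    by (auto simp: symp_def ae_eq_sphere_def)
  show "transp ae_eq_sphere"
    unfolding transp_def ae_eq_sphere_def by (auto elim: eventually_elim2)
qed

lemma square_integrable_sphere_measurable [measurable_dest]:
  "square_integrable_sphere f \<Longrightarrow> f \<in> borel_measurable sphere_measure"
  by (simp add: square_integrable_sphere_def)

lemma square_integrable_sphere_mult:
  assumes "square_integrable_sphere f" "square_integrable_sphere g"
  shows "integrable sphere_measure (\<lambda>x. f x * g x)"
proof (rule Bochner_Integration.integrable_bound)
  show "integrable sphere_measure (\<lambda>x. (f x)\<^sup>2 + (g x)\<^sup>2)"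
    using assms by (auto simp: square_integrable_sphere_def)
  show "(\<lambda>x. f x * g x) \<in> borel_measurable sphere_measure"
    using assms[THEN square_integrable_sphere_measurable] by simp
  have "\<bar>a * b\<bar> \<le> \<bar>a\<^sup>2 + b\<^sup>2\<bar>" for a b :: real
  proof -
    have "0 \<le> (\<bar>a\<bar> - \<bar>b\<bar>)\<^sup>2" by simp
    then have "2 * \<bar>a * b\<bar> \<le> a\<^sup>2 + b\<^sup>2"
      by (simp add: power2_diff abs_mult)
    then show ?thesis by linarith
  qed
  then show "AE x in sphere_measure. norm (f x * g x) \<le> norm ((f x)\<^sup>2 + (g x)\<^sup>2)"
    by simp
qed

lemma square_integrable_sphere_add:
  assumes "square_integrable_sphere f" "square_integrable_sphere g"
  shows "square_integrable_sphere (\<lambda>x. f x + g x)"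
  using assms square_integrable_sphere_mult[OF assms]
    assms[THEN square_integrable_sphere_measurable]
  by (auto simp: square_integrable_sphere_def power2_sum mult.assoc)

lemma square_integrable_sphere_cmult:
  assumes "square_integrable_sphere f"
  shows "square_integrable_sphere (\<lambda>x. c * f x)"
  using assms by (auto simp: square_integrable_sphere_def power_mult_distrib)

lemma square_integrable_sphere_diff:
  assumes "square_integrable_sphere f" "square_integrable_sphere g"
  shows "square_integrable_sphere (\<lambda>x. f x - g x)"
  using square_integrable_sphere_add[OF assms(1) square_integrable_sphere_cmult[OF assms(2), of "-1"]]
  by simp

lemma square_integrable_sphere_zero: "square_integrable_sphere (\<lambda>_. 0)"
  by (simp add: square_integrable_sphere_def)

lemma square_integrable_sphere_bounded:
  assumes "f \<in> borel_measurable sphere_measure" "\<And>x. x \<in> sphere 0 1 \<Longrightarrow> \<bar>f x\<bar> \<le> C"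
  shows "square_integrable_sphere f"
  unfolding square_integrable_sphere_def
proof (intro conjI sphere_measure.integrable_const_bound[where B = "C\<^sup>2"] AE_I2)
  fix x :: "real^3" assume "x \<in> space sphere_measure"
  then show "norm ((f x)\<^sup>2) \<le> C\<^sup>2"
    using power_mono[OF assms(2)[of x], of 2] by simp
qed (use assms(1) in auto)

instantiation sphere_L2 :: real_inner
begin

lift_definition zero_sphere_L2 :: sphere_L2 is "\<lambda>_. 0"
  by (simp add: ae_eq_sphere_def square_integrable_sphere_zero)

lift_definition plus_sphere_L2 :: "sphere_L2 \<Rightarrow> sphere_L2 \<Rightarrow> sphere_L2" is "\<lambda>f g x. f x + g x"
  by (auto simp: ae_eq_sphere_def intro: square_integrable_sphere_add)

lift_definition minus_sphere_L2 :: "sphere_L2 \<Rightarrow> sphere_L2 \<Rightarrow> sphere_L2" is "\<lambda>f g x. f x - g x"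
  by (auto simp: ae_eq_sphere_def intro: square_integrable_sphere_diff)

lift_definition uminus_sphere_L2 :: "sphere_L2 \<Rightarrow> sphere_L2" is "\<lambda>f x. - f x"
  using square_integrable_sphere_cmult[of _ "-1"] by (auto simp: ae_eq_sphere_def)

lift_definition scaleR_sphere_L2 :: "real \<Rightarrow> sphere_L2 \<Rightarrow> sphere_L2" is "\<lambda>c f x. c * f x"
  by (auto simp: ae_eq_sphere_def intro: square_integrable_sphere_cmult)

lift_definition inner_sphere_L2 :: "sphere_L2 \<Rightarrow> sphere_L2 \<Rightarrow> real" is
  "\<lambda>f g. LINT x|sphere_measure. f x * g x"
  unfolding ae_eq_sphere_def
  by (rule Bochner_Integration.integral_cong_AE) auto

definition norm_sphere_L2 :: "sphere_L2 \<Rightarrow> real" where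
  "norm_sphere_L2 f = sqrt (inner f f)"

definition dist_sphere_L2 :: "sphere_L2 \<Rightarrow> sphere_L2 \<Rightarrow> real" where
  "dist_sphere_L2 f g = norm (f - g)"

definition sgn_sphere_L2 :: "sphere_L2 \<Rightarrow> sphere_L2" where
  "sgn_sphere_L2 f = inverse (norm f) *\<^sub>R f"

definition uniformity_sphere_L2 :: "(sphere_L2 \<times> sphere_L2) filter" where
  "uniformity_sphere_L2 = (INF e\<in>{0 <..}. principal {(f, g). dist f g < e})"

definition open_sphere_L2 :: "sphere_L2 set \<Rightarrow> bool" where
  "open_sphere_L2 U \<longleftrightarrow> (\<forall>f\<in>U. eventually (\<lambda>(f', g). f' = f \<longrightarrow> g \<in> U) uniformity)"

instance
proof
  fix f g h :: sphere_L2 and a b :: real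
  show "f + g + h = f + (g + h)"
    by transfer (auto simp: ae_eq_sphere_def add.assoc intro!: square_integrable_sphere_add)
  show "f + g = g + f"
    by transfer (auto simp: ae_eq_sphere_def add.commute intro!: square_integrable_sphere_add)
  show "0 + f = f"
    by transfer (auto simp: ae_eq_sphere_def)
  show "- f + f = 0"
    by transfer (auto simp: ae_eq_sphere_def square_integrable_sphere_zero)
  show "f - g = f + - g"
    by transfer (auto simp: ae_eq_sphere_def intro!: square_integrable_sphere_diff)
  show "a *\<^sub>R (f + g) = a *\<^sub>R f + a *\<^sub>R g"
    by transfer (auto simp: ae_eq_sphere_def distrib_left
      intro!: square_integrable_sphere_add square_integrable_sphere_cmult)
  show "(a + b) *\<^sub>R f = a *\<^sub>R f + b *\<^sub>R f"
    by transfer (auto simp: ae_eq_sphere_def distrib_right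
      intro!: square_integrable_sphere_add square_integrable_sphere_cmult)
  show "a *\<^sub>R b *\<^sub>R f = (a * b) *\<^sub>R f"
    by transfer (auto simp: ae_eq_sphere_def mult.assoc intro!: square_integrable_sphere_cmult)
  show "1 *\<^sub>R f = f"
    by transfer (auto simp: ae_eq_sphere_def)
  show "dist f g = norm (f - g)"
    by (rule dist_sphere_L2_def)
  show "sgn f = inverse (norm f) *\<^sub>R f"
    by (rule sgn_sphere_L2_def)
  show "uniformity = (INF e\<in>{0 <..}. principal {(f :: sphere_L2, g). dist f g < e})"
    by (rule uniformity_sphere_L2_def)
  show "open U = (\<forall>f\<in>U. eventually (\<lambda>(f', g). f' = f \<longrightarrow> g \<in> U) uniformity)" for U :: "sphere_L2 set"
    by (rule open_sphere_L2_def)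
  show "inner f g = inner g f"
    by transfer (simp add: mult.commute)
  show "inner (f + g) h = inner f h + inner g h"
    by transfer (auto simp: ae_eq_sphere_refl distrib_right square_integrable_sphere_mult)
  show "inner (a *\<^sub>R f) g = a * inner f g"
    by transfer (simp add: mult.assoc)
  show "0 \<le> inner f f"
    by transfer simp
  show "inner f f = 0 \<longleftrightarrow> f = 0"
  proof transfer
    fix f assume "ae_eq_sphere f f"
    then have f: "square_integrable_sphere f" by (simp add: ae_eq_sphere_refl)
    have "(LINT x|sphere_measure. f x * f x) = 0 \<longleftrightarrow> (AE x in sphere_measure. f x * f x = 0)"
      by (rule integral_nonneg_eq_0_iff_AE[OF square_integrable_sphere_mult[OF f f]]) simp
    then show "(LINT x|sphere_measure. f x * f x) = 0 \<longleftrightarrow> ae_eq_sphere f (\<lambda>_. 0)"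
      using f by (simp add: ae_eq_sphere_def square_integrable_sphere_zero)
  qed
  show "norm f = sqrt (inner f f)"
    by (rule norm_sphere_L2_def)
qed

end

lemma abs_sphere_L2_eqI:
  assumes "square_integrable_sphere f" "square_integrable_sphere g"
    and "AE x in sphere_measure. f x = g x"
  shows "abs_sphere_L2 f = abs_sphere_L2 g"
  using assms by (intro Quotient3_rel_abs[OF Quotient3_sphere_L2]) (simp add: ae_eq_sphere_def)

lemma square_integrable_rep_sphere_L2: "square_integrable_sphere (rep_sphere_L2 u)"
  using Quotient3_rep_reflp[OF Quotient3_sphere_L2, of u] by (simp add: ae_eq_sphere_def)

lemma abs_rep_sphere_L2: "abs_sphere_L2 (rep_sphere_L2 u) = u"
  by (rule Quotient3_abs_rep[OF Quotient3_sphere_L2])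

lemma
  assumes "square_integrable_sphere f" "square_integrable_sphere g"
  shows plus_abs_sphere_L2: "abs_sphere_L2 f + abs_sphere_L2 g = abs_sphere_L2 (\<lambda>x. f x + g x)"
    and diff_abs_sphere_L2: "abs_sphere_L2 f - abs_sphere_L2 g = abs_sphere_L2 (\<lambda>x. f x - g x)"
    and inner_abs_sphere_L2: "inner (abs_sphere_L2 f) (abs_sphere_L2 g) = (LINT x|sphere_measure. f x * g x)"
  using assms by (auto simp: plus_sphere_L2.abs_eq minus_sphere_L2.abs_eq inner_sphere_L2.abs_eq ae_eq_sphere_refl)

lemma scaleR_abs_sphere_L2:
  "square_integrable_sphere f \<Longrightarrow> c *\<^sub>R abs_sphere_L2 f = abs_sphere_L2 (\<lambda>x. c * f x)"
  by (simp add: scaleR_sphere_L2.abs_eq ae_eq_sphere_refl)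

lemma norm_abs_sphere_L2:
  "square_integrable_sphere f \<Longrightarrow> (norm (abs_sphere_L2 f))\<^sup>2 = (LINT x|sphere_measure. (f x)\<^sup>2)"
  unfolding power2_norm_eq_inner by (simp add: inner_abs_sphere_L2 power2_eq_square)

lemma nn_integral_sphere_L2:
  assumes "square_integrable_sphere f"
  shows "(\<integral>\<^sup>+x. ennreal ((f x)\<^sup>2) \<partial>sphere_measure) = ennreal ((norm (abs_sphere_L2 f))\<^sup>2)"
  using assms unfolding norm_abs_sphere_L2[OF assms]
  by (intro nn_integral_eq_integral) (auto simp: square_integrable_sphere_def)

lemma nn_integral_abs_sphere_L2_le:
  assumes "square_integrable_sphere f"
  shows "(\<integral>\<^sup>+x. ennreal \<bar>f x\<bar> \<partial>sphere_measure) \<le> ennreal (norm (abs_sphere_L2 (\<lambda>_. 1)) * norm (abs_sphere_L2 f))"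
proof -
  have 1: "square_integrable_sphere (\<lambda>_. 1)"
    by (rule square_integrable_sphere_bounded[of _ 1]) auto
  have a: "square_integrable_sphere (\<lambda>x. \<bar>f x\<bar>)"
    using assms by (auto simp: square_integrable_sphere_def)
  have i: "integrable sphere_measure (\<lambda>x. \<bar>f x\<bar>)"
    using square_integrable_sphere_mult[OF 1 a] by simp
  have "(LINT x|sphere_measure. \<bar>f x\<bar>) = inner (abs_sphere_L2 (\<lambda>_. 1)) (abs_sphere_L2 (\<lambda>x. \<bar>f x\<bar>))"
    by (simp add: inner_abs_sphere_L2[OF 1 a])
  also have "\<dots> \<le> norm (abs_sphere_L2 (\<lambda>_. 1)) * norm (abs_sphere_L2 (\<lambda>x. \<bar>f x\<bar>))"
    by (rule norm_cauchy_schwarz)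
  also have "norm (abs_sphere_L2 (\<lambda>x. \<bar>f x\<bar>)) = norm (abs_sphere_L2 f)"
    by (rule power2_eq_imp_eq) (simp_all add: norm_abs_sphere_L2 a assms)
  finally show ?thesis
    by (subst nn_integral_eq_integral[OF i]) (auto intro: ennreal_leI)
qed

lemma sphere_L2_dominated_convergence:
  assumes F: "\<And>n. F n \<in> borel_measurable sphere_measure" and f: "f \<in> borel_measurable sphere_measure"
    and w: "square_integrable_sphere w"
    and lim: "\<And>x. x \<in> sphere 0 1 \<Longrightarrow> (\<lambda>n. F n x) \<longlonglongrightarrow> f x"
    and bd: "\<And>n x. x \<in> sphere 0 1 \<Longrightarrow> \<bar>F n x\<bar> \<le> w x"
  shows "square_integrable_sphere f" "\<And>n. square_integrable_sphere (F n)"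
    "(\<lambda>n. abs_sphere_L2 (F n)) \<longlonglongrightarrow> abs_sphere_L2 f"
proof -
  have le: "\<bar>f x\<bar> \<le> w x" if "x \<in> sphere 0 1" for x
    by (rule tendsto_upperbound[OF tendsto_rabs[OF lim[OF that]]]) (simp_all add: bd[OF that])
  have sq: "square_integrable_sphere g"
    if "g \<in> borel_measurable sphere_measure" "\<And>x. x \<in> sphere 0 1 \<Longrightarrow> \<bar>g x\<bar> \<le> w x" for g
    unfolding square_integrable_sphere_def
  proof
    show "integrable sphere_measure (\<lambda>x. (g x)\<^sup>2)"
    proof (rule Bochner_Integration.integrable_bound)
      show "integrable sphere_measure (\<lambda>x. (w x)\<^sup>2)"
        using w by (simp add: square_integrable_sphere_def)
      show "AE x in sphere_measure. norm ((g x)\<^sup>2) \<le> norm ((w x)\<^sup>2)"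
      proof (rule AE_I2)
        fix x :: "real^3" assume "x \<in> space sphere_measure"
        then have "\<bar>g x\<bar>\<^sup>2 \<le> (w x)\<^sup>2"
          by (intro power_mono that) auto
        then show "norm ((g x)\<^sup>2) \<le> norm ((w x)\<^sup>2)" by simp
      qed
    qed (use that(1) in simp)
  qed (rule that(1))
  show sf: "square_integrable_sphere f" by (rule sq[OF f le])
  show sF: "square_integrable_sphere (F n)" for n by (rule sq[OF F bd])
  have "(\<lambda>n. LINT x|sphere_measure. (F n x - f x)\<^sup>2) \<longlonglongrightarrow> (LINT x|sphere_measure. 0)"
  proof (rule integral_dominated_convergence[where w = "\<lambda>x. (2 * w x)\<^sup>2"])
    show "integrable sphere_measure (\<lambda>x. (2 * w x)\<^sup>2)"
      using square_integrable_sphere_cmult[OF w, of 2] by (simp add: square_integrable_sphere_def)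
    show "AE x in sphere_measure. (\<lambda>n. (F n x - f x)\<^sup>2) \<longlonglongrightarrow> 0"
    proof (rule AE_I2)
      fix x :: "real^3" assume "x \<in> space sphere_measure"
      then have "(\<lambda>n. F n x - f x) \<longlonglongrightarrow> f x - f x"
        by (intro tendsto_intros lim) simp
      from tendsto_power[OF this, of 2] show "(\<lambda>n. (F n x - f x)\<^sup>2) \<longlonglongrightarrow> 0" by simp
    qed
    show "AE x in sphere_measure. norm ((F n x - f x)\<^sup>2) \<le> (2 * w x)\<^sup>2" for n
    proof (rule AE_I2)
      fix x :: "real^3" assume "x \<in> space sphere_measure"
      then have "\<bar>F n x - f x\<bar> \<le> 2 * w x"
        using bd[of x n] le[of x] by simp
      from power_mono[OF this, of 2] show "norm ((F n x - f x)\<^sup>2) \<le> (2 * w x)\<^sup>2" by simp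
    qed
  qed (use F f in simp_all)
  moreover have "(norm (abs_sphere_L2 (F n) - abs_sphere_L2 f))\<^sup>2 = (LINT x|sphere_measure. (F n x - f x)\<^sup>2)" for n
    by (simp add: diff_abs_sphere_L2 norm_abs_sphere_L2 sF sf square_integrable_sphere_diff)
  ultimately have "(\<lambda>n. (norm (abs_sphere_L2 (F n) - abs_sphere_L2 f))\<^sup>2) \<longlonglongrightarrow> 0" by simp
  from tendsto_real_sqrt[OF this] have "(\<lambda>n. norm (abs_sphere_L2 (F n) - abs_sphere_L2 f)) \<longlonglongrightarrow> 0" by simp
  then show "(\<lambda>n. abs_sphere_L2 (F n)) \<longlonglongrightarrow> abs_sphere_L2 f"
    by (rule LIM_zero_cancel[OF tendsto_norm_zero_cancel])
qed

instance sphere_L2 :: banach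
proof
  fix X :: "nat \<Rightarrow> sphere_L2" assume X: "Cauchy X"
  define F where "F n = rep_sphere_L2 (X n)" for n
  have F: "square_integrable_sphere (F n)" and XF: "X n = abs_sphere_L2 (F n)" for n
    by (simp_all add: F_def square_integrable_rep_sphere_L2 abs_rep_sphere_L2)
  note [measurable] = F[THEN square_integrable_sphere_measurable]
  have nX: "norm (X m - X n) = norm (abs_sphere_L2 (\<lambda>x. F m x - F n x))" for m n
    by (simp add: XF diff_abs_sphere_L2 F)
  have "\<forall>k. \<exists>N. \<forall>m\<ge>N. \<forall>n\<ge>N. norm (X m - X n) < (1/2)^k"
    using X unfolding Cauchy_iff by (metis half_gt_zero_iff zero_less_one zero_less_power)
  then obtain N where N: "\<And>k m n. m \<ge> N k \<Longrightarrow> n \<ge> N k \<Longrightarrow> norm (X m - X n) < (1/2)^k"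
    by metis
  define r where "r k = k + (\<Sum>i\<le>k. N i)" for k
  have rN: "r k \<ge> N k" "r (Suc k) \<ge> N k" "r k \<ge> k" for k
    unfolding r_def by (induction k) auto
  define d where "d k x = F (r (Suc k)) x - F (r k) x" for k x
  have d: "square_integrable_sphere (d k)" for k
    unfolding d_def by (intro square_integrable_sphere_diff F)
  note [measurable] = d[THEN square_integrable_sphere_measurable]
  let ?C = "norm (abs_sphere_L2 (\<lambda>_. 1))"
  have nd: "norm (abs_sphere_L2 (d k)) \<le> (1/2)^k" for k
    using N[of k "r (Suc k)" "r k"] rN[of k] unfolding nX d_def by simp
  have "(\<integral>\<^sup>+x. (\<Sum>k. ennreal \<bar>d k x\<bar>) \<partial>sphere_measure) = (\<Sum>k. \<integral>\<^sup>+x. ennreal \<bar>d k x\<bar> \<partial>sphere_measure)"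
    by (rule nn_integral_suminf) simp
  also have "\<dots> \<le> (\<Sum>k. ennreal (?C * (1/2)^k))"
    by (intro suminf_le order_trans[OF nn_integral_abs_sphere_L2_le[OF d]] ennreal_leI mult_left_mono nd) auto
  also have "\<dots> = ennreal (\<Sum>k. ?C * (1/2)^k)"
    by (rule suminf_ennreal2) (auto intro!: summable_mult summable_geometric)
  also have "\<dots> < \<infinity>" by simp
  finally have "AE x in sphere_measure. (\<Sum>k. ennreal \<bar>d k x\<bar>) \<noteq> \<infinity>"
    by (intro nn_integral_noteq_infinite) auto
  then have conv: "AE x in sphere_measure. convergent (\<lambda>k. F (r k) x)"
  proof (rule AE_mp, intro AE_I2 impI)
    fix x assume "(\<Sum>k. ennreal \<bar>d k x\<bar>) \<noteq> \<infinity>"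
    then have "summable (\<lambda>k. \<bar>d k x\<bar>)"
      by (intro summable_suminf_not_top) auto
    then have "summable (\<lambda>k. d k x)"
      by (rule summable_rabs_cancel)
    then have "convergent (\<lambda>n. \<Sum>k<n. d k x)"
      by (simp add: summable_iff_convergent)
    moreover have "(\<Sum>k<n. d k x) = F (r n) x - F (r 0) x" for n
      unfolding d_def by (rule sum_lessThan_telescope)
    ultimately have "convergent (\<lambda>n. F (r n) x - F (r 0) x)" by simp
    from convergent_add[OF this convergent_const[of "F (r 0) x"]]
    show "convergent (\<lambda>k. F (r k) x)" by simp
  qed
  define f where "f x = lim (\<lambda>k. F (r k) x)" for x
  have [measurable]: "f \<in> borel_measurable sphere_measure"
    unfolding f_def by measurable
  have lim: "AE x in sphere_measure. (\<lambda>k. F (r k) x) \<longlonglongrightarrow> f x"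
    using conv by (auto simp: f_def convergent_LIMSEQ_iff)
  have key: "(\<integral>\<^sup>+x. ennreal ((f x - F m x)\<^sup>2) \<partial>sphere_measure) \<le> ennreal (((1/2)^j)\<^sup>2)" if m: "m \<ge> N j" for m j
  proof -
    have "(\<integral>\<^sup>+x. ennreal ((f x - F m x)\<^sup>2) \<partial>sphere_measure)
        = (\<integral>\<^sup>+x. liminf (\<lambda>k. ennreal ((F (r k) x - F m x)\<^sup>2)) \<partial>sphere_measure)"
    proof (rule nn_integral_cong_AE, rule AE_mp[OF lim], intro AE_I2 impI)
      fix x assume "(\<lambda>k. F (r k) x) \<longlonglongrightarrow> f x"
      then have "(\<lambda>k. ennreal ((F (r k) x - F m x)\<^sup>2)) \<longlonglongrightarrow> ennreal ((f x - F m x)\<^sup>2)"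
        by (intro tendsto_ennrealI tendsto_intros)
      then show "ennreal ((f x - F m x)\<^sup>2) = liminf (\<lambda>k. ennreal ((F (r k) x - F m x)\<^sup>2))"
        by (intro lim_imp_Liminf[symmetric]) auto
    qed
    also have "\<dots> \<le> liminf (\<lambda>k. \<integral>\<^sup>+x. ennreal ((F (r k) x - F m x)\<^sup>2) \<partial>sphere_measure)"
      by (rule nn_integral_liminf) simp
    also have "\<dots> \<le> limsup (\<lambda>k. \<integral>\<^sup>+x. ennreal ((F (r k) x - F m x)\<^sup>2) \<partial>sphere_measure)"
      by (rule Liminf_le_Limsup) simp
    also have "\<dots> \<le> ennreal (((1/2)^j)\<^sup>2)"
    proof (rule Limsup_bounded, rule eventually_sequentiallyI[of "N j"])
      fix k assume "k \<ge> N j"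
      then have "norm (X (r k) - X m) < (1/2)^j"
        using N[of j "r k" m] rN(3)[of k] m by simp
      then have "(norm (X (r k) - X m))\<^sup>2 \<le> ((1/2)^j)\<^sup>2"
        by (intro power_mono) auto
      then show "(\<integral>\<^sup>+x. ennreal ((F (r k) x - F m x)\<^sup>2) \<partial>sphere_measure) \<le> ennreal (((1/2)^j)\<^sup>2)"
        unfolding nX by (subst nn_integral_sphere_L2) (auto intro: square_integrable_sphere_diff F ennreal_leI)
    qed
    finally show ?thesis .
  qed
  have df: "square_integrable_sphere (\<lambda>x. f x - F m x)" if m: "m \<ge> N j" for m j
    unfolding square_integrable_sphere_def
    using key[OF m] by (auto intro!: integrableI_bounded simp: le_less_trans[OF _ ennreal_less_top])
  have f: "square_integrable_sphere f"
    using square_integrable_sphere_add[OF df[of 0 "N 0"] F[of "N 0"]] by simp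
  have "X \<longlonglongrightarrow> abs_sphere_L2 f"
  proof (rule metric_LIMSEQ_I)
    fix e :: real assume "0 < e"
    then obtain j where j: "(1/2)^j < e"
      using real_arch_pow_inv[of e "1/2"] by auto
    show "\<exists>n0. \<forall>n\<ge>n0. dist (X n) (abs_sphere_L2 f) < e"
    proof (intro exI[of _ "N j"] allI impI)
      fix n assume n: "n \<ge> N j"
      have "ennreal ((norm (abs_sphere_L2 f - X n))\<^sup>2) \<le> ennreal (((1/2)^j)\<^sup>2)"
        using key[OF n] nn_integral_sphere_L2[OF df[OF n]] by (simp add: XF diff_abs_sphere_L2 F f)
      then have "(norm (abs_sphere_L2 f - X n))\<^sup>2 \<le> ((1/2)^j)\<^sup>2"
        by (subst (asm) ennreal_le_iff) auto
      then have "norm (abs_sphere_L2 f - X n) \<le> (1/2)^j"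
        by (rule power2_le_imp_le) auto
      then show "dist (X n) (abs_sphere_L2 f) < e"
        using j by (simp add: dist_norm norm_minus_commute)
    qed
  qed
  then show "convergent X" by (rule convergentI)
qed

lemma second_countable_if_countable_dense:
  fixes D :: "'a::metric_space set"
  assumes "countable D" "closure D = UNIV"
  shows "\<exists>B::'a set set. countable B \<and> open = generate_topology B"
proof (intro exI conjI)
  let ?B = "(\<lambda>(x, n). ball x (1 / Suc n)) ` (D \<times> (UNIV :: nat set))"
  show "countable ?B" using assms(1) by auto
  show "open = generate_topology ?B"
  proof (rule topological_basis_imp_subbasis, rule topological_basisI)
    fix U :: "'a set" and x assume "open U" "x \<in> U"
    then obtain e where e: "e > 0" "ball x e \<subseteq> U"
      by (meson open_contains_ball)
    obtain n where n: "1 / Suc n < e / 2"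
      using e(1) nat_approx_posE[of "e / 2"] by auto
    obtain y where y: "y \<in> D" "dist y x < 1 / Suc n"
      using assms(2) closure_approachable[of x D] by (metis UNIV_I of_nat_0_less_iff zero_less_Suc zero_less_divide_1_iff)
    have "ball y (1 / Suc n) \<subseteq> ball x e"
    proof
      fix z assume "z \<in> ball y (1 / Suc n)"
      then have "dist y z < 1 / Suc n" by simp
      moreover have "dist x z \<le> dist y x + dist y z"
        by (metis dist_commute dist_triangle)
      ultimately show "z \<in> ball x e" using n y(2) by simp
    qed
    then show "\<exists>B'\<in>?B. x \<in> B' \<and> B' \<subseteq> U"
      using y e(2) by (intro bexI[of _ "ball y (1 / Suc n)"]) auto
  qed auto
qed

instance sphere_L2 :: second_countable_topology
proof
  obtain B0 :: "(real^3) set set" where B0: "countable B0" "topological_basis B0"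
    using ex_countable_basis by blast
  define G where "G = Inter ` {b. finite b \<and> b \<subseteq> B0}"
  have cG: "countable G"
    unfolding G_def by (intro countable_image countable_Collect_finite_subset B0)
  have openB0: "open U" if "U \<in> B0" for U
    using B0(2) that by (rule topological_basis_open)
  have openG: "open U" if "U \<in> G" for U
    using that openB0 by (auto simp: G_def intro!: open_Inter)
  have stable: "Int_stable G"
  proof (rule Int_stableI)
    fix a b assume "a \<in> G" "b \<in> G"
    then obtain x y where "a = \<Inter>x" "finite x" "x \<subseteq> B0" "b = \<Inter>y" "finite y" "y \<subseteq> B0"
      unfolding G_def by blast
    moreover have "\<Inter>x \<inter> \<Inter>y \<in> G" if "finite x" "x \<subseteq> B0" "finite y" "y \<subseteq> B0" for x y
      unfolding G_def using that by (intro image_eqI[of _ _ "x \<union> y"]) (auto simp: Inter_Un_distrib)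
    ultimately show "a \<inter> b \<in> G" by simp
  qed
  have "B0 \<subseteq> G"
  proof
    fix U assume "U \<in> B0"
    then show "U \<in> G"
      unfolding G_def by (intro image_eqI[of _ _ "{U}"]) auto
  qed
  have univG: "UNIV \<in> G"
    unfolding G_def by (rule image_eqI[of _ _ "{}"]) auto
  have borelG: "sets (borel :: (real^3) measure) = sigma_sets UNIV G"
  proof -
    have "sets (borel :: (real^3) measure) = sigma_sets UNIV B0"
      by (subst borel_eq_countable_basis[OF B0]) simp
    also have "\<dots> \<subseteq> sigma_sets UNIV G"
      by (rule sigma_sets_mono') fact
    finally have "sets (borel :: (real^3) measure) \<subseteq> sigma_sets UNIV G" .
    moreover have "sigma_sets UNIV G \<subseteq> sets (borel :: (real^3) measure)"
      by (rule sets.sigma_sets_subset[where M = borel, simplified]) (use openG in \<open>blast intro: borel_open\<close>)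
    ultimately show ?thesis by blast
  qed
  define ind :: "(real^3) set \<Rightarrow> sphere_L2" where "ind A = abs_sphere_L2 (indicator A)" for A
  have ind_meas: "(indicator A :: real^3 \<Rightarrow> real) \<in> borel_measurable sphere_measure" if "A \<in> sets borel" for A
  proof -
    have "(indicator A :: real^3 \<Rightarrow> real) \<in> borel_measurable (restrict_space borel (sphere 0 1))"
      using that by (intro measurable_restrict_space1) simp
    then show ?thesis by (simp cong: measurable_cong_sets add: sets_sphere_measure)
  qed
  have one: "square_integrable_sphere (\<lambda>_. 1)"
    by (rule square_integrable_sphere_bounded[of _ 1]) auto
  have ind_sq: "square_integrable_sphere (indicator A)" if "A \<in> sets borel" for A
    using ind_meas[OF that] by (rule square_integrable_sphere_bounded[of _ 1]) (auto simp: indicator_def)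
  define comb where "comb xs = sum_list (map (\<lambda>(q :: rat, A). (of_rat q :: real) *\<^sub>R ind A) xs)" for xs
  define D where "D = comb ` lists (UNIV \<times> G)"
  have cD: "countable D"
    unfolding D_def by (intro countable_image countable_lists) (use cG in auto)
  define V where "V = closure D"
  have clV: "closed V" by (simp add: V_def)
  have addD: "x + y \<in> D" if "x \<in> D" "y \<in> D" for x y
  proof -
    from that obtain xs ys where "xs \<in> lists (UNIV \<times> G)" "x = comb xs" "ys \<in> lists (UNIV \<times> G)" "y = comb ys"
      by (auto simp: D_def)
    then show ?thesis
      unfolding D_def by (intro image_eqI[of _ _ "xs @ ys"]) (auto simp: comb_def)
  qed
  have scaleD: "(of_rat q :: real) *\<^sub>R x \<in> D" if "x \<in> D" for x q
  proof -
    from that obtain xs where xs: "xs \<in> lists (UNIV \<times> G)" "x = comb xs" by (auto simp: D_def)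
    have "(of_rat q :: real) *\<^sub>R comb ys = comb (map (\<lambda>(p, A). (q * p, A)) ys)" for ys
      by (induction ys) (auto simp: comb_def scaleR_right_distrib of_rat_mult)
    then show ?thesis
      unfolding D_def using xs by (intro image_eqI[of _ _ "map (\<lambda>(p, A). (q * p, A)) xs"]) (auto simp: in_lists_conv_set)
  qed
  have addV: "x + y \<in> V" if "x \<in> V" "y \<in> V" for x y
  proof -
    from that obtain s t where "\<forall>n. s n \<in> D" "s \<longlonglongrightarrow> x" "\<forall>n. t n \<in> D" "t \<longlonglongrightarrow> y"
      unfolding V_def closure_sequential by blast
    then show ?thesis
      unfolding V_def closure_sequential
      by (intro exI[of _ "\<lambda>n. s n + t n"]) (auto intro: addD tendsto_add)
  qed
  have scaleVrat: "(of_rat q :: real) *\<^sub>R x \<in> V" if "x \<in> V" for x q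
  proof -
    from that obtain s where "\<forall>n. s n \<in> D" "s \<longlonglongrightarrow> x"
      unfolding V_def closure_sequential by blast
    then show ?thesis
      unfolding V_def closure_sequential
      by (intro exI[of _ "\<lambda>n. of_rat q *\<^sub>R s n"]) (auto intro: scaleD tendsto_intros)
  qed
  have scaleV: "c *\<^sub>R x \<in> V" if "x \<in> V" for c x
  proof -
    have "c \<in> closure \<rat>" by (simp add: Rats_closure_real)
    then obtain s where s: "\<And>n. s n \<in> \<rat>" "s \<longlonglongrightarrow> c"
      unfolding closure_sequential by blast
    show ?thesis
    proof (rule closed_sequentially[OF clV])
      show "(\<lambda>n. s n *\<^sub>R x) \<longlonglongrightarrow> c *\<^sub>R x" using s(2) by (intro tendsto_intros)
      show "s n *\<^sub>R x \<in> V" for n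
        using s(1)[of n] that by (auto elim!: Rats_cases intro: scaleVrat)
    qed
  qed
  have zeroV: "0 \<in> V"
  proof -
    have "comb [] \<in> D" unfolding D_def by (intro imageI) auto
    then show ?thesis unfolding V_def comb_def using closure_subset by auto
  qed
  have indG: "ind A \<in> V" if "A \<in> G" for A
  proof -
    have "comb [(1, A)] \<in> D" unfolding D_def using that by (intro imageI) auto
    then show ?thesis unfolding V_def comb_def using closure_subset by auto
  qed
  have indV: "ind A \<in> V" if "A \<in> sets borel" for A
    using stable subset_UNIV[of G, folded Pow_UNIV] that[unfolded borelG]
  proof (induction rule: sigma_sets_induct_disjoint)
    case (basic A)
    then show ?case by (rule indG)
  next
    case empty
    have "ind {} = 0 *\<^sub>R ind UNIV"
      unfolding ind_def by (subst scaleR_abs_sphere_L2) (simp_all add: one indicator_def[abs_def])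
    then show ?case by (simp add: zeroV)
  next
    case (compl A)
    then have A: "A \<in> sets borel" by (simp add: borelG)
    have "ind (UNIV - A) = ind UNIV + (-1) *\<^sub>R ind A"
      unfolding ind_def
      by (subst scaleR_abs_sphere_L2, rule ind_sq[OF A],
          subst plus_abs_sphere_L2, rule ind_sq, simp, rule square_integrable_sphere_cmult, rule ind_sq[OF A],
          rule arg_cong[where f = abs_sphere_L2]) (auto simp: indicator_def)
    also have "\<dots> \<in> V"
      by (intro addV scaleV indG univG compl)
    finally show ?case .
  next
    case (union A)
    have A: "A i \<in> sets borel" for i
      using union(2) unfolding borelG by blast
    have UA: "(\<Union>i\<in>I. A i) \<in> sets borel" for I :: "nat set"
      using A by (intro sets.countable_UN') auto
    have part: "ind (\<Union>i<n. A i) \<in> V" for n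
    proof (induction n)
      case 0
      have "ind {} = 0 *\<^sub>R ind UNIV"
      unfolding ind_def by (subst scaleR_abs_sphere_L2) (simp_all add: one indicator_def[abs_def])
      then show ?case by (simp add: zeroV)
    next
      case (Suc n)
      have "A i \<inter> A n = {}" if "i < n" for i
        using union(1) that unfolding disjoint_family_on_def by (metis UNIV_I less_irrefl)
      then have "(\<Union>i<n. A i) \<inter> A n = {}" by blast
      then have eq: "indicator (\<Union>i<Suc n. A i) = (\<lambda>x. indicator (\<Union>i<n. A i) x + indicator (A n) x :: real)"
        by (simp add: lessThan_Suc Un_commute[of "A n"] indicator_add fun_eq_iff)
      have "ind (\<Union>i<Suc n. A i) = ind (\<Union>i<n. A i) + ind (A n)"
        unfolding ind_def eq by (intro plus_abs_sphere_L2[symmetric] ind_sq A UA)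
      also have "\<dots> \<in> V" by (intro addV Suc union)
      finally show ?case .
    qed
    have "(\<lambda>n. ind (\<Union>i<n. A i)) \<longlonglongrightarrow> ind (\<Union>i. A i)"
      unfolding ind_def
    proof (rule sphere_L2_dominated_convergence(3)[OF _ _ one])
      show "(\<lambda>n. indicator (\<Union>i<n. A i) x :: real) \<longlonglongrightarrow> indicator (\<Union>i. A i) x" for x
        by (rule LIMSEQ_indicator_UN)
    qed (intro ind_meas UA, intro ind_meas UA, simp add: indicator_def)
    then show ?case by (rule closed_sequentially[OF clV, rotated]) (rule part)
  qed
  have "closure D = UNIV"
  proof (rule UNIV_eq_I[symmetric])
    fix u :: sphere_L2
    let ?f = "rep_sphere_L2 u"
    have f: "square_integrable_sphere ?f" by (rule square_integrable_rep_sphere_L2)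
    then have fm: "?f \<in> borel_measurable sphere_measure" by (rule square_integrable_sphere_measurable)
    obtain F where F: "\<And>i. simple_function sphere_measure (F i)"
      "\<And>x. x \<in> space sphere_measure \<Longrightarrow> (\<lambda>i. F i x) \<longlonglongrightarrow> ?f x"
      "\<And>i x. x \<in> space sphere_measure \<Longrightarrow> dist (F i x) 0 \<le> 2 * dist (?f x) 0"
      using borel_measurable_implies_sequence_metric[OF fm, of 0] by blast
    have "square_integrable_sphere (\<lambda>x. \<bar>?f x\<bar>)"
      using f by (auto simp: square_integrable_sphere_def)
    from square_integrable_sphere_cmult[OF this, of 2]
    have w: "square_integrable_sphere (\<lambda>x. 2 * \<bar>?f x\<bar>)" .
    have Fm: "F i \<in> borel_measurable sphere_measure" for i
      using F(1) by (rule borel_measurable_simple_function)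
    note dc = sphere_L2_dominated_convergence[OF Fm fm w]
    have lim: "(\<lambda>i. abs_sphere_L2 (F i)) \<longlonglongrightarrow> abs_sphere_L2 ?f" and sqF: "\<And>i. square_integrable_sphere (F i)"
      using F(2,3) by (auto intro!: dc)
    have "abs_sphere_L2 (F i) \<in> V" for i
    proof -
      let ?R = "F i ` space sphere_measure"
      define A where "A y = F i -` {y} \<inter> space sphere_measure" for y
      have fin: "finite ?R" using F(1) by (rule simple_functionD)
      have Ab: "A y \<in> sets borel" for y
      proof -
        have "A y \<in> sets sphere_measure"
          unfolding A_def using F(1) by (rule simple_functionD)
        then show ?thesis
          by (auto simp: sets_sphere_measure sets_restrict_space)
      qed
      have sqA: "square_integrable_sphere (\<lambda>x. y * indicator (A y) x)" for y
        by (intro square_integrable_sphere_cmult ind_sq Ab)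
      have smA: "y *\<^sub>R ind (A y) = abs_sphere_L2 (\<lambda>x. y * indicator (A y) x)" for y
        unfolding ind_def by (intro scaleR_abs_sphere_L2 ind_sq Ab)
      have part: "(\<Sum>y\<in>S. y *\<^sub>R ind (A y)) \<in> V \<and> square_integrable_sphere (\<lambda>x. \<Sum>y\<in>S. y * indicator (A y) x)
         \<and> (\<Sum>y\<in>S. y *\<^sub>R ind (A y)) = abs_sphere_L2 (\<lambda>x. \<Sum>y\<in>S. y * indicator (A y) x)" if "finite S" for S
        using that
      proof induction
        case empty
        then show ?case
          by (simp add: zeroV square_integrable_sphere_zero zero_sphere_L2.abs_eq[symmetric])
      next
        case (insert y S)
        have "y *\<^sub>R ind (A y) + (\<Sum>y\<in>S. y *\<^sub>R ind (A y)) \<in> V"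
          using insert by (intro addV scaleV indV Ab) auto
        moreover have "square_integrable_sphere (\<lambda>x. y * indicator (A y) x + (\<Sum>y\<in>S. y * indicator (A y) x))"
          using insert by (intro square_integrable_sphere_add sqA) auto
        moreover have "y *\<^sub>R ind (A y) + (\<Sum>y\<in>S. y *\<^sub>R ind (A y))
            = abs_sphere_L2 (\<lambda>x. y * indicator (A y) x + (\<Sum>y\<in>S. y * indicator (A y) x))"
          using insert unfolding smA by (auto intro!: plus_abs_sphere_L2 sqA)
        ultimately show ?case
          unfolding sum.insert[OF insert.hyps] by blast
      qed
      have "abs_sphere_L2 (F i) = abs_sphere_L2 (\<lambda>x. \<Sum>y\<in>?R. y * indicator (A y) x)"
      proof (rule abs_sphere_L2_eqI[OF sqF], use part[OF fin] in blast, rule AE_I2)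
        fix x :: "real^3" assume x: "x \<in> space sphere_measure"
        have "(\<Sum>y\<in>?R. y * indicator (A y) x) = (\<Sum>y\<in>?R. if y = F i x then y else 0)"
          using x by (intro sum.cong) (auto simp: A_def indicator_def)
        also have "\<dots> = F i x" using fin x by simp
        finally show "F i x = (\<Sum>y\<in>?R. y * indicator (A y) x)" by simp
      qed
      then show ?thesis using part[OF fin] by metis
    qed
    from closed_sequentially[OF clV this lim] show "u \<in> closure D"
      by (simp add: abs_rep_sphere_L2 V_def)
  qed
  with cD show "\<exists>B::sphere_L2 set set. countable B \<and> open = generate_topology B"
    by (rule second_countable_if_countable_dense)
qed


section \<open>Poisson spherical random waves\<close>

text \<open>Rodrigues' formula.\<close>

definition legendre_poly :: "nat \<Rightarrow> real poly" where
  "legendre_poly n = smult (1 / (2 ^ n * fact n)) ((pderiv ^^ n) ([:-1, 0, 1:] ^ n))"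

lemma poly_legendre_poly_1: "poly (legendre_poly n) 1 = 1"
proof -
  have *: "poly ((pderiv ^^ n) ([:-1, 1:] ^ n * q)) 1 = fact n * poly q 1" for n and q :: "real poly"
  proof (induction n arbitrary: q)
    case (Suc n)
    have "pderiv ([:-1, 1:] ^ Suc n * q) =
        [:-1, 1:] ^ n * (smult (1 + real n) q + [:-1, 1:] * pderiv q)"
      by (simp add: pderiv_mult pderiv_power_Suc pderiv_pCons algebra_simps del: power_Suc)
         (simp add: algebra_simps)
    then show ?case
      by (simp only: funpow_Suc_right o_apply Suc.IH) (simp add: algebra_simps)
  qed simp
  have "[:-1, 0, 1:] = [:-1, 1:] * [:1, 1 :: real:]" by simp
  then have "[:-1, 0, 1 :: real:] ^ n = [:-1, 1:] ^ n * [:1, 1:] ^ n"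
    by (simp only: power_mult_distrib)
  then show ?thesis
    by (simp only: legendre_poly_def poly_smult *) (simp add: poly_power)
qed

text \<open>
  A Poisson random measure with finite intensity \<open>\<Lambda>\<close>, realized for every outcome as a finite
  counting measure. Independence is required for every finite family of disjoint sets.
\<close>

definition poisson_random_measure ::
    "'a measure \<Rightarrow> ('a \<Rightarrow> 'b measure) \<Rightarrow> 'b measure \<Rightarrow> bool" where
  "poisson_random_measure M N \<Lambda> \<longleftrightarrow>
     finite_measure \<Lambda> \<and>
     (\<forall>\<omega>\<in>space M. sets (N \<omega>) = sets \<Lambda> \<and> (\<forall>A\<in>sets \<Lambda>. \<exists>k::nat. emeasure (N \<omega>) A = of_nat k)) \<and>
     (\<forall>A\<in>sets \<Lambda>. (\<lambda>\<omega>. emeasure (N \<omega>) A) \<in> borel_measurable M) \<and>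
     (\<forall>A\<in>sets \<Lambda>. \<forall>k::nat.
        measure M {\<omega>\<in>space M. emeasure (N \<omega>) A = of_nat k} =
          exp (- measure \<Lambda> A) * measure \<Lambda> A ^ k / fact k) \<and>
     (\<forall>A :: nat \<Rightarrow> 'b set. \<forall>n.
        (\<forall>i<n. A i \<in> sets \<Lambda>) \<and> disjoint_family_on A {..<n} \<longrightarrow>
          prob_space.indep_vars M (\<lambda>_. borel) (\<lambda>i \<omega>. emeasure (N \<omega>) (A i)) {..<n})"

text \<open>
  The wave of degree \<open>l\<close> and rate \<open>r\<close> driven by the realization \<open>\<eta>\<close> of the random measure.
  For finite \<open>\<eta>\<close> the function below is bounded and continuous, so its class is an element of \<open>sphere_L2\<close>.
\<close>

definition poisson_wave :: "nat \<Rightarrow> real \<Rightarrow> (real^3) measure \<Rightarrow> sphere_L2" where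
  "poisson_wave l r \<eta> = abs_sphere_L2
     (\<lambda>x. 1 / sqrt r *
        (LINT \<xi>|\<eta>. sqrt ((2 * real l + 1) / (4 * pi)) * poly (legendre_poly l) (inner x \<xi>)))"


section \<open>Gaussian random elements and covariance operators\<close>

definition gaussian_real :: "'a measure \<Rightarrow> ('a \<Rightarrow> real) \<Rightarrow> bool" where
  "gaussian_real M X \<longleftrightarrow> X \<in> borel_measurable M \<and>
     ((\<exists>m \<sigma>. 0 < \<sigma> \<and> distributed M lborel X (normal_density m \<sigma>)) \<or> (\<exists>m. AE \<omega> in M. X \<omega> = m))"

definition gaussian_element :: "'a measure \<Rightarrow> ('a \<Rightarrow> 'k::real_inner) \<Rightarrow> bool" where
  "gaussian_element M X \<longleftrightarrow>
     X \<in> borel_measurable M \<and> (\<forall>u. gaussian_real M (\<lambda>\<omega>. inner (X \<omega>) u))"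

definition centred_square_integrable ::
    "'a measure \<Rightarrow> ('a \<Rightarrow> 'k::{real_inner, banach, second_countable_topology}) \<Rightarrow> bool" where
  "centred_square_integrable M X \<longleftrightarrow>
     X \<in> borel_measurable M \<and> integrable M (\<lambda>\<omega>. (norm (X \<omega>))\<^sup>2) \<and> (LINT \<omega>|M. X \<omega>) = 0"

definition covariance_operator ::
    "'a measure \<Rightarrow> ('a \<Rightarrow> 'k::{real_inner, banach, second_countable_topology}) \<Rightarrow> 'k \<Rightarrow> 'k" where
  "covariance_operator M X u = (LINT \<omega>|M. inner (X \<omega>) u *\<^sub>R X \<omega>)"


section \<open>The smooth distance of order three\<close>

definition fderiv ::
    "('a::real_normed_vector \<Rightarrow> 'b::real_normed_vector) \<Rightarrow> 'a \<Rightarrow> 'a \<Rightarrow>\<^sub>L 'b" where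
  "fderiv f x = Blinfun (frechet_derivative f (at x))"

definition finite_orthonormal :: "'a::real_inner set \<Rightarrow> bool" where
  "finite_orthonormal E \<longleftrightarrow>
     finite E \<and> (\<forall>e\<in>E. \<forall>e'\<in>E. inner e e' = (if e = e' then 1 else 0))"

text \<open>
  The norm of the \<open>j\<close>-fold Hilbert tensor power of \<open>K\<close>, for a \<open>j\<close>-linear form identified with a tensor
  by Riesz representation: the root of the sum of the squared coefficients in an orthonormal basis.
  By Bessel's inequality this sum over a basis equals the supremum over all finite orthonormal sets,
  so no basis has to be chosen. The value is \<open>\<infinity>\<close> if the form is not Hilbert--Schmidt.
\<close>

definition tensor_norm1 :: "('a::real_inner \<Rightarrow>\<^sub>L real) \<Rightarrow> ennreal" where
  "tensor_norm1 A = (SUP E\<in>Collect finite_orthonormal. ennreal (sqrt (\<Sum>a\<in>E. (A a)\<^sup>2)))"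

definition tensor_norm2 :: "('a::real_inner \<Rightarrow>\<^sub>L 'a \<Rightarrow>\<^sub>L real) \<Rightarrow> ennreal" where
  "tensor_norm2 A =
     (SUP E\<in>Collect finite_orthonormal. ennreal (sqrt (\<Sum>a\<in>E. \<Sum>b\<in>E. (A a b)\<^sup>2)))"

definition tensor_norm3 :: "('a::real_inner \<Rightarrow>\<^sub>L 'a \<Rightarrow>\<^sub>L 'a \<Rightarrow>\<^sub>L real) \<Rightarrow> ennreal" where
  "tensor_norm3 A =
     (SUP E\<in>Collect finite_orthonormal. ennreal (sqrt (\<Sum>a\<in>E. \<Sum>b\<in>E. \<Sum>c\<in>E. (A a b c)\<^sup>2)))"

definition Cb3_norm :: "('a::real_inner \<Rightarrow> real) \<Rightarrow> ennreal" where
  "Cb3_norm h =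
     max (SUP x. tensor_norm1 (fderiv h x))
       (max (SUP x. tensor_norm2 (fderiv (fderiv h) x))
            (SUP x. tensor_norm3 (fderiv (fderiv (fderiv h)) x)))"

definition Cb3 :: "('a::real_inner \<Rightarrow> real) set" where
  "Cb3 = {h. (\<forall>x. h differentiable (at x)) \<and> (\<forall>x. fderiv h differentiable (at x)) \<and>
             (\<forall>x. fderiv (fderiv h) differentiable (at x)) \<and> Cb3_norm h < \<infinity>}"

text \<open>
  Functions in \<open>Cb3\<close> are Lipschitz, so the expectations exist for square-integrable \<open>X\<close> and \<open>Y\<close>;
  these may live on different probability spaces.
\<close>

definition d3 ::
    "'a measure \<Rightarrow> ('a \<Rightarrow> 'k::real_inner) \<Rightarrow> 'b measure \<Rightarrow> ('b \<Rightarrow> 'k) \<Rightarrow> ennreal" where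
  "d3 M X M' Y =
     (SUP h\<in>{h \<in> Cb3. Cb3_norm h \<le> 1}. ennreal \<bar>(LINT \<omega>|M. h (X \<omega>)) - (LINT \<omega>|M'. h (Y \<omega>))\<bar>)"

end

theory Submission
  imports Defs
begin

text \<open>
  The wave is \<open>\<nu>\<^sup>-\<^sup>1\<^sup>/\<^sup>2\<close> times the integral against the Poisson random measure of the map \<open>\<phi>\<close> sending \<open>\<xi>\<close> to the
  rescaled zonal function \<open>P\<^sub>l(inner x \<xi>)\<close>, a unit vector of mean zero in a finite-dimensional subspace.
  Discretizing \<open>\<phi>\<close> on a fine partition of the sphere turns the wave into a sum of independent
  Poisson multiples of fixed vectors, which embeds into a convolution semigroup \<open>S\<^sub>t\<close> of averaging operators;
  the Gaussian element embeds into the semigroup \<open>G\<^sub>t f(y) = E f(y + sqrt t Z)\<close>. Comparing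
  \<open>S\<^sub>1 = (S\<^sub>1\<^sub>/\<^sub>n)\<^sup>n\<close> with \<open>G\<^sub>1 = (G\<^sub>1\<^sub>/\<^sub>n)\<^sup>n\<close> by telescoping as in Lindeberg's proof of the central limit theorem, and
  Taylor expanding the test function to third order, the terms of order one and two cancel up to the mesh
  of the partition, and letting \<open>n\<close> tend to infinity leaves \<open>1 / 6\<close> of the third moment. This gives the constant \<open>2 * pi / 3\<close>, which is smaller than the
  claimed \<open>(1 / 4 + sqrt pi) * sqrt (4 * pi)\<close>.
\<close>

text \<open>Independence is given for counts of finitely many disjoint sets, so the semigroup is
  built for a discretized wave, which is the value at time 1 of a compound Poisson process. Two
  limits follow, in this order. For a fixed partition \<open>n\<close> tends to infinity: the
  one-step errors, of order \<open>1 / n^2\<close> and \<open>n powr (-3/2)\<close>, have constants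
  that depend on the partition and on the third moment of \<open>Z\<close>, but they vanish after
  \<open>n\<close> steps, and only the difference of the generators at the test function survives.
  Then the mesh tends to 0. What remains comes from jumps of norm \<open>1 / sqrt \<nu>\<close> with
  total intensity \<open>4 * pi * \<nu>\<close>; the Gaussian third moment leaves no trace. The
  semigroups commute, so the one-step comparison is made at the test function itself and smoothing
  never has to be shown to preserve \<open>Cb3\<close>. Finite dimension matters on the Gaussian
  side: there the semigroup law follows from uniqueness of characteristic functions on the line, and
  third moments are finite by coordinates.\<close>

section \<open>Test functions of class Cb3\<close>

lemma has_derivative_fderiv:
  "f differentiable (at x) \<Longrightarrow> (f has_derivative blinfun_apply (fderiv f x)) (at x)"
  unfolding fderiv_def
  by (metis bounded_linear_Blinfun_apply frechet_derivative_works has_derivative_bounded_linear)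

lemma finite_orthonormal_singleton: "norm u = 1 \<Longrightarrow> finite_orthonormal {u}"
  by (simp add: finite_orthonormal_def norm_eq_1)

text \<open>A single unit vector is an orthonormal set, so the supremum bounds the form at
  \<open>u / norm u\<close>, and homogeneity does the rest. Only diagonal values are extracted, here
  and for the two higher tensor norms: a Taylor expansion along a line uses no others.\<close>

lemma tensor_norm1_leD:
  assumes "tensor_norm1 A \<le> 1"
  shows "\<bar>A u\<bar> \<le> norm u"
proof (cases "u = 0")
  case False
  define e where "e = u /\<^sub>R norm u"
  have u: "u = norm u *\<^sub>R e" and "norm e = 1" using False by (simp_all add: e_def)
  then have "ennreal (sqrt (\<Sum>a\<in>{e}. (A a)\<^sup>2)) \<le> 1"
    unfolding tensor_norm1_def[symmetric]
    by (intro order_trans[OF _ assms[unfolded tensor_norm1_def]] SUP_upper) (simp add: finite_orthonormal_singleton)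
  then have "\<bar>A e\<bar> \<le> 1" by simp
  then have "norm u * \<bar>A e\<bar> \<le> norm u * 1" by (intro mult_left_mono) auto
  then show ?thesis by (subst u) (simp add: blinfun.scaleR_right abs_mult)
qed simp

lemma tensor_norm2_leD:
  assumes "tensor_norm2 A \<le> 1"
  shows "\<bar>A u u\<bar> \<le> (norm u)\<^sup>2"
proof (cases "u = 0")
  case False
  define e where "e = u /\<^sub>R norm u"
  have u: "u = norm u *\<^sub>R e" and "norm e = 1" using False by (simp_all add: e_def)
  then have "ennreal (sqrt (\<Sum>a\<in>{e}. \<Sum>b\<in>{e}. (A a b)\<^sup>2)) \<le> 1"
    by (intro order_trans[OF _ assms[unfolded tensor_norm2_def]] SUP_upper) (simp add: finite_orthonormal_singleton)
  then have "\<bar>A e e\<bar> \<le> 1" by simp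
  then have "(norm u)\<^sup>2 * \<bar>A e e\<bar> \<le> (norm u)\<^sup>2 * 1" by (intro mult_left_mono) auto
  then show ?thesis by (subst u, subst (2) u) (simp add: blinfun.scaleR_right blinfun.scaleR_left abs_mult power2_eq_square mult.assoc)
qed simp

lemma tensor_norm3_leD:
  assumes "tensor_norm3 A \<le> 1"
  shows "\<bar>A u u u\<bar> \<le> norm u ^ 3"
proof (cases "u = 0")
  case False
  define e where "e = u /\<^sub>R norm u"
  have u: "u = norm u *\<^sub>R e" and "norm e = 1" using False by (simp_all add: e_def)
  then have "ennreal (sqrt (\<Sum>a\<in>{e}. \<Sum>b\<in>{e}. \<Sum>c\<in>{e}. (A a b c)\<^sup>2)) \<le> 1"
    by (intro order_trans[OF _ assms[unfolded tensor_norm3_def]] SUP_upper) (simp add: finite_orthonormal_singleton)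
  then have "\<bar>A e e e\<bar> \<le> 1" by simp
  then have "norm u ^ 3 * \<bar>A e e e\<bar> \<le> norm u ^ 3 * 1" by (intro mult_left_mono) auto
  then show ?thesis by (subst u, subst (2) u, subst (3) u)
    (simp add: blinfun.scaleR_right blinfun.scaleR_left abs_mult power3_eq_cube mult.assoc)
qed simp

lemma
  assumes "Cb3_norm h \<le> 1"
  shows Cb3_norm_D1: "\<bar>fderiv h x u\<bar> \<le> norm u"
    and Cb3_norm_D2: "\<bar>fderiv (fderiv h) x u u\<bar> \<le> (norm u)\<^sup>2"
    and Cb3_norm_D3: "\<bar>fderiv (fderiv (fderiv h)) x u u u\<bar> \<le> norm u ^ 3"
  using assms unfolding Cb3_norm_def max.bounded_iff SUP_le_iff
  by (auto intro!: tensor_norm1_leD tensor_norm2_leD tensor_norm3_leD)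

text \<open>Evaluating the remaining arguments at the direction \<open>u\<close> is bounded linear,
  so the Frechet derivatives become successive derivatives of one real function.\<close>

lemma Cb3_along_line:
  assumes "h \<in> Cb3"
  shows "((\<lambda>s. h (y + s *\<^sub>R u)) has_real_derivative fderiv h (y + s *\<^sub>R u) u) (at s)"
    and "((\<lambda>s. fderiv h (y + s *\<^sub>R u) u) has_real_derivative fderiv (fderiv h) (y + s *\<^sub>R u) u u) (at s)"
    and "((\<lambda>s. fderiv (fderiv h) (y + s *\<^sub>R u) u u) has_real_derivative
            fderiv (fderiv (fderiv h)) (y + s *\<^sub>R u) u u u) (at s)"
proof -
  have line: "((\<lambda>s. y + s *\<^sub>R u) has_derivative (\<lambda>t. t *\<^sub>R u)) (at s)"
    by (auto intro!: derivative_eq_intros)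
  have d: "h differentiable (at x)" "fderiv h differentiable (at x)" "fderiv (fderiv h) differentiable (at x)" for x
    using assms by (auto simp: Cb3_def)
  note c = has_derivative_compose[OF line, OF has_derivative_fderiv]
  show "((\<lambda>s. h (y + s *\<^sub>R u)) has_real_derivative fderiv h (y + s *\<^sub>R u) u) (at s)"
    using c[OF d(1)] by (auto simp: has_field_derivative_def blinfun.scaleR_right mult_commute_abs)
  show "((\<lambda>s. fderiv h (y + s *\<^sub>R u) u) has_real_derivative fderiv (fderiv h) (y + s *\<^sub>R u) u u) (at s)"
    using bounded_linear.has_derivative[OF blinfun.bounded_linear_left c[OF d(2)], of u]
    by (auto simp: has_field_derivative_def blinfun.scaleR_right blinfun.scaleR_left mult_commute_abs)
  show "((\<lambda>s. fderiv (fderiv h) (y + s *\<^sub>R u) u u) has_real_derivative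
            fderiv (fderiv (fderiv h)) (y + s *\<^sub>R u) u u u) (at s)"
    using bounded_linear.has_derivative[OF blinfun.bounded_linear_left
        bounded_linear.has_derivative[OF blinfun.bounded_linear_left c[OF d(3)], of u], of u]
    by (auto simp: has_field_derivative_def blinfun.scaleR_right blinfun.scaleR_left mult_commute_abs)
qed

lemma Cb3_taylor:
  assumes "h \<in> Cb3" "Cb3_norm h \<le> 1"
  shows "\<bar>h (y + u) - h y - fderiv h y u - fderiv (fderiv h) y u u / 2\<bar> \<le> norm u ^ 3 / 6"
proof -
  define g where "g m s = (if m = 0 then h (y + s *\<^sub>R u) else if m = 1 then fderiv h (y + s *\<^sub>R u) u
    else if m = 2 then fderiv (fderiv h) (y + s *\<^sub>R u) u u else fderiv (fderiv (fderiv h)) (y + s *\<^sub>R u) u u u)"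
    for m :: nat and s
  have "\<forall>m t. m < 3 \<and> 0 \<le> t \<and> t \<le> 1 \<longrightarrow> DERIV (g m) t :> g (Suc m) t"
  proof (intro allI impI)
    fix m :: nat and t :: real assume "m < 3 \<and> 0 \<le> t \<and> t \<le> 1"
    then have "m = 0 \<or> m = 1 \<or> m = 2" by auto
    then show "DERIV (g m) t :> g (Suc m) t"
      by (elim disjE) (simp_all add: g_def[abs_def] Cb3_along_line[OF assms(1)] del: One_nat_def)
  qed
  \<comment> \<open>The Lagrange remainder asks that the third derivative exist on the segment,
    which is what \<open>Cb3\<close> provides. It is the source of the factor 1/6 in the final
    bound.\<close>
  from Maclaurin[of 1 3 g "g 0", OF _ _ _ this] obtain t where
    "g 0 1 = (\<Sum>m<3. g m 0 / fact m * 1 ^ m) + g 3 t / fact 3 * 1 ^ 3" by auto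
  then have "h (y + u) - h y - fderiv h y u - fderiv (fderiv h) y u u / 2
      = fderiv (fderiv (fderiv h)) (y + t *\<^sub>R u) u u u / 6"
    by (simp add: g_def eval_nat_numeral)
  then show ?thesis
    using Cb3_norm_D3[OF assms(2), of "y + t *\<^sub>R u" u] by (simp only: abs_divide)
qed

lemma Cb3_lipschitz:
  assumes "h \<in> Cb3" "Cb3_norm h \<le> 1"
  shows "\<bar>h x - h y\<bar> \<le> norm (x - y)"
proof -
  obtain t where "h (y + 1 *\<^sub>R (x - y)) - h (y + 0 *\<^sub>R (x - y)) = (1 - 0) * fderiv h (y + t *\<^sub>R (x - y)) (x - y)"
    using MVT2[of 0 1 "\<lambda>s. h (y + s *\<^sub>R (x - y))", OF _ Cb3_along_line(1)[OF assms(1)]] by auto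
  then show ?thesis using Cb3_norm_D1[OF assms(2), of "y + t *\<^sub>R (x - y)" "x - y"] by simp
qed

text \<open>Only the diagonal of \<open>B\<close> is controlled, so the mixed terms are recovered by
  polarization. With \<open>a = b + d e\<close> the difference is \<open>d\<close> times half the
  difference of the form at \<open>b + e\<close> and \<open>b - e\<close>, plus \<open>d * d\<close>
  times its value at \<open>e\<close>. The vectors \<open>b + e\<close> and \<open>b - e\<close>
  have norm at most 2, which contributes 4, and the last term contributes 1.\<close>

lemma bounded_quadratic_form_diff_le:
  fixes B :: "'a::real_normed_vector \<Rightarrow>\<^sub>L 'a \<Rightarrow>\<^sub>L real"
  assumes q: "\<And>u. \<bar>B u u\<bar> \<le> (norm u)\<^sup>2"
    and "norm a \<le> 1" "norm b \<le> 1" "norm (a - b) \<le> d" "0 < d" "d \<le> 1"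
  shows "\<bar>B a a - B b b\<bar> \<le> 5 * d"
proof -
  define e where "e = (a - b) /\<^sub>R d"
  have a: "a = b + d *\<^sub>R e" and e: "norm e \<le> 1" using assms by (simp_all add: e_def divide_simps)
  have 4: "\<bar>B (b + e) (b + e)\<bar> \<le> 4" "\<bar>B (b - e) (b - e)\<bar> \<le> 4"
  proof -
    have "norm (b + e) \<le> 2" "norm (b - e) \<le> 2"
      using norm_triangle_ineq[of b e] norm_triangle_ineq4[of b e] assms e by auto
    from this[THEN power_mono[where n = 2]] show "\<bar>B (b + e) (b + e)\<bar> \<le> 4" "\<bar>B (b - e) (b - e)\<bar> \<le> 4"
      using q[of "b + e"] q[of "b - e"] by simp_all
  qed
  have "B a a - B b b = d * ((B (b + e) (b + e) - B (b - e) (b - e)) / 2 + d * B e e)"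
    unfolding a by (simp add: blinfun.bilinear_simps algebra_simps power2_eq_square)
  also have "\<bar>\<dots>\<bar> \<le> d * (4 + 1 * 1)"
  proof -
    have "\<bar>B e e\<bar> \<le> 1" using q[of e] power_mono[OF e, of 2] by simp
    then have "\<bar>d * B e e\<bar> \<le> 1 * 1" unfolding abs_mult using assms by (intro mult_mono) auto
    with 4 have "\<bar>(B (b + e) (b + e) - B (b - e) (b - e)) / 2 + d * B e e\<bar> \<le> 4 + 1 * 1"
      unfolding abs_le_iff by (auto simp: field_simps)
    then show ?thesis using assms unfolding abs_mult by (intro mult_mono) auto
  qed
  finally show ?thesis by simp
qed

section \<open>Characteristic functions determine joint laws\<close>

lemma integrable_weight_mult:
  fixes w g :: "'a \<Rightarrow> real"
  assumes "prob_space M" and [measurable]: "w \<in> borel_measurable M" "g \<in> borel_measurable M"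
    and w: "\<And>x. 0 \<le> w x" "\<And>x. w x \<le> c" and g: "\<And>x. \<bar>g x\<bar> \<le> 1"
  shows "integrable M (\<lambda>x. w x * g x)"
proof -
  interpret prob_space M by fact
  show ?thesis
  proof (rule integrable_const_bound[of _ c])
    have "w x * \<bar>g x\<bar> \<le> c * 1" for x
      using w[of x] g[of x] by (intro mult_mono) auto
    then show "AE x in M. norm (w x * g x) \<le> c" using w by (simp add: abs_mult)
  qed simp
qed

text \<open>A bounded non-negative weight, divided by its positive mass \<open>m\<close>, becomes a
  density. The phase \<open>- (pi / 2)\<close> turns the cosine into a sine, so cosine integrals
  with free phase encode the whole complex characteristic function by real integrals.\<close>

lemma
  fixes X w :: "'a \<Rightarrow> real"
  assumes M: "prob_space M" and [measurable]: "X \<in> borel_measurable M" "w \<in> borel_measurable M"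
    and w: "\<And>x. 0 \<le> w x" "\<And>x. w x \<le> c" and m: "(LINT x|M. w x) = m" "0 < m"
  defines "D \<equiv> distr (density M (\<lambda>x. ennreal (w x / m))) borel X"
  shows weighted_real_distribution: "real_distribution D"
    and weighted_char: "char D t = complex_of_real ((LINT x|M. w x * cos (t * X x)) / m)
        + \<i> * complex_of_real ((LINT x|M. w x * cos (t * X x + - (pi / 2))) / m)"
    and weighted_measure: "A \<in> sets borel \<Longrightarrow> (LINT x|D. indicator A x) = (LINT x|M. w x * indicator A (X x)) / m"
proof -
  let ?c = "complex_of_real ((LINT x|M. w x * cos (t * X x)) / m)
      + \<i> * complex_of_real ((LINT x|M. w x * cos (t * X x + - (pi / 2))) / m)"
  note i = integrable_weight_mult[OF M _ _ w]
  have "integrable M (\<lambda>x. w x * 1)" by (rule i) simp_all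
  then have iw: "integrable M w" by simp
  define P where "P = density M (\<lambda>x. ennreal (w x / m))"
  have P: "prob_space P"
    unfolding P_def
  proof (rule prob_spaceI)
    show "emeasure (density M (\<lambda>x. ennreal (w x / m))) (space (density M (\<lambda>x. ennreal (w x / m)))) = 1"
      using m(2) w(1) iw by (simp add: emeasure_density nn_integral_eq_integral m(1) cong: nn_integral_cong_simp)
  qed
  have XP [measurable]: "X \<in> borel_measurable P" by (simp add: P_def)
  show "real_distribution D"
    unfolding D_def P_def[symmetric] by (rule prob_space.real_distribution_distr[OF P XP])
  have "char D t = (CLINT x|P. iexp (t * X x))"
    unfolding D_def P_def[symmetric] by (simp add: char_def integral_distr)
  also have "\<dots> = (CLINT x|M. (w x / m) *\<^sub>R iexp (t * X x))"
    unfolding P_def using m w by (subst integral_density) auto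
  also have "\<dots> = (CLINT x|M. complex_of_real (w x * cos (t * X x) / m) + \<i> * complex_of_real (w x * cos (t * X x + - (pi / 2)) / m))"
    by (rule Bochner_Integration.integral_cong) (auto simp: Re_exp Im_exp complex_eq_iff cos_diff)
  also have "\<dots> = ?c"
    by (subst Bochner_Integration.integral_add)
       (auto intro!: integrable_of_real integrable_mult_right integrable_divide i simp del: of_real_divide of_real_mult)
  finally show "char D t = ?c" .
  assume A: "A \<in> sets borel"
  have "(LINT x|D. indicator A x) = (LINT x|P. indicator A (X x) :: real)"
    unfolding D_def P_def[symmetric] using A by (subst integral_distr) auto
  also have "\<dots> = (LINT x|M. w x * indicator A (X x)) / m"
    unfolding P_def using m w A by (subst integral_density) auto
  finally show "(LINT x|D. indicator A x) = (LINT x|M. w x * indicator A (X x)) / m" .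
qed

text \<open>Levy's uniqueness theorem for the two normalized weighted laws. The case
  \<open>t = 0\<close>, \<open>b = 0\<close> of the hypothesis says that the masses agree; mass 0
  cannot be normalized and is treated apart, as both weights are then null almost
  everywhere.\<close>

lemma weighted_distr_unique:
  fixes X :: "'a \<Rightarrow> real" and Y :: "'b \<Rightarrow> real"
  assumes M: "prob_space M" and N: "prob_space N"
    and X: "X \<in> borel_measurable M" and Y: "Y \<in> borel_measurable N"
    and wm: "w \<in> borel_measurable M" and vm: "v \<in> borel_measurable N"
    and w: "\<And>x. 0 \<le> w x" "\<And>x. w x \<le> c" and v: "\<And>x. 0 \<le> v x" "\<And>x. v x \<le> c"
    and eq: "\<And>t b. (LINT x|M. w x * cos (t * X x + b)) = (LINT x|N. v x * cos (t * Y x + b))"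
    and A: "A \<in> sets borel"
  shows "(LINT x|M. w x * indicator A (X x)) = (LINT x|N. v x * indicator A (Y x))"
proof -
  define m where "m = (LINT x|M. w x)"
  have m': "(LINT x|N. v x) = m"
    using eq[of 0 0] by (simp add: m_def)
  show ?thesis
  proof (cases "m = 0")
    case True
    have "integrable M (\<lambda>x. w x * 1)" "integrable N (\<lambda>x. v x * 1)"
      by (rule integrable_weight_mult[OF M wm _ w] integrable_weight_mult[OF N vm _ v]; simp)+
    then have "AE x in M. w x = 0" "AE x in N. v x = 0"
      using True m' integral_nonneg_eq_0_iff_AE[of M w] integral_nonneg_eq_0_iff_AE[of N v] w(1) v(1) by (simp_all add: m_def)
    then have "(LINT x|M. w x * indicator A (X x)) = 0" "(LINT x|N. v x * indicator A (Y x)) = 0"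
      by (auto intro!: integral_eq_zero_AE)
    then show ?thesis by simp
  next
    case False
    then have m: "0 < m" using Bochner_Integration.integral_nonneg[of M w] w(1) by (simp add: less_le m_def)
    note P = M X wm w m_def[symmetric] m and Q = N Y vm v m' m
    have "char (distr (density M (\<lambda>x. ennreal (w x / m))) borel X) = char (distr (density N (\<lambda>x. ennreal (v x / m))) borel Y)"
    proof
      fix t
      show "char (distr (density M (\<lambda>x. ennreal (w x / m))) borel X) t = char (distr (density N (\<lambda>x. ennreal (v x / m))) borel Y) t"
        unfolding weighted_char[OF P] weighted_char[OF Q] using eq[of t 0] eq[of t "- (pi / 2)"] by simp
    qed
    from Levy_uniqueness[OF weighted_real_distribution[OF P] weighted_real_distribution[OF Q] this]
    have "(LINT x|M. w x * indicator A (X x)) / m = (LINT x|N. v x * indicator A (Y x)) / m"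
      using weighted_measure[OF P A] weighted_measure[OF Q A] by simp
    then show ?thesis using m by simp
  qed
qed

lemma emeasure_distr_PiE:
  fixes X :: "nat \<Rightarrow> 'a \<Rightarrow> real"
  assumes "prob_space M" and [measurable]: "\<And>i. X i \<in> borel_measurable M" and B: "\<And>i. B i \<in> sets borel"
  shows "emeasure (distr M (Pi\<^sub>M {..<d} (\<lambda>_. borel)) (\<lambda>x. \<lambda>i\<in>{..<d}. X i x)) (Pi\<^sub>E {..<d} B)
     = ennreal (LINT x|M. (\<Prod>i<d. indicator (B i) (X i x)))"
proof -
  interpret prob_space M by fact
  let ?X = "\<lambda>x. \<lambda>i\<in>{..<d}. X i x"
  have m: "?X \<in> measurable M (Pi\<^sub>M {..<d} (\<lambda>_. borel))" by measurable
  have S: "Pi\<^sub>E {..<d} B \<in> sets (Pi\<^sub>M {..<d} (\<lambda>_. borel))"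
    using B by (intro sets_PiM_I_finite) auto
  have "(\<Prod>i<d. indicator (B i) (X i x) :: real) = indicator (?X -` (Pi\<^sub>E {..<d} B) \<inter> space M) x" if "x \<in> space M" for x
  proof (cases "\<forall>i<d. X i x \<in> B i")
    case True
    then show ?thesis using that by (auto simp: indicator_def PiE_def Pi_def)
  next
    case False
    then show ?thesis using that by (auto simp: indicator_def PiE_def Pi_def intro!: prod_zero)
  qed
  then have "(LINT x|M. (\<Prod>i<d. indicator (B i) (X i x))) = measure M (?X -` (Pi\<^sub>E {..<d} B) \<inter> space M)"
    using measurable_sets[OF m S] by (subst Bochner_Integration.integral_cong[OF refl]) auto
  then show ?thesis by (simp add: emeasure_distr[OF m S] emeasure_eq_measure)
qed

text \<open>A theorem of Cramer-Wold type derived from uniqueness on the line: one coordinate at a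
  time is moved out of the argument of the cosine and into an indicator of an arbitrary Borel
  set.\<close>

lemma joint_distr_unique:
  fixes X :: "nat \<Rightarrow> 'a \<Rightarrow> real" and Y :: "nat \<Rightarrow> 'b \<Rightarrow> real"
  assumes M: "prob_space M" and N: "prob_space N"
    and X[measurable]: "\<And>i. X i \<in> borel_measurable M" and Y[measurable]: "\<And>i. Y i \<in> borel_measurable N"
    and cf: "\<And>a b. (LINT x|M. cos (b + (\<Sum>i<d. a i * X i x))) = (LINT x|N. cos (b + (\<Sum>i<d. a i * Y i x)))"
  shows "distr M (Pi\<^sub>M {..<d} (\<lambda>_. borel)) (\<lambda>x. \<lambda>i\<in>{..<d}. X i x)
       = distr N (Pi\<^sub>M {..<d} (\<lambda>_. borel)) (\<lambda>x. \<lambda>i\<in>{..<d}. Y i x)"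
proof -
  interpret M: prob_space M by fact
  interpret N: prob_space N by fact
  define W where "W A r x = (\<Prod>i<r. indicator (A i) (X i x) :: real)" for A :: "nat \<Rightarrow> real set" and r x
  define V where "V A r x = (\<Prod>i<r. indicator (A i) (Y i x) :: real)" for A :: "nat \<Rightarrow> real set" and r x
  have W01: "0 \<le> W A r x" "W A r x \<le> 1" for A r x
    by (auto simp: W_def intro!: prod_nonneg prod_le_1)
  have V01: "0 \<le> V A r x" "V A r x \<le> 1" for A r x
    by (auto simp: V_def intro!: prod_nonneg prod_le_1)
  have [measurable]: "W A r \<in> borel_measurable M" "V A r \<in> borel_measurable N" if "\<And>i. A i \<in> sets borel" for A r
    using that unfolding W_def V_def by measurable
  have iM: "integrable M (\<lambda>x. W A r x * g x)"
    if "g \<in> borel_measurable M" "\<And>x. \<bar>g x\<bar> \<le> 1" "\<And>i. A i \<in> sets borel" for g A r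
    by (rule integrable_weight_mult[OF M, where w = "W A r" and g = g and c = 1]) (use that W01 in simp_all)
  have iN: "integrable N (\<lambda>x. V A r x * g x)"
    if "g \<in> borel_measurable N" "\<And>x. \<bar>g x\<bar> \<le> 1" "\<And>i. A i \<in> sets borel" for g A r
    by (rule integrable_weight_mult[OF N, where w = "V A r" and g = g and c = 1]) (use that V01 in simp_all)
  \<comment> \<open>State after \<open>r\<close> rounds: indicators in the coordinates below
    \<open>r\<close>, a cosine of a free linear combination of the others. At \<open>r = d\<close>
    that combination is empty, and \<open>b = 0\<close> leaves the probability of a
    rectangle.\<close>
  have main: "(LINT x|M. W A r x * cos (b + (\<Sum>i\<in>{r..<d}. a i * X i x)))
      = (LINT x|N. V A r x * cos (b + (\<Sum>i\<in>{r..<d}. a i * Y i x)))"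
    if "r \<le> d" "\<And>i. A i \<in> sets borel" for r A a b
    using that
  proof (induction r arbitrary: a b)
    case 0
    then show ?case using cf[of b a] by (simp add: W_def V_def atLeast0LessThan)
  next
    case (Suc r)
    then have A: "\<And>i. A i \<in> sets borel" and r: "r < d" by auto
    have split: "(\<Sum>i\<in>{r..<d}. f i) = f r + (\<Sum>i\<in>{Suc r..<d}. f i)" for f :: "nat \<Rightarrow> real"
      using r by (rule sum.atLeast_Suc_lessThan)
    define \<theta> where "\<theta> a x = (\<Sum>i\<in>{Suc r..<d}. a i * X i x)" for a x
    define \<eta> where "\<eta> a x = (\<Sum>i\<in>{Suc r..<d}. a i * Y i x)" for a x
    have [measurable]: "\<theta> a \<in> borel_measurable M" "\<eta> a \<in> borel_measurable N" for a
      unfolding \<theta>_def \<eta>_def by measurable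
    have upd: "\<theta> (a(r := t)) = \<theta> a" "\<eta> (a(r := t)) = \<eta> a" "\<theta> (\<lambda>i. - a i) x = - \<theta> a x" "\<eta> (\<lambda>i. - a i) y = - \<eta> a y"
        "\<theta> (\<lambda>_. 0) x = 0" "\<eta> (\<lambda>_. 0) y = 0" for a t x y
      by (auto simp: \<theta>_def \<eta>_def sum_negf intro!: ext sum.cong)
    have IH: "(LINT x|M. W A r x * cos (c + (t * X r x + \<theta> a x))) = (LINT x|N. V A r x * cos (c + (t * Y r x + \<eta> a x)))" for c t a
      using Suc.IH[of c "a(r := t)"] r A upd(1)[of a t] upd(2)[of a t] by (simp add: split \<theta>_def \<eta>_def)
    \<comment> \<open>The product of the weight with a cosine in coordinate \<open>r\<close> is
      again a sum of cosines of linear combinations, so the induction hypothesis covers each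
      term.\<close>
    have pc: "(1 + cos (b + z)) * cos (t * y + c) =
       cos (t * y + c) + cos (b + c + (t * y + z)) / 2 + cos (c - b + (t * y - z)) / 2" for b c t y z :: real
    proof -
      have "cos (b + z) * cos (t * y + c) = (cos ((b + z) - (t * y + c)) + cos ((b + z) + (t * y + c))) / 2"
        by (rule cos_times_cos)
      also have "cos ((b + z) - (t * y + c)) = cos (c - b + (t * y - z))"
        using cos_minus[of "(b + z) - (t * y + c)"] by (simp add: algebra_simps)
      finally show ?thesis by (simp add: algebra_simps)
    qed
    \<comment> \<open>A cosine takes negative values and is no weight; adding 1 gives one with
      values between 0 and 2.\<close>
    have step: "(LINT x|M. W A r x * (1 + cos (b + \<theta> a x)) * indicator (A r) (X r x))
        = (LINT x|N. V A r x * (1 + cos (b + \<eta> a x)) * indicator (A r) (Y r x))" for a b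
    proof (rule weighted_distr_unique[OF M N])
      fix t c
      have "(LINT x|M. W A r x * (1 + cos (b + \<theta> a x)) * cos (t * X r x + c)) =
        (LINT x|M. W A r x * cos (c + (t * X r x + \<theta> (\<lambda>_. 0) x)) + W A r x * cos (b + c + (t * X r x + \<theta> a x)) / 2
            + W A r x * cos (c - b + (t * X r x + \<theta> (\<lambda>i. - a i) x)) / 2)"
        by (simp add: mult.assoc pc upd) (simp add: algebra_simps add_divide_distrib)
      also have "\<dots> = (LINT x|M. W A r x * cos (c + (t * X r x + \<theta> (\<lambda>_. 0) x)))
          + (LINT x|M. W A r x * cos (b + c + (t * X r x + \<theta> a x))) / 2
          + (LINT x|M. W A r x * cos (c - b + (t * X r x + \<theta> (\<lambda>i. - a i) x))) / 2"
        by (subst Bochner_Integration.integral_add Bochner_Integration.integral_divide_zero;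
            (intro Bochner_Integration.integrable_add integrable_divide iM A)?; simp)+
      also have "\<dots> = (LINT x|N. V A r x * cos (c + (t * Y r x + \<eta> (\<lambda>_. 0) x)))
          + (LINT x|N. V A r x * cos (b + c + (t * Y r x + \<eta> a x))) / 2
          + (LINT x|N. V A r x * cos (c - b + (t * Y r x + \<eta> (\<lambda>i. - a i) x))) / 2"
        by (simp only: IH)
      also have "\<dots> = (LINT x|N. V A r x * cos (c + (t * Y r x + \<eta> (\<lambda>_. 0) x)) + V A r x * cos (b + c + (t * Y r x + \<eta> a x)) / 2
            + V A r x * cos (c - b + (t * Y r x + \<eta> (\<lambda>i. - a i) x)) / 2)"
        by (subst Bochner_Integration.integral_add Bochner_Integration.integral_divide_zero;
            (intro Bochner_Integration.integrable_add integrable_divide iN A)?; simp)+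
      also have "\<dots> = (LINT x|N. V A r x * (1 + cos (b + \<eta> a x)) * cos (t * Y r x + c))"
        by (simp add: mult.assoc pc upd) (simp add: algebra_simps add_divide_distrib)
      finally show "(LINT x|M. W A r x * (1 + cos (b + \<theta> a x)) * cos (t * X r x + c)) =
          (LINT x|N. V A r x * (1 + cos (b + \<eta> a x)) * cos (t * Y r x + c))" .
    next
      have *: "0 \<le> 1 + cos z" "1 + cos z \<le> 2" for z :: real
        using cos_ge_minus_one[of z] cos_le_one[of z] by linarith+
      fix x show "0 \<le> W A r x * (1 + cos (b + \<theta> a x))" "W A r x * (1 + cos (b + \<theta> a x)) \<le> 2"
        using * W01[of A r x] mult_mono[of "W A r x" 1 "1 + cos (b + \<theta> a x)" 2] by auto
    next
      have *: "0 \<le> 1 + cos z" "1 + cos z \<le> 2" for z :: real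
        using cos_ge_minus_one[of z] cos_le_one[of z] by linarith+
      fix x show "0 \<le> V A r x * (1 + cos (b + \<eta> a x))" "V A r x * (1 + cos (b + \<eta> a x)) \<le> 2"
        using * V01[of A r x] mult_mono[of "V A r x" 1 "1 + cos (b + \<eta> a x)" 2] by auto
    qed (use A in \<open>simp_all\<close>)
    have WS: "W A (Suc r) x = W A r x * indicator (A r) (X r x)" for x by (simp add: W_def)
    have VS: "V A (Suc r) x = V A r x * indicator (A r) (Y r x)" for x by (simp add: V_def)
    have eM: "(LINT x|M. W A r x * (1 + cos (b + \<theta> a x)) * indicator (A r) (X r x))
        = (LINT x|M. W A (Suc r) x * 1) + (LINT x|M. W A (Suc r) x * cos (b + \<theta> a x))" for a b
      by (subst Bochner_Integration.integral_add[symmetric], rule iM[OF _ _ A], simp, simp, rule iM[OF _ _ A], simp, simp)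
         (auto simp: WS algebra_simps intro!: Bochner_Integration.integral_cong)
    have eN: "(LINT x|N. V A r x * (1 + cos (b + \<eta> a x)) * indicator (A r) (Y r x))
        = (LINT x|N. V A (Suc r) x * 1) + (LINT x|N. V A (Suc r) x * cos (b + \<eta> a x))" for a b
      by (subst Bochner_Integration.integral_add[symmetric], rule iN[OF _ _ A], simp, simp, rule iN[OF _ _ A], simp, simp)
         (auto simp: VS algebra_simps intro!: Bochner_Integration.integral_cong)
    \<comment> \<open>For zero phase and zero coefficients the cosine is 1, so \<open>step\<close>
      compares twice the integral of the indicators. Subtracting this integral removes the 1 that
      was added.\<close>
    have "(LINT x|M. W A (Suc r) x * 1) = (LINT x|N. V A (Suc r) x * 1)"
      using step[of 0 "\<lambda>_. 0", unfolded eM eN] by (simp add: upd)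
    then show ?case
      using step[of b a, unfolded eM eN] by (simp add: \<theta>_def \<eta>_def)
  qed
  define P where "P = distr M (Pi\<^sub>M {..<d} (\<lambda>_. borel :: real measure)) (\<lambda>x. \<lambda>i\<in>{..<d}. X i x)"
  define Q where "Q = distr N (Pi\<^sub>M {..<d} (\<lambda>_. borel :: real measure)) (\<lambda>x. \<lambda>i\<in>{..<d}. Y i x)"
  have mX: "(\<lambda>x. \<lambda>i\<in>{..<d}. X i x) \<in> measurable M (Pi\<^sub>M {..<d} (\<lambda>_. borel))" by measurable
  have mY: "(\<lambda>x. \<lambda>i\<in>{..<d}. Y i x) \<in> measurable N (Pi\<^sub>M {..<d} (\<lambda>_. borel))" by measurable
  interpret P: prob_space P unfolding P_def by (rule M.prob_space_distr[OF mX])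
  have "P = Q"
  proof (rule measure_eqI_PiM_finite[where I = "{..<d}" and M = "\<lambda>_. borel"])
    fix A :: "nat \<Rightarrow> real set" assume A': "\<And>i. i \<in> {..<d} \<Longrightarrow> A i \<in> sets borel"
    \<comment> \<open>\<open>main\<close> wants a Borel set for every index, hence the default
      \<open>{}\<close> beyond \<open>d\<close>.\<close>
    define B where "B i = (if i < d then A i else {})" for i
    have B: "B i \<in> sets borel" for i using A' by (auto simp: B_def)
    have BA: "Pi\<^sub>E {..<d} A = Pi\<^sub>E {..<d} B" by (auto simp: B_def PiE_def Pi_def)
    have "emeasure P (Pi\<^sub>E {..<d} B) = ennreal (LINT x|M. W B d x)"
      unfolding P_def W_def using M.prob_space_axioms X B by (rule emeasure_distr_PiE)
    also have "(LINT x|M. W B d x) = (LINT x|N. V B d x)"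
      using main[of d B 0] B by simp
    also have "ennreal \<dots> = emeasure Q (Pi\<^sub>E {..<d} B)"
      unfolding Q_def V_def using N.prob_space_axioms Y B by (rule emeasure_distr_PiE[symmetric])
    finally show "emeasure P (Pi\<^sub>E {..<d} A) = emeasure Q (Pi\<^sub>E {..<d} A)" unfolding BA .
  next
    show "range (\<lambda>_::nat. Pi\<^sub>E {..<d} (\<lambda>_. UNIV :: real set)) \<subseteq> prod_algebra {..<d} (\<lambda>_. borel)"
      by (auto intro!: prod_algebraI_finite)
    show "(\<Union>i::nat. Pi\<^sub>E {..<d} (\<lambda>_. UNIV :: real set)) = space (Pi\<^sub>M {..<d} (\<lambda>_. borel))"
      by (simp add: space_PiM)
  qed (simp_all add: P_def Q_def P.emeasure_eq_measure[unfolded P_def])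
  then show ?thesis by (simp add: P_def Q_def)
qed

section \<open>Averaging operators on Lipschitz functions\<close>

definition lipschitz_fun :: "('k::real_normed_vector \<Rightarrow> real) \<Rightarrow> bool" where
  "lipschitz_fun f \<longleftrightarrow> (\<exists>L. L-lipschitz_on UNIV f)"

lemma lipschitz_fun_diff:
  "lipschitz_fun f \<Longrightarrow> lipschitz_fun g \<Longrightarrow> lipschitz_fun (\<lambda>y. f y - g y)"
  unfolding lipschitz_fun_def by (blast intro: lipschitz_on_diff)

text \<open>What telescoping uses of the map from \<open>f\<close> to the expectation of
  \<open>f (y + X)\<close>. Lipschitz functions can be unbounded, so contraction in the sup norm is
  stated for those with a bound \<open>e\<close>; it is applied to differences.\<close>

definition averaging :: "(('k::real_normed_vector \<Rightarrow> real) \<Rightarrow> 'k \<Rightarrow> real) \<Rightarrow> bool" where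
  "averaging A \<longleftrightarrow>
     (\<forall>L f. L-lipschitz_on UNIV f \<longrightarrow> L-lipschitz_on UNIV (A f)) \<and>
     (\<forall>f g. lipschitz_fun f \<longrightarrow> lipschitz_fun g \<longrightarrow> A (\<lambda>y. f y - g y) = (\<lambda>y. A f y - A g y)) \<and>
     (\<forall>f e. lipschitz_fun f \<longrightarrow> (\<forall>y. \<bar>f y\<bar> \<le> e) \<longrightarrow> (\<forall>y. \<bar>A f y\<bar> \<le> e))"

definition commuting :: "(('k::real_normed_vector \<Rightarrow> real) \<Rightarrow> 'k \<Rightarrow> real) \<Rightarrow> (('k \<Rightarrow> real) \<Rightarrow> 'k \<Rightarrow> real) \<Rightarrow> bool" where
  "commuting A G \<longleftrightarrow> (\<forall>f. lipschitz_fun f \<longrightarrow> A (G f) = G (A f))"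

definition averaging_semigroup :: "(real \<Rightarrow> ('k::real_normed_vector \<Rightarrow> real) \<Rightarrow> 'k \<Rightarrow> real) \<Rightarrow> bool" where
  "averaging_semigroup S \<longleftrightarrow> (\<forall>s\<ge>0. averaging (S s)) \<and> (\<forall>f. lipschitz_fun f \<longrightarrow> S 0 f = f) \<and>
     (\<forall>s\<ge>0. \<forall>t\<ge>0. \<forall>f. lipschitz_fun f \<longrightarrow> S (s + t) f = S s (S t f))"

lemma
  assumes "averaging A"
  shows averaging_lipschitz_on: "L-lipschitz_on UNIV f \<Longrightarrow> L-lipschitz_on UNIV (A f)"
    and averaging_lipschitz: "lipschitz_fun f \<Longrightarrow> lipschitz_fun (A f)"
    and averaging_diff: "lipschitz_fun f \<Longrightarrow> lipschitz_fun g \<Longrightarrow> A (\<lambda>y. f y - g y) = (\<lambda>y. A f y - A g y)"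
    and averaging_bound: "lipschitz_fun f \<Longrightarrow> (\<And>y. \<bar>f y\<bar> \<le> e) \<Longrightarrow> \<bar>A f y\<bar> \<le> e"
  using assms unfolding averaging_def lipschitz_fun_def by blast+

lemma averaging_diff_bound:
  assumes "averaging A" "lipschitz_fun f" "lipschitz_fun g" "\<And>y. \<bar>f y - g y\<bar> \<le> e"
  shows "\<bar>A f y - A g y\<bar> \<le> e"
  using averaging_bound[OF assms(1) lipschitz_fun_diff[OF assms(2,3)] assms(4)]
    averaging_diff[OF assms(1-3)] by simp

lemma averaging_compose:
  assumes "averaging A" "averaging G"
  shows "averaging (\<lambda>f. A (G f))"
proof -
  note l = averaging_lipschitz[OF assms(2)]
  show ?thesis
    unfolding averaging_def
    using assms[THEN averaging_lipschitz_on] averaging_bound[OF assms(1) l] averaging_bound[OF assms(2)]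
    by (auto simp: averaging_diff[OF assms(2)] averaging_diff[OF assms(1) l l])
qed

lemma averaging_funpow: "averaging A \<Longrightarrow> averaging (A ^^ n)"
proof (induction n)
  case 0
  then show ?case by (simp add: averaging_def)
next
  case (Suc n)
  then show ?case using averaging_compose[of A "A ^^ n"] by (simp add: comp_def)
qed

lemma commuting_funpow:
  assumes "averaging A" "averaging G" "commuting A G"
  shows "commuting A (G ^^ n)"
proof (induction n)
  case (Suc n)
  show ?case
    unfolding commuting_def
  proof (intro allI impI)
    fix f :: "'a \<Rightarrow> real" assume f: "lipschitz_fun f"
    then have "lipschitz_fun ((G ^^ n) f)"
      by (intro averaging_lipschitz[OF averaging_funpow[OF assms(2)]])
    then show "A ((G ^^ Suc n) f) = (G ^^ Suc n) (A f)"
      using f assms(3) Suc by (simp add: commuting_def)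
  qed
qed (simp add: commuting_def)

text \<open>Write the difference at \<open>Suc n\<close> as \<open>A\<close> applied to the
  difference at \<open>n\<close>, plus \<open>A\<close> of the \<open>n\<close>-th power of
  \<open>G\<close> minus \<open>G\<close> of it. By commutation the second part is the
  \<open>n\<close>-th power of \<open>G\<close> applied to \<open>A f - G f\<close>, so the one-step
  error is only ever needed at \<open>f\<close>.\<close>

lemma averaging_telescope:
  assumes A: "averaging A" and G: "averaging G" and comm: "commuting A G"
    and f: "lipschitz_fun f" and le: "\<And>y. \<bar>A f y - G f y\<bar> \<le> e"
  shows "\<bar>(A ^^ n) f y - (G ^^ n) f y\<bar> \<le> real n * e"
proof (induction n arbitrary: y)
  case (Suc n)
  note An = averaging_funpow[OF A, of n] and Gn = averaging_funpow[OF G, of n]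
  have fA: "lipschitz_fun ((A ^^ n) f)" "lipschitz_fun ((G ^^ n) f)"
    by (intro averaging_lipschitz[OF An] averaging_lipschitz[OF Gn] f)+
  have "\<bar>A ((A ^^ n) f) y - A ((G ^^ n) f) y\<bar> \<le> real n * e"
    by (rule averaging_diff_bound[OF A fA Suc])
  moreover have "A ((G ^^ n) f) = (G ^^ n) (A f)"
    using commuting_funpow[OF A G comm] f by (simp add: commuting_def)
  moreover have "\<bar>(G ^^ n) (A f) y - (G ^^ n) (G f) y\<bar> \<le> e"
    by (intro averaging_diff_bound[OF Gn] averaging_lipschitz[OF A f] averaging_lipschitz[OF G f] le)
  ultimately show ?case
    by (simp add: funpow_swap1 algebra_simps)
qed simp

lemma averaging_semigroup_funpow:
  assumes S: "averaging_semigroup S" and t: "0 \<le> t" and f: "lipschitz_fun f"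
  shows "(S t ^^ n) f = S (real n * t) f"
proof (induction n)
  case 0
  then show ?case using S f by (simp add: averaging_semigroup_def)
next
  case (Suc n)
  have "S (t + real n * t) f = S t (S (real n * t) f)"
    using S t f unfolding averaging_semigroup_def by simp
  then show ?case by (simp add: Suc algebra_simps)
qed

text \<open>With \<open>n\<close> steps of length \<open>1 / n\<close> the generator error adds up
  to \<open>e\<close>, while the remainders contribute \<open>C / n\<close> and
  \<open>C' / sqrt n\<close>. The constants \<open>C\<close> and \<open>C'\<close> may therefore be
  as large as they like.\<close>

lemma averaging_semigroup_compare:
  assumes S: "averaging_semigroup S" and G: "averaging_semigroup G"
    and comm: "\<And>s t. 0 \<le> s \<Longrightarrow> 0 \<le> t \<Longrightarrow> commuting (S s) (G t)"
    and f: "lipschitz_fun f"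
    and eS: "\<And>t y. 0 < t \<Longrightarrow> t \<le> 1 \<Longrightarrow> \<bar>S t f y - f y - t * g y\<bar> \<le> C * t\<^sup>2"
    and eG: "\<And>t y. 0 < t \<Longrightarrow> t \<le> 1 \<Longrightarrow> \<bar>G t f y - f y - t * g' y\<bar> \<le> C' * (t * sqrt t)"
    and gg': "\<And>y. \<bar>g y - g' y\<bar> \<le> e"
  shows "\<bar>S 1 f y - G 1 f y\<bar> \<le> e"
proof -
  have "\<bar>S 1 f y - G 1 f y\<bar> \<le> e + C * (1 / Suc n) + C' * sqrt (1 / Suc n)" for n
  proof -
    define t where "t = 1 / real (Suc n)"
    have t: "0 < t" "t \<le> 1" "real (Suc n) * t = 1" by (auto simp: t_def)
    have A: "averaging (S t)" "averaging (G t)"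
      using S G t by (auto simp: averaging_semigroup_def)
    have cm: "commuting (S t) (G t)" using comm[of t t] t by simp
    have le: "\<bar>S t f y - G t f y\<bar> \<le> t * e + C * t\<^sup>2 + C' * (t * sqrt t)" for y
    proof -
      have "\<bar>t * (g y - g' y)\<bar> \<le> t * e" using gg'[of y] t by (simp add: abs_mult)
      then show ?thesis using eS[OF t(1,2), of y] eG[OF t(1,2), of y] by (simp add: algebra_simps)
    qed
    have "\<bar>(S t ^^ Suc n) f y - (G t ^^ Suc n) f y\<bar> \<le> real (Suc n) * (t * e + C * t\<^sup>2 + C' * (t * sqrt t))"
      by (rule averaging_telescope) (fact A cm f le)+
    then have "\<bar>S 1 f y - G 1 f y\<bar> \<le> real (Suc n) * (t * e + C * t\<^sup>2 + C' * (t * sqrt t))"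
      using t
        averaging_semigroup_funpow[OF S _ f, of t "Suc n"] averaging_semigroup_funpow[OF G _ f, of t "Suc n"]
      by simp
    also have "\<dots> = (real (Suc n) * t) * (e + C * t + C' * sqrt t)"
      by (simp add: algebra_simps power2_eq_square)
    finally show ?thesis by (simp only: t(3)) (simp add: t_def)
  qed
  moreover have "(\<lambda>n. e + C * (1 / Suc n) + C' * sqrt (1 / Suc n)) \<longlonglongrightarrow> e + C * 0 + C' * sqrt 0"
    by (intro tendsto_intros lim_1_over_n[THEN LIMSEQ_Suc, unfolded of_nat_Suc] LIMSEQ_Suc[OF lim_1_over_n])
  ultimately show ?thesis
    using LIMSEQ_le_const[of _ "e + C * 0 + C' * sqrt 0"] by fastforce
qed

section \<open>Averages over shifts by integrable random elements\<close>

definition L1_element :: "'a measure \<Rightarrow> ('a \<Rightarrow> 'k::{real_normed_vector, second_countable_topology}) \<Rightarrow> bool" where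
  "L1_element M X \<longleftrightarrow> prob_space M \<and> X \<in> borel_measurable M \<and> integrable M (\<lambda>\<omega>. norm (X \<omega>))"

definition shift_avg :: "'a measure \<Rightarrow> ('a \<Rightarrow> 'k::{real_normed_vector, second_countable_topology}) \<Rightarrow> ('k \<Rightarrow> real) \<Rightarrow> 'k \<Rightarrow> real" where
  "shift_avg M X f y = (LINT \<omega>|M. f (y + X \<omega>))"

lemma borel_measurable_lipschitz: "lipschitz_fun f \<Longrightarrow> f \<in> borel_measurable borel"
  unfolding lipschitz_fun_def
  by (blast intro: borel_measurable_continuous_onI lipschitz_on_continuous_on)

lemma lipschitz_on_growth:
  "L-lipschitz_on UNIV f \<Longrightarrow> \<bar>f (y + x)\<bar> \<le> \<bar>f y\<bar> + L * norm x" for f :: "_ \<Rightarrow> real"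
  using lipschitz_onD[of L UNIV f "y + x" y] by (simp add: dist_norm)

lemma integrable_shift:
  assumes X: "L1_element M X" and f: "lipschitz_fun f"
  shows "integrable M (\<lambda>\<omega>. f (y + X \<omega>))"
proof -
  interpret prob_space M using X by (simp add: L1_element_def)
  have [measurable]: "X \<in> borel_measurable M" "f \<in> borel_measurable borel"
    using X f by (auto simp: L1_element_def borel_measurable_lipschitz)
  obtain L where L: "L-lipschitz_on UNIV f" using f unfolding lipschitz_fun_def by blast
  show ?thesis
  proof (rule Bochner_Integration.integrable_bound)
    show "integrable M (\<lambda>\<omega>. \<bar>f y\<bar> + L * norm (X \<omega>))"
      using X by (auto simp: L1_element_def)
    show "AE \<omega> in M. norm (f (y + X \<omega>)) \<le> norm (\<bar>f y\<bar> + L * norm (X \<omega>))"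
      using lipschitz_on_growth[OF L] by (auto intro!: AE_I2 order_trans[OF _ abs_ge_self])
  qed simp
qed

lemma averaging_shift_avg:
  assumes X: "L1_element M X"
  shows "averaging (shift_avg M X)"
  unfolding averaging_def
proof (intro conjI allI impI)
  interpret prob_space M using X by (simp add: L1_element_def)
  note int = integrable_shift[OF X]
  fix f g :: "'b \<Rightarrow> real" and L e y
  show "L-lipschitz_on UNIV (shift_avg M X f)" if L: "L-lipschitz_on UNIV f"
  proof (rule lipschitz_onI)
    show "0 \<le> L" using L by (rule lipschitz_on_nonneg)
    fix x y
    have i: "integrable M (\<lambda>\<omega>. f (y + X \<omega>))" for y
      using L unfolding lipschitz_fun_def by (intro int[unfolded lipschitz_fun_def]) blast
    have "\<bar>LINT \<omega>|M. f (x + X \<omega>) - f (y + X \<omega>)\<bar> \<le> (LINT \<omega>|M. L * dist x y)"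
    proof (rule order_trans[OF integral_abs_bound integral_mono])
      show "\<bar>f (x + X \<omega>) - f (y + X \<omega>)\<bar> \<le> L * dist x y" for \<omega>
        using lipschitz_onD[OF L, of "x + X \<omega>" "y + X \<omega>"] by (simp add: dist_norm)
    qed (use i in auto)
    then show "dist (shift_avg M X f x) (shift_avg M X f y) \<le> L * dist x y"
      using i by (simp add: shift_avg_def dist_norm prob_space)
  qed
  show "shift_avg M X (\<lambda>y. f y - g y) = (\<lambda>y. shift_avg M X f y - shift_avg M X g y)"
    if "lipschitz_fun f" "lipschitz_fun g"
    by (auto simp: shift_avg_def fun_eq_iff int that)
  show "\<bar>shift_avg M X f y\<bar> \<le> e" if "lipschitz_fun f" "\<forall>y. \<bar>f y\<bar> \<le> e"
  proof -
    have "\<bar>shift_avg M X f y\<bar> \<le> (LINT \<omega>|M. e)"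
      unfolding shift_avg_def
      by (rule order_trans[OF integral_abs_bound integral_mono]) (use that int in auto)
    then show ?thesis by (simp add: prob_space)
  qed
qed

lemma L1_element_pair:
  assumes X: "L1_element M X" and Y: "L1_element M' Y"
  shows "L1_element (M \<Otimes>\<^sub>M M') (\<lambda>(x, y). X x + Y y)"
proof -
  interpret M: prob_space M using X by (simp add: L1_element_def)
  interpret M': prob_space M' using Y by (simp add: L1_element_def)
  interpret P: pair_prob_space M M' ..
  have [measurable]: "X \<in> borel_measurable M" "Y \<in> borel_measurable M'"
    using X Y by (auto simp: L1_element_def)
  have "integrable (M \<Otimes>\<^sub>M M') (\<lambda>(x, y). norm (X x + Y y))"
  proof (rule Bochner_Integration.integrable_bound)
    have "integrable (M \<Otimes>\<^sub>M M') (\<lambda>(x, y). norm (X x))" "integrable (M \<Otimes>\<^sub>M M') (\<lambda>(x, y). norm (Y y))"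
      using X Y unfolding L1_element_def
      by (auto intro!: P.Fubini_integrable simp: M.prob_space M'.prob_space)
    then show "integrable (M \<Otimes>\<^sub>M M') (\<lambda>(x, y). norm (X x) + norm (Y y))"
      by (simp add: case_prod_beta')
  qed (auto simp: norm_triangle_ineq)
  then show ?thesis
    by (simp add: L1_element_def P.prob_space_axioms case_prod_beta')
qed

text \<open>Fubini in the two orders. Both compositions equal the average over the independent sum,
  which yields commutation although the two elements live on different probability spaces.\<close>

lemma shift_avg_compose:
  assumes X: "L1_element M X" and Y: "L1_element M' Y" and f: "lipschitz_fun f"
  shows "shift_avg M X (shift_avg M' Y f) = shift_avg (M \<Otimes>\<^sub>M M') (\<lambda>(x, y). X x + Y y) f"
    and "shift_avg M' Y (shift_avg M X f) = shift_avg (M \<Otimes>\<^sub>M M') (\<lambda>(x, y). X x + Y y) f"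
proof -
  interpret M: prob_space M using X by (simp add: L1_element_def)
  interpret M': prob_space M' using Y by (simp add: L1_element_def)
  interpret P: pair_prob_space M M' ..
  have i: "integrable (M \<Otimes>\<^sub>M M') (\<lambda>(x, y'). f (y + (X x + Y y')))" for y
    using integrable_shift[OF L1_element_pair[OF X Y] f, of y] by (simp add: case_prod_beta')
  show *: "shift_avg M X (shift_avg M' Y f) = shift_avg (M \<Otimes>\<^sub>M M') (\<lambda>(x, y). X x + Y y) f"
    using P.integral_fst[OF i] unfolding shift_avg_def fun_eq_iff case_prod_beta by (simp add: add_ac)
  show "shift_avg M' Y (shift_avg M X f) = shift_avg (M \<Otimes>\<^sub>M M') (\<lambda>(x, y). X x + Y y) f"
    using P.integral_snd[OF i] unfolding shift_avg_def fun_eq_iff case_prod_beta by (simp add: add_ac)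
qed

lemma commuting_shift_avg: "L1_element M X \<Longrightarrow> L1_element M' Y \<Longrightarrow> commuting (shift_avg M X) (shift_avg M' Y)"
  unfolding commuting_def by (auto intro: trans[OF shift_avg_compose(1) shift_avg_compose(2)[symmetric]])

section \<open>Gaussian elements\<close>

text \<open>The Gaussian characteristic function in real form. Centring removes the mean, so the
  phase \<open>c\<close> splits off as a factor; a degenerate law gets \<open>v = 0\<close>.\<close>

lemma gaussian_real_cos:
  assumes "prob_space M" "gaussian_real M U" "(LINT x|M. U x) = 0"
  obtains v where "\<And>c r. (LINT x|M. cos (c + r * U x)) = cos c * exp (- (v * r\<^sup>2) / 2)"
proof -
  interpret prob_space M by fact
  have [measurable]: "U \<in> borel_measurable M" using assms by (simp add: gaussian_real_def)
  consider m \<sigma> where "0 < \<sigma>" "distributed M lborel U (normal_density m \<sigma>)" | m where "AE x in M. U x = m"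
    using assms by (auto simp: gaussian_real_def)
  then show ?thesis
  proof cases
    case 1
    then have m: "m = 0" using normal_distributed_expectation[of \<sigma> U m] assms(3) by simp
    have "distributed M lborel (\<lambda>x. (U x - m) / \<sigma>) std_normal_density"
      using 1 normal_standard_normal_convert[of \<sigma> U m] by simp
    then have "distr M lborel (\<lambda>x. U x / \<sigma>) = density lborel std_normal_density"
      by (simp add: m distributed_def)
    then have d: "distr M borel (\<lambda>x. U x / \<sigma>) = std_normal_distribution"
      by (metis distr_cong sets_lborel)
    have "(LINT x|M. cos (c + r * U x)) = cos c * exp (- (\<sigma>\<^sup>2 * r\<^sup>2) / 2)" for c r
    proof -
      have "(CLINT x|M. iexp (r * \<sigma> * (U x / \<sigma>))) = char std_normal_distribution (r * \<sigma>)"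
        unfolding char_def d[symmetric] by (subst integral_distr) auto
      also have "\<dots> = exp (- ((r * \<sigma>)\<^sup>2) / 2)" by (simp add: char_std_normal_distribution)
      finally have *: "(CLINT x|M. iexp (r * U x)) = exp (- ((r * \<sigma>)\<^sup>2) / 2)"
        using 1 by simp
      have i: "integrable M (\<lambda>x. iexp (r * U x))" by (rule integrable_iexp) auto
      have "(LINT x|M. cos (c + r * U x)) = (LINT x|M. Re (cis c * iexp (r * U x)))"
        by (rule Bochner_Integration.integral_cong) (auto simp: Re_exp Im_exp cos_add)
      also have "\<dots> = Re (CLINT x|M. cis c * iexp (r * U x))"
        using i by (intro integral_Re) auto
      also have "\<dots> = Re (cis c * (CLINT x|M. iexp (r * U x)))" using i by simp
      also have "\<dots> = cos c * exp (- (\<sigma>\<^sup>2 * r\<^sup>2) / 2)"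
        unfolding * by (simp add: power_mult_distrib mult.commute)
      finally show ?thesis .
    qed
    then show ?thesis by (rule that)
  next
    case 2
    have "(LINT x|M. U x) = (LINT x|M. m)" by (rule integral_cong_AE) (use 2 in auto)
    then have m: "m = 0" using assms(3) by (simp add: prob_space)
    have "(LINT x|M. cos (c + r * U x)) = cos c * exp (- (0 * r\<^sup>2) / 2)" for c r
    proof -
      have "(LINT x|M. cos (c + r * U x)) = (LINT x|M. cos c)"
        by (rule integral_cong_AE) (use 2 m in auto)
      then show ?thesis by (simp add: prob_space)
    qed
    then show ?thesis by (rule that)
  qed
qed

lemma gaussian_real_moments:
  assumes "prob_space M" "gaussian_real M U"
  shows "integrable M (\<lambda>x. \<bar>U x\<bar> ^ k)"
proof -
  interpret prob_space M by fact
  have [measurable]: "U \<in> borel_measurable M" using assms by (simp add: gaussian_real_def)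
  consider m \<sigma> where "0 < \<sigma>" "distributed M lborel U (normal_density m \<sigma>)" | m where "AE x in M. U x = m"
    using assms by (auto simp: gaussian_real_def)
  then show ?thesis
  proof cases
    case 1
    have "distributed M lborel (\<lambda>x. (U x - m) / \<sigma>) std_normal_density"
      using 1 normal_standard_normal_convert[of \<sigma> U m] by simp
    then have "distr M lborel (\<lambda>x. (U x - m) / \<sigma>) = density lborel std_normal_density"
      by (simp add: distributed_def)
    then have d: "distr M borel (\<lambda>x. (U x - m) / \<sigma>) = std_normal_distribution"
      by (metis distr_cong sets_lborel)
    have i: "integrable M (\<lambda>x. ((U x - m) / \<sigma>) ^ j)" for j
      using integrable_std_normal_distribution_moment[of j] unfolding d[symmetric]
      by (subst (asm) integrable_distr_eq) auto
    have "U x ^ k = (\<Sum>j\<le>k. of_nat (k choose j) * (\<sigma> * ((U x - m) / \<sigma>)) ^ j * m ^ (k - j))" for x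
      using 1 binomial_ring[of "\<sigma> * ((U x - m) / \<sigma>)" m k] by simp
    moreover have "integrable M (\<lambda>x. \<Sum>j\<le>k. of_nat (k choose j) * (\<sigma> * ((U x - m) / \<sigma>)) ^ j * m ^ (k - j))"
      unfolding power_mult_distrib by (intro Bochner_Integration.integrable_sum integrable_mult_right integrable_mult_left i)
    ultimately have "integrable M (\<lambda>x. U x ^ k)" by simp
    from integrable_abs[OF this] show ?thesis by (simp add: power_abs)
  next
    case 2
    have "AE x in M. norm (\<bar>U x\<bar> ^ k) \<le> \<bar>m\<bar> ^ k" using 2 by eventually_elim simp
    then show ?thesis by (intro integrable_const_bound) auto
  qed
qed

section \<open>Random elements in the span of a finite orthonormal family\<close>

definition orthonormal_upto :: "nat \<Rightarrow> (nat \<Rightarrow> 'k::real_inner) \<Rightarrow> bool" where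
  "orthonormal_upto d e \<longleftrightarrow> (\<forall>i<d. \<forall>j<d. inner (e i) (e j) = (if i = j then 1 else 0))"

text \<open>The null set in the hypothesis depends on \<open>u\<close>, so only countably many test
  vectors can be used. For \<open>k\<close> in a countable dense set, \<open>k - P k\<close> is
  orthogonal to every \<open>e i\<close>; as the projection \<open>P\<close> is self-adjoint,
  \<open>Z - P Z\<close> is almost surely orthogonal to a dense set and hence 0.\<close>

lemma AE_in_span_orthonormal:
  fixes Z :: "'b \<Rightarrow> 'k::{real_inner, second_countable_topology}"
  assumes e: "orthonormal_upto d e"
    and Z: "\<And>u. (\<And>i. i < d \<Longrightarrow> inner (e i) u = 0) \<Longrightarrow> AE \<omega> in M. inner (Z \<omega>) u = 0"
  shows "AE \<omega> in M. Z \<omega> = (\<Sum>i<d. inner (Z \<omega>) (e i) *\<^sub>R e i)"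
proof -
  define P where "P x = (\<Sum>i<d. inner x (e i) *\<^sub>R e i)" for x
  have Pe: "inner (P x) (e j) = inner x (e j)" if "j < d" for x j
  proof -
    have "inner (P x) (e j) = (\<Sum>i<d. inner x (e i) * (if i = j then 1 else 0))"
      unfolding P_def inner_sum_left using e that by (auto simp: orthonormal_upto_def intro!: sum.cong)
    then show ?thesis using that by (simp add: if_distrib cong: if_cong)
  qed
  have sym: "inner (x - P x) y = inner x (y - P y)" for x y
    by (simp add: P_def inner_diff inner_sum_left inner_sum_right inner_commute mult.commute)
  obtain D :: "'k set" where D: "countable D" "\<And>X. open X \<Longrightarrow> X \<noteq> {} \<Longrightarrow> \<exists>d\<in>D. d \<in> X"
    using countable_dense_exists by metis
  have "AE \<omega> in M. \<forall>k\<in>D. inner (Z \<omega>) (k - P k) = 0"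
  proof (subst AE_ball_countable[OF D(1)], intro ballI Z)
    fix k i assume "i < d"
    then show "inner (e i) (k - P k) = 0"
      using Pe[of i k] by (simp add: inner_diff_right inner_commute)
  qed
  then show ?thesis
  proof eventually_elim
    case (elim \<omega>)
    define w where "w = Z \<omega> - P (Z \<omega>)"
    have k: "inner w k = 0" if "k \<in> D" for k using elim that by (simp add: w_def sym)
    have "norm w \<le> \<epsilon>" if "0 < \<epsilon>" for \<epsilon>
    proof -
      obtain k where "k \<in> D" "dist w k < \<epsilon>"
        using D(2)[of "ball w \<epsilon>"] \<open>0 < \<epsilon>\<close> by (auto simp: dist_commute)
      then have "norm w * norm w = inner w (w - k)" by (simp add: inner_diff k norm_eq_sqrt_inner)
      also have "\<dots> \<le> norm w * norm (w - k)" by (rule norm_cauchy_schwarz)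
      also have "\<dots> \<le> norm w * \<epsilon>" using \<open>dist w k < \<epsilon>\<close> by (intro mult_left_mono) (auto simp: dist_norm)
      finally show ?thesis using \<open>0 < \<epsilon>\<close> by (cases "norm w = 0") auto
    qed
    then have "norm w \<le> 0" by (rule field_le_epsilon[of _ 0, simplified])
    then show ?case by (simp add: w_def P_def)
  qed
qed

text \<open>On a finite-dimensional subspace the law is the joint law of the coordinates, and a
  linear combination of coordinates is an inner product with one vector. It serves to identify the
  law of a sum of independent Gaussian elements.\<close>

lemma expectation_eq_if_cf_eq:
  fixes X :: "'a \<Rightarrow> 'k::{real_inner, second_countable_topology}" and Y :: "'b \<Rightarrow> 'k" and f :: "'k \<Rightarrow> real"
    and e :: "nat \<Rightarrow> 'k"
  assumes M: "prob_space M" and N: "prob_space N"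
    and [measurable]: "X \<in> borel_measurable M" "Y \<in> borel_measurable N" "f \<in> borel_measurable borel"
    and X: "AE \<omega> in M. X \<omega> = (\<Sum>i<d. inner (X \<omega>) (e i) *\<^sub>R e i)"
    and Y: "AE \<omega> in N. Y \<omega> = (\<Sum>i<d. inner (Y \<omega>) (e i) *\<^sub>R e i)"
    and cf: "\<And>b u. (LINT \<omega>|M. cos (b + inner (X \<omega>) u)) = (LINT \<omega>|N. cos (b + inner (Y \<omega>) u))"
  shows "(LINT \<omega>|M. f (X \<omega>)) = (LINT \<omega>|N. f (Y \<omega>))"
proof -
  have s: "(\<Sum>i<d. a i * inner x (e i)) = inner x (\<Sum>i<d. a i *\<^sub>R e i)" for a and x :: 'k
    by (simp add: inner_sum_right)
  have J: "distr M (Pi\<^sub>M {..<d} (\<lambda>_. borel)) (\<lambda>\<omega>. \<lambda>i\<in>{..<d}. inner (X \<omega>) (e i))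
    = distr N (Pi\<^sub>M {..<d} (\<lambda>_. borel)) (\<lambda>\<omega>. \<lambda>i\<in>{..<d}. inner (Y \<omega>) (e i))"
    by (rule joint_distr_unique[OF M N, where X = "\<lambda>i \<omega>. inner (X \<omega>) (e i)" and Y = "\<lambda>i \<omega>. inner (Y \<omega>) (e i)"])
       (simp_all add: s cf)
  define g where "g z = f (\<Sum>i<d. z i *\<^sub>R e i)" for z
  have [measurable]: "g \<in> borel_measurable (Pi\<^sub>M {..<d} (\<lambda>_. borel))" unfolding g_def by measurable
  have "(LINT \<omega>|M. f (X \<omega>)) = (LINT \<omega>|M. g (\<lambda>i\<in>{..<d}. inner (X \<omega>) (e i)))"
    by (rule integral_cong_AE) (use X in \<open>auto simp: g_def\<close>)
  also have "\<dots> = (LINT \<omega>|N. g (\<lambda>i\<in>{..<d}. inner (Y \<omega>) (e i)))"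
    using arg_cong[OF J, of "\<lambda>D. integral\<^sup>L D g"] by (subst (asm) (1 2) integral_distr) auto
  also have "\<dots> = (LINT \<omega>|N. f (Y \<omega>))"
    by (rule integral_cong_AE) (use Y in \<open>auto simp: g_def\<close>)
  finally show ?thesis .
qed

text \<open>Polarization writes a product of two coordinates as a difference of squares of inner
  products, so the second moments of one-dimensional projections determine the expectation of any
  bilinear form on the diagonal.\<close>

lemma quadratic_form_integral_eq:
  fixes X :: "'a \<Rightarrow> 'k::{real_inner, second_countable_topology}" and Y :: "'b \<Rightarrow> 'k" and B :: "'k \<Rightarrow>\<^sub>L 'k \<Rightarrow>\<^sub>L real"
  assumes [measurable]: "X \<in> borel_measurable M" "Y \<in> borel_measurable N"
    and X: "AE \<omega> in M. X \<omega> = (\<Sum>i<d. inner (X \<omega>) (e i) *\<^sub>R e i)"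
    and Y: "AE \<omega> in N. Y \<omega> = (\<Sum>i<d. inner (Y \<omega>) (e i) *\<^sub>R e i)"
    and iX: "\<And>u. integrable M (\<lambda>\<omega>. (inner (X \<omega>) u)\<^sup>2)" and iY: "\<And>u. integrable N (\<lambda>\<omega>. (inner (Y \<omega>) u)\<^sup>2)"
    and eq: "\<And>u. (LINT \<omega>|M. (inner (X \<omega>) u)\<^sup>2) = (LINT \<omega>|N. (inner (Y \<omega>) u)\<^sup>2)"
  shows "(LINT \<omega>|M. B (X \<omega>) (X \<omega>)) = (LINT \<omega>|N. B (Y \<omega>) (Y \<omega>))"
proof -
  define q where "q x = (\<Sum>i<d. \<Sum>j<d. ((inner x (e i + e j))\<^sup>2 - (inner x (e i - e j))\<^sup>2) / 4 * B (e i) (e j))" for x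
  have q: "B x x = q x" if "x = (\<Sum>i<d. inner x (e i) *\<^sub>R e i)" for x
  proof -
    have "B x x = B (\<Sum>i<d. inner x (e i) *\<^sub>R e i) (\<Sum>i<d. inner x (e i) *\<^sub>R e i)"
      using that by simp
    also have "\<dots> = (\<Sum>i<d. \<Sum>j<d. inner x (e i) * inner x (e j) * B (e i) (e j))"
      by (simp add: blinfun.sum_left blinfun.sum_right blinfun.scaleR_left blinfun.scaleR_right
          sum_distrib_left mult.assoc) (subst sum.swap, simp add: mult.left_commute)
    also have "\<dots> = q x"
      unfolding q_def by (intro sum.cong refl) (simp add: inner_add inner_diff power2_eq_square algebra_simps)
    finally show ?thesis .
  qed
  have [measurable]: "(\<lambda>x. B x x) \<in> borel_measurable borel"
    by (intro borel_measurable_continuous_onI continuous_intros)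
  have [measurable]: "q \<in> borel_measurable borel" unfolding q_def by measurable
  have "(LINT \<omega>|M. B (X \<omega>) (X \<omega>)) = (LINT \<omega>|M. q (X \<omega>))"
    by (rule integral_cong_AE) (use X in \<open>auto simp: q\<close>)
  also have "\<dots> = (LINT \<omega>|N. q (Y \<omega>))"
    unfolding q_def by (simp add: Bochner_Integration.integral_sum Bochner_Integration.integral_diff iX iY eq)
  also have "\<dots> = (LINT \<omega>|N. B (Y \<omega>) (Y \<omega>))"
    by (rule integral_cong_AE) (use Y in \<open>auto simp: q\<close>)
  finally show ?thesis .
qed

section \<open>The semigroup of a Gaussian element with finite-dimensional range\<close>

context
  fixes M :: "'b measure" and Z :: "'b \<Rightarrow> 'k::{real_inner, banach, second_countable_topology}"
    and d :: nat and e :: "nat \<Rightarrow> 'k"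
  assumes M: "prob_space M" and gauss: "gaussian_element M Z" and centred: "centred_square_integrable M Z"
    and e: "orthonormal_upto d e"
    and span: "AE \<omega> in M. Z \<omega> = (\<Sum>i<d. inner (Z \<omega>) (e i) *\<^sub>R e i)"
begin

interpretation prob_space M by (rule M)

lemma gaussian_element_L1: "L1_element M (\<lambda>\<omega>. c *\<^sub>R Z \<omega>)"
proof -
  have [measurable]: "Z \<in> borel_measurable M" using gauss by (simp add: gaussian_element_def)
  have "integrable M (\<lambda>\<omega>. norm (Z \<omega>))"
    by (rule square_integrable_imp_integrable) (use centred in \<open>simp_all add: centred_square_integrable_def\<close>)
  then show ?thesis by (simp add: L1_element_def M)
qed

lemma gaussian_element_integrable: "integrable M Z"
  using gaussian_element_L1[of 1] gauss
  by (intro integrable_norm_cancel[of M Z]) (simp_all add: L1_element_def gaussian_element_def)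

text \<open>In the span of \<open>d\<close> unit vectors the norm is at most \<open>d\<close> times
  the largest absolute coordinate, whose cube is at most the sum of all cubes. Only finiteness
  counts: this moment multiplies an error that vanishes in the limit.\<close>

lemma gaussian_element_third_moment: "integrable M (\<lambda>\<omega>. norm (Z \<omega>) ^ 3)"
proof -
  have [measurable]: "Z \<in> borel_measurable M" using gauss by (simp add: gaussian_element_def)
  show ?thesis
  proof (rule Bochner_Integration.integrable_bound)
    show "integrable M (\<lambda>\<omega>. real d ^ 3 * (\<Sum>i<d. \<bar>inner (Z \<omega>) (e i)\<bar> ^ 3))"
      using gauss by (intro integrable_mult_right Bochner_Integration.integrable_sum gaussian_real_moments[OF M])
        (auto simp: gaussian_element_def)
    show "AE \<omega> in M. norm (norm (Z \<omega>) ^ 3) \<le> norm (real d ^ 3 * (\<Sum>i<d. \<bar>inner (Z \<omega>) (e i)\<bar> ^ 3))"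
      using span
    proof eventually_elim
      case (elim \<omega>)
      show ?case
      proof (cases "d = 0")
        case False
        define a where "a i = \<bar>inner (Z \<omega>) (e i)\<bar>" for i
        define m where "m = Max (a ` {..<d})"
        have m: "m \<in> a ` {..<d}" "\<And>i. i < d \<Longrightarrow> a i \<le> m" unfolding m_def using False by (auto intro!: Max_in)
        then have m0: "0 \<le> m" by (auto simp: a_def)
        have "norm (Z \<omega>) = norm (\<Sum>i<d. inner (Z \<omega>) (e i) *\<^sub>R e i)" using elim by simp
        also have "\<dots> \<le> (\<Sum>i<d. a i)"
          using e by (intro sum_norm_le) (auto simp: a_def orthonormal_upto_def norm_eq_sqrt_inner)
        also have "\<dots> \<le> real d * m" using sum_bounded_above[of "{..<d}" a m] m by simp
        finally have "norm (Z \<omega>) ^ 3 \<le> (real d * m) ^ 3" by (intro power_mono) auto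
        also have "\<dots> = real d ^ 3 * m ^ 3" by (simp add: power_mult_distrib)
        also have "m ^ 3 \<le> (\<Sum>i<d. a i ^ 3)"
          using m(1) by (auto simp: a_def intro!: member_le_sum[of _ _ "\<lambda>i. \<bar>inner (Z \<omega>) (e i)\<bar> ^ 3"])
        finally show ?thesis by (simp add: a_def mult_left_mono sum_nonneg)
      qed (use elim in simp)
    qed
  qed simp
qed

text \<open>For independent copies \<open>Z\<close> and \<open>Z'\<close>, the sum
  \<open>sqrt s *\<^sub>R Z + sqrt t *\<^sub>R Z'\<close> has the law of
  \<open>sqrt (s + t) *\<^sub>R Z\<close>, because the variances in each direction add.\<close>

lemma gaussian_averaging_semigroup: "averaging_semigroup (\<lambda>s. shift_avg M (\<lambda>\<omega>. sqrt s *\<^sub>R Z \<omega>))"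
  unfolding averaging_semigroup_def
proof (intro conjI allI impI)
  have [measurable]: "Z \<in> borel_measurable M" using gauss by (simp add: gaussian_element_def)
  fix s t :: real and f :: "'k \<Rightarrow> real"
  show "averaging (shift_avg M (\<lambda>\<omega>. sqrt s *\<^sub>R Z \<omega>))"
    by (rule averaging_shift_avg[OF gaussian_element_L1])
  show "shift_avg M (\<lambda>\<omega>. sqrt 0 *\<^sub>R Z \<omega>) f = f"
    by (simp add: shift_avg_def prob_space fun_eq_iff)
  assume s: "0 \<le> s" and t: "0 \<le> t" and f: "lipschitz_fun f"
  interpret P: pair_prob_space M M ..
  have [measurable]: "f \<in> borel_measurable borel" using f by (rule borel_measurable_lipschitz)
  let ?W = "\<lambda>(x, x'). sqrt s *\<^sub>R Z x + sqrt t *\<^sub>R Z x'"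
  have cf: "(LINT p|(M \<Otimes>\<^sub>M M). cos (b + inner (?W p) u))
      = (LINT x|M. cos (b + inner (sqrt (s + t) *\<^sub>R Z x) u))" for b u
  proof -
    have "(LINT x|M. inner (Z x) u) = inner (LINT x|M. Z x) u"
      by (rule integral_inner_left) (use gaussian_element_integrable in auto)
    then have "(LINT x|M. inner (Z x) u) = 0" using centred by (simp add: centred_square_integrable_def)
    moreover have "gaussian_real M (\<lambda>x. inner (Z x) u)" using gauss by (simp add: gaussian_element_def)
    ultimately obtain v where v: "\<And>c r. (LINT x|M. cos (c + r * inner (Z x) u)) = cos c * exp (- (v * r\<^sup>2) / 2)"
      using gaussian_real_cos[OF M] by metis
    have "integrable (M \<Otimes>\<^sub>M M) (\<lambda>(x, x'). cos (b + sqrt s * inner (Z x) u + sqrt t * inner (Z x') u))"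
      by (rule P.integrable_const_bound[of _ 1]) auto
    from P.integral_fst[OF this]
    have "(LINT p|(M \<Otimes>\<^sub>M M). cos (b + inner (?W p) u))
      = (LINT x|M. LINT x'|M. cos (b + sqrt s * inner (Z x) u + sqrt t * inner (Z x') u))"
      by (simp add: case_prod_beta' inner_add add.assoc)
    \<comment> \<open>The integral over the second copy leaves a constant times a cosine of the
      first, so \<open>v\<close> applies a second time.\<close>
    also have "\<dots> = cos b * exp (- (v * (sqrt s)\<^sup>2) / 2) * exp (- (v * (sqrt t)\<^sup>2) / 2)"
      by (simp only: v integral_mult_left_zero)
    also have "\<dots> = cos b * exp (- (v * (sqrt (s + t))\<^sup>2) / 2)"
      using s t by (simp add: mult_exp_exp mult.assoc add_divide_distrib[symmetric] distrib_left)
    finally show ?thesis by (simp add: v)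
  qed
  have sp: "AE p in M \<Otimes>\<^sub>M M. ?W p
     = (\<Sum>i<d. inner (?W p) (e i) *\<^sub>R e i)"
  proof -
    have "AE p in M \<Otimes>\<^sub>M M. Z (fst p) = (\<Sum>i<d. inner (Z (fst p)) (e i) *\<^sub>R e i)"
    proof (rule P.AE_pair_measure)
      show "AE x in M. AE x' in M. Z (fst (x, x')) = (\<Sum>i<d. inner (Z (fst (x, x'))) (e i) *\<^sub>R e i)"
        using span by eventually_elim simp
    qed simp
    moreover have "AE p in M \<Otimes>\<^sub>M M. Z (snd p) = (\<Sum>i<d. inner (Z (snd p)) (e i) *\<^sub>R e i)"
    proof (rule P.AE_pair_measure)
      show "AE x in M. AE x' in M. Z (snd (x, x')) = (\<Sum>i<d. inner (Z (snd (x, x'))) (e i) *\<^sub>R e i)"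
        using span by simp
    qed simp
    ultimately show ?thesis
    proof eventually_elim
      case (elim p)
      have "sqrt s *\<^sub>R Z (fst p) + sqrt t *\<^sub>R Z (snd p) =
        sqrt s *\<^sub>R (\<Sum>i<d. inner (Z (fst p)) (e i) *\<^sub>R e i) + sqrt t *\<^sub>R (\<Sum>i<d. inner (Z (snd p)) (e i) *\<^sub>R e i)"
        using elim by simp
      also have "\<dots> = (\<Sum>i<d. inner (sqrt s *\<^sub>R Z (fst p) + sqrt t *\<^sub>R Z (snd p)) (e i) *\<^sub>R e i)"
        by (simp add: inner_add scaleR_add_left sum.distrib scaleR_sum_right)
      finally show ?case by (simp add: case_prod_beta')
    qed
  qed
  have sp': "AE x in M. sqrt (s + t) *\<^sub>R Z x = (\<Sum>i<d. inner (sqrt (s + t) *\<^sub>R Z x) (e i) *\<^sub>R e i)"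
    using span
  proof eventually_elim
    case (elim x)
    then have "sqrt (s + t) *\<^sub>R Z x = sqrt (s + t) *\<^sub>R (\<Sum>i<d. inner (Z x) (e i) *\<^sub>R e i)"
      by (rule arg_cong)
    also have "\<dots> = (\<Sum>i<d. inner (sqrt (s + t) *\<^sub>R Z x) (e i) *\<^sub>R e i)"
      by (simp add: scaleR_sum_right)
    finally show ?case .
  qed
  show "shift_avg M (\<lambda>\<omega>. sqrt (s + t) *\<^sub>R Z \<omega>) f = shift_avg M (\<lambda>\<omega>. sqrt s *\<^sub>R Z \<omega>) (shift_avg M (\<lambda>\<omega>. sqrt t *\<^sub>R Z \<omega>) f)"
    unfolding shift_avg_compose[OF gaussian_element_L1 gaussian_element_L1 f]
    unfolding shift_avg_def
    by (rule ext, rule expectation_eq_if_cf_eq[OF M P.prob_space_axioms _ _ _ sp' sp cf[symmetric]]) simp_all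
qed

text \<open>The linear Taylor term has mean zero because \<open>Z\<close> is centred. The quadratic
  term is of order \<open>s\<close>, and the cubic remainder carries
  \<open>sqrt s ^ 3 = s * sqrt s\<close>, which is small against \<open>s\<close>.\<close>

lemma gaussian_second_order:
  assumes h: "h \<in> Cb3" "Cb3_norm h \<le> 1" and s: "0 \<le> s"
  shows "\<bar>shift_avg M (\<lambda>\<omega>. sqrt s *\<^sub>R Z \<omega>) h y - h y - s * ((LINT \<omega>|M. fderiv (fderiv h) y (Z \<omega>) (Z \<omega>)) / 2)\<bar>
    \<le> (LINT \<omega>|M. norm (Z \<omega>) ^ 3) / 6 * (s * sqrt s)"
proof -
  have [measurable]: "Z \<in> borel_measurable M" using gauss by (simp add: gaussian_element_def)
  have lip: "lipschitz_fun h"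
    unfolding lipschitz_fun_def using Cb3_lipschitz[OF h] by (intro exI[of _ 1] lipschitz_onI) (auto simp: dist_norm)
  let ?D = "fderiv h y" and ?B = "fderiv (fderiv h) y"
  have [measurable]: "(\<lambda>x. ?B x x) \<in> borel_measurable borel"
    by (intro borel_measurable_continuous_onI continuous_intros)
  have i1: "integrable M (\<lambda>\<omega>. h (y + sqrt s *\<^sub>R Z \<omega>))" by (rule integrable_shift[OF gaussian_element_L1 lip])
  have i2: "integrable M (\<lambda>\<omega>. ?D (Z \<omega>))"
    by (rule integrable_bounded_linear[OF blinfun.bounded_linear_right gaussian_element_integrable])
  have i3: "integrable M (\<lambda>\<omega>. ?B (Z \<omega>) (Z \<omega>))"
  proof (rule Bochner_Integration.integrable_bound)
    show "integrable M (\<lambda>\<omega>. (norm (Z \<omega>))\<^sup>2)" using centred by (simp add: centred_square_integrable_def)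
  qed (use Cb3_norm_D2[OF h(2)] in auto)
  have D0: "(LINT \<omega>|M. ?D (Z \<omega>)) = 0"
    using integral_bounded_linear[OF blinfun.bounded_linear_right gaussian_element_integrable, of ?D] centred
    by (simp add: centred_square_integrable_def)
  have "\<bar>LINT \<omega>|M. h (y + sqrt s *\<^sub>R Z \<omega>) - h y - sqrt s * ?D (Z \<omega>) - s * (?B (Z \<omega>) (Z \<omega>) / 2)\<bar>
      \<le> (LINT \<omega>|M. s * sqrt s * (norm (Z \<omega>) ^ 3 / 6))"
  proof (rule order_trans[OF integral_abs_bound integral_mono])
    fix \<omega>
    have "s * sqrt s = sqrt s ^ 3" using s by (simp add: power3_eq_cube)
    then show "\<bar>h (y + sqrt s *\<^sub>R Z \<omega>) - h y - sqrt s * ?D (Z \<omega>) - s * (?B (Z \<omega>) (Z \<omega>) / 2)\<bar> \<le> s * sqrt s * (norm (Z \<omega>) ^ 3 / 6)"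
      using Cb3_taylor[OF h, of y "sqrt s *\<^sub>R Z \<omega>"] s
      by (simp add: blinfun.scaleR_right blinfun.scaleR_left power_mult_distrib mult.assoc[symmetric])
  qed (use i1 i2 i3 gaussian_element_third_moment in auto)
  also have "(LINT \<omega>|M. h (y + sqrt s *\<^sub>R Z \<omega>) - h y - sqrt s * ?D (Z \<omega>) - s * (?B (Z \<omega>) (Z \<omega>) / 2))
     = shift_avg M (\<lambda>\<omega>. sqrt s *\<^sub>R Z \<omega>) h y - h y - s * ((LINT \<omega>|M. ?B (Z \<omega>) (Z \<omega>)) / 2)"
    using i1 i2 i3 D0 by (simp add: shift_avg_def prob_space)
  finally show ?thesis using gaussian_element_third_moment by (simp add: mult.commute)
qed

end

section \<open>Poisson averaging\<close>

text \<open>Rate 0 occurs for null cells of a partition and at time 0 of the semigroup; the point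
  mass at 0 extends the usual formula to it.\<close>

definition pois :: "real \<Rightarrow> nat pmf" where
  "pois p = (if 0 < p then poisson_pmf p else return_pmf 0)"

lemma pmf_pois: "0 \<le> p \<Longrightarrow> pmf (pois p) k = p ^ k / fact k * exp (- p)"
  by (cases "p = 0") (auto simp: pois_def pmf_return power_0_left)

lemma pmf_nat_integral:
  fixes f :: "nat \<Rightarrow> real"
  assumes "\<And>k. 0 \<le> f k" "(\<lambda>k. pmf P k * f k) sums S"
  shows "integrable (measure_pmf P) f" "(LINT k|P. f k) = S"
proof -
  have S: "0 \<le> S" using assms by (intro sums_le[OF _ sums_zero assms(2)]) auto
  have "(\<integral>\<^sup>+k. f k \<partial>P) = ennreal S"
    unfolding nn_integral_measure_pmf nn_integral_count_space_nat
    using assms by (subst ennreal_mult[symmetric]) (auto intro!: suminf_ennreal_eq)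
  then have "integrable (measure_pmf P) f \<and> (LINT k|P. f k) = S"
    using assms S by (subst (asm) nn_integral_eq_integrable) auto
  then show "integrable (measure_pmf P) f" "(LINT k|P. f k) = S" by auto
qed

text \<open>The second factorial moment is exactly \<open>p\<^sup>2\<close>, without a linear term,
  and its integrand vanishes at the counts 0 and 1. Both facts make it the right bound for a
  first-order expansion in \<open>p\<close>.\<close>

lemma
  assumes p: "0 \<le> p"
  shows pois_integrable: "integrable (pois p) real" and pois_mean: "(LINT k|pois p. real k) = p"
    and pois_integrable2: "integrable (pois p) (\<lambda>k. real k * real (k - 1))"
    and pois_factorial_moment2: "(LINT k|pois p. real k * real (k - 1)) = p\<^sup>2"
proof -
  have e: "(\<lambda>n. p ^ n / fact n * exp (- p) * c) sums c" for c
  proof -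
    have "(\<lambda>n. p ^ n /\<^sub>R fact n) sums exp p" by (rule exp_converges)
    from sums_mult2[OF this, of "exp (- p) * c"]
    have "(\<lambda>n. p ^ n / fact n * exp (- p) * c) sums (exp p * (exp (- p) * c))"
      by (simp add: divide_inverse mult_ac)
    moreover have "exp p * (exp (- p) * c) = c" by (simp add: mult.assoc[symmetric] mult_exp_exp)
    ultimately show ?thesis by simp
  qed
  have s1: "(\<lambda>n. p ^ n / fact n * exp (- p) * real n) sums p"
  proof -
    have "(\<lambda>n. p ^ Suc n / fact (Suc n) * exp (- p) * real (Suc n)) sums p"
      using e[of p] by (rule sums_cong[THEN iffD1, rotated]) (simp add: field_simps del: of_nat_Suc)
    from sums_Suc[OF this] show ?thesis by simp
  qed
  have s2: "(\<lambda>n. p ^ n / fact n * exp (- p) * (real n * real (n - 1))) sums p\<^sup>2"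
  proof -
    have "(\<lambda>n. p ^ Suc n / fact (Suc n) * exp (- p) * (real (Suc n) * real (Suc n - 1))) sums (p * p)"
      using sums_mult[OF s1, of p] by (rule sums_cong[THEN iffD1, rotated]) (simp add: field_simps del: of_nat_Suc)
    from sums_Suc[OF this] show ?thesis by (simp add: power2_eq_square)
  qed
  show "integrable (pois p) real" "(LINT k|pois p. real k) = p"
    using pmf_nat_integral[of real "pois p" p] s1 p by (simp_all add: pmf_pois)
  show "integrable (pois p) (\<lambda>k. real k * real (k - 1))" "(LINT k|pois p. real k * real (k - 1)) = p\<^sup>2"
    using pmf_nat_integral[of "\<lambda>k. real k * real (k - 1)" "pois p" "p\<^sup>2"] s2 p by (simp_all add: pmf_pois)
qed

lemma pois_add:
  assumes "0 \<le> a" "0 \<le> b"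
  shows "map_pmf (\<lambda>(x, y). x + y) (pair_pmf (pois a) (pois b)) = pois (a + b)"
proof (rule pmf_eqI)
  fix n
  have E: "exp (- a - b) = exp (- a) * exp (- b)" by (simp add: mult_exp_exp)
  have "(\<lambda>(x, y). x + y :: nat) -` {n} = (\<lambda>k. (k, n - k)) ` {..n}"
    by (auto simp: image_iff)
  then have "pmf (map_pmf (\<lambda>(x, y). x + y) (pair_pmf (pois a) (pois b))) n
      = (\<Sum>k\<le>n. pmf (pois a) k * pmf (pois b) (n - k))"
    by (subst pmf_map) (simp add: measure_measure_pmf_finite sum.reindex inj_on_def pmf_pair)
  also have "\<dots> = (\<Sum>k\<le>n. of_nat (n choose k) * a ^ k * b ^ (n - k)) / fact n * exp (- (a + b))"
    unfolding sum_divide_distrib sum_distrib_right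
    by (intro sum.cong refl) (simp add: assms pmf_pois binomial_fact E field_simps)
  also have "\<dots> = pmf (pois (a + b)) n"
    using assms by (simp add: pmf_pois binomial_ring)
  finally show "pmf (map_pmf (\<lambda>(x, y). x + y) (pair_pmf (pois a) (pois b))) n = pmf (pois (a + b)) n" .
qed

text \<open>The convolution identity on the product measure, the form in which it meets
  \<open>shift_avg_compose\<close>.\<close>

lemma distr_pois_add:
  assumes "0 \<le> a" "0 \<le> b"
  shows "distr (measure_pmf (pois a) \<Otimes>\<^sub>M measure_pmf (pois b)) (count_space UNIV) (\<lambda>(x, y). x + y) = measure_pmf (pois (a + b))"
proof (rule measure_eqI)
  let ?P = "measure_pmf (pois a) \<Otimes>\<^sub>M measure_pmf (pois b)"
  let ?D = "distr ?P (count_space UNIV) (\<lambda>(x, y). x + y)"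
  interpret P: pair_prob_space "measure_pmf (pois a)" "measure_pmf (pois b)" ..
  have [measurable]: "(\<lambda>(x, y). x + y) \<in> measurable ?P (count_space UNIV)"
    by measurable
  fix S :: "nat set"
  have "emeasure (?D) S
     = (\<integral>\<^sup>+z. indicator S z \<partial>?D)"
    by simp
  also have "\<dots> = (\<integral>\<^sup>+p. indicator S (case p of (x, y) \<Rightarrow> x + y) \<partial>?P)"
    by (subst nn_integral_distr) auto
  also have "\<dots> = (\<integral>\<^sup>+x. \<integral>\<^sup>+y. indicator S (x + y) \<partial>pois b \<partial>pois a)"
    by (subst measure_pmf.nn_integral_fst[symmetric]) auto
  also have "\<dots> = emeasure (measure_pmf (map_pmf (\<lambda>(x, y). x + y) (pair_pmf (pois a) (pois b)))) S"
    by (subst nn_integral_indicator[symmetric]) (simp_all add: nn_integral_pair_pmf')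
  finally show "emeasure (?D) S
     = emeasure (measure_pmf (pois (a + b))) S"
    using pois_add[OF assms] by simp
qed simp

section \<open>Poisson multiples of fixed vectors and their semigroup\<close>

definition pois_avg :: "real \<Rightarrow> 'k::{real_normed_vector, second_countable_topology} \<Rightarrow> ('k \<Rightarrow> real) \<Rightarrow> 'k \<Rightarrow> real" where
  "pois_avg p v = shift_avg (measure_pmf (pois p)) (\<lambda>k. real k *\<^sub>R v)"

lemma L1_element_pois: "0 \<le> p \<Longrightarrow> L1_element (measure_pmf (pois p)) (\<lambda>k. real k *\<^sub>R v)"
  using pois_integrable[of p] by (simp add: L1_element_def measure_pmf.prob_space_axioms)

lemma pois_avg_add:
  assumes "0 \<le> a" "0 \<le> b" and f: "lipschitz_fun f"
  shows "pois_avg (a + b) v f = pois_avg a v (pois_avg b v f)"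
proof
  let ?P = "measure_pmf (pois a) \<Otimes>\<^sub>M measure_pmf (pois b)"
  fix y
  have [measurable]: "f \<in> borel_measurable borel" using f by (rule borel_measurable_lipschitz)
  have [measurable]: "(\<lambda>(x, y). x + y) \<in> measurable ?P (count_space UNIV)"
    by measurable
  have "pois_avg (a + b) v f y = (LINT k|distr ?P (count_space UNIV) (\<lambda>(x, y). x + y). f (y + real k *\<^sub>R v))"
    unfolding distr_pois_add[OF assms(1,2)] by (simp add: pois_avg_def shift_avg_def)
  also have "\<dots> = shift_avg ?P (\<lambda>(k, l). real k *\<^sub>R v + real l *\<^sub>R v) f y"
    unfolding shift_avg_def by (subst integral_distr) (auto simp: case_prod_beta' scaleR_add_left)
  also have "\<dots> = pois_avg a v (pois_avg b v f) y"
    unfolding pois_avg_def using shift_avg_compose(1)[OF L1_element_pois[OF assms(1)] L1_element_pois[OF assms(2)] f, of v v]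
    by simp
  finally show "pois_avg (a + b) v f y = pois_avg a v (pois_avg b v f) y" .
qed

text \<open>The increment \<open>g k\<close> after \<open>k\<close> jumps is compared with
  \<open>k * g 1\<close>. They agree for \<open>k \<le> 1\<close>; for larger \<open>k\<close> the
  Lipschitz bound is linear in \<open>k\<close>, hence dominated by a multiple of
  \<open>k * (k - 1)\<close>, whose mean is \<open>p\<^sup>2\<close>.\<close>

lemma pois_avg_first_order:
  assumes p: "0 \<le> p" and L: "L-lipschitz_on UNIV f"
  shows "\<bar>pois_avg p v f y - f y - p * (f (y + v) - f y)\<bar> \<le> 2 * L * norm v * p\<^sup>2"
proof -
  have f: "lipschitz_fun f" using L unfolding lipschitz_fun_def by blast
  have L0: "0 \<le> L" using L by (rule lipschitz_on_nonneg)
  have i: "integrable (pois p) (\<lambda>k. f (y + real k *\<^sub>R v))" by (rule integrable_shift[OF L1_element_pois[OF p] f])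
  define g where "g k = f (y + real k *\<^sub>R v) - f y" for k :: nat
  have g: "\<bar>g k\<bar> \<le> L * (real k * norm v)" for k
    using lipschitz_onD[OF L, of "y + real k *\<^sub>R v" y] by (simp add: g_def dist_norm)
  have ig: "integrable (pois p) g" unfolding g_def using i by simp
  have "\<bar>LINT k|pois p. g k - real k * g 1\<bar> \<le> (LINT k|pois p. 2 * L * norm v * (real k * real (k - 1)))"
  proof (rule order_trans[OF integral_abs_bound integral_mono])
    fix k :: nat
    consider "k = 0" | "k = 1" | "2 \<le> k" by linarith
    then show "\<bar>g k - real k * g 1\<bar> \<le> 2 * L * norm v * (real k * real (k - 1))"
    proof cases
      case 3
      have "\<bar>real k * g 1\<bar> \<le> real k * (L * norm v)" using g[of 1] by (simp add: abs_mult mult_left_mono)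
      then have "\<bar>g k - real k * g 1\<bar> \<le> 2 * L * norm v * (real k * 1)" using g[of k] by (simp add: algebra_simps)
      also have "\<dots> \<le> 2 * L * norm v * (real k * real (k - 1))"
        using 3 L0 by (intro mult_left_mono) auto
      finally show ?thesis .
    qed (simp_all add: g_def)
  qed (use ig pois_integrable[OF p] pois_integrable2[OF p] in auto)
  also have "\<dots> = 2 * L * norm v * p\<^sup>2" using pois_factorial_moment2[OF p] by simp
  also have "(LINT k|pois p. g k - real k * g 1) = (LINT k|pois p. g k) - p * g 1"
    using ig pois_integrable[OF p] pois_mean[OF p] by simp
  also have "(LINT k|pois p. g k) = pois_avg p v f y - f y"
    unfolding g_def using i by (simp add: pois_avg_def shift_avg_def)
  finally show ?thesis by (simp add: g_def)
qed

lemma pois_avg_zeroth_order: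
  assumes p: "0 \<le> p" and L: "L-lipschitz_on UNIV f"
  shows "\<bar>pois_avg p v f y - f y\<bar> \<le> L * norm v * p"
proof -
  have f: "lipschitz_fun f" using L unfolding lipschitz_fun_def by blast
  have i: "integrable (pois p) (\<lambda>k. f (y + real k *\<^sub>R v))" by (rule integrable_shift[OF L1_element_pois[OF p] f])
  have "\<bar>LINT k|pois p. f (y + real k *\<^sub>R v) - f y\<bar> \<le> (LINT k|pois p. L * norm v * real k)"
  proof (rule order_trans[OF integral_abs_bound integral_mono])
    fix k :: nat
    show "\<bar>f (y + real k *\<^sub>R v) - f y\<bar> \<le> L * norm v * real k"
      using lipschitz_onD[OF L, of "y + real k *\<^sub>R v" y] by (simp add: dist_norm mult_ac)
  qed (use i pois_integrable[OF p] in auto)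
  then show ?thesis using i pois_mean[OF p] by (simp add: pois_avg_def shift_avg_def)
qed

text \<open>The transition operator at time \<open>t\<close> of a compound Poisson process whose
  jumps \<open>snd a\<close> occur at rate \<open>fst a\<close>.\<close>

primrec multi_pois_avg :: "(real \<times> 'k::{real_normed_vector, second_countable_topology}) list \<Rightarrow> real \<Rightarrow> ('k \<Rightarrow> real) \<Rightarrow> 'k \<Rightarrow> real" where
  "multi_pois_avg [] t f = f"
| "multi_pois_avg (a # as) t f = pois_avg (t * fst a) (snd a) (multi_pois_avg as t f)"

lemma averaging_multi_pois_avg:
  assumes "\<And>a. a \<in> set as \<Longrightarrow> 0 \<le> fst a" "0 \<le> t"
  shows "averaging (multi_pois_avg as t)"
  using assms(1)
proof (induction as)
  case Nil
  have "multi_pois_avg [] t = (\<lambda>f. f)" by auto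
  then show ?case by (simp add: averaging_def)
next
  case (Cons a as)
  have "multi_pois_avg (a # as) t = (\<lambda>f. pois_avg (t * fst a) (snd a) (multi_pois_avg as t f))" by auto
  moreover have "averaging (pois_avg (t * fst a) (snd a))"
    unfolding pois_avg_def using Cons.prems[of a] assms(2) by (intro averaging_shift_avg L1_element_pois) auto
  ultimately show ?case using Cons averaging_compose by simp
qed

lemma commuting_multi_pois_avg:
  assumes as: "\<And>a. a \<in> set as \<Longrightarrow> 0 \<le> fst a" "0 \<le> t" and X: "L1_element M X"
  shows "commuting (multi_pois_avg as t) (shift_avg M X)"
  using as(1)
proof (induction as)
  case Nil
  then show ?case by (simp add: commuting_def)
next
  case (Cons a as)
  have c: "commuting (pois_avg (t * fst a) (snd a)) (shift_avg M X)"
    unfolding pois_avg_def using Cons.prems[of a] as(2) by (intro commuting_shift_avg L1_element_pois X) auto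
  have "averaging (multi_pois_avg as t)" using Cons.prems as(2) by (intro averaging_multi_pois_avg) auto
  then have l: "lipschitz_fun (multi_pois_avg as t f)" if "lipschitz_fun f" for f using that by (rule averaging_lipschitz)
  show ?case using Cons c l by (auto simp: commuting_def)
qed

text \<open>Rates add within each factor by \<open>pois_avg_add\<close>; then the factor with rate
  \<open>t * fst a\<close> is commuted past the remaining average of time \<open>s\<close>.\<close>

lemma multi_pois_avg_semigroup:
  fixes as :: "(real \<times> 'k::{real_normed_vector, second_countable_topology}) list"
  assumes as: "\<And>a. a \<in> set as \<Longrightarrow> 0 \<le> fst a"
  shows "averaging_semigroup (multi_pois_avg as)"
  unfolding averaging_semigroup_def
proof (intro conjI allI impI)
  fix s t :: real and f :: "'k \<Rightarrow> real" assume "0 \<le> s" "0 \<le> t" and f: "lipschitz_fun f"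
  then show "multi_pois_avg as (s + t) f = multi_pois_avg as s (multi_pois_avg as t f)"
    using as
  proof (induction as)
    case (Cons a as)
    then have p: "0 \<le> s * fst a" "0 \<le> t * fst a" and as: "\<And>a. a \<in> set as \<Longrightarrow> 0 \<le> fst a" by auto
    note av = averaging_lipschitz[OF averaging_multi_pois_avg[OF as]]
    have lt: "lipschitz_fun (multi_pois_avg as t f)" and lst: "lipschitz_fun (multi_pois_avg as s (multi_pois_avg as t f))"
      using Cons.prems by (auto intro!: av)
    have "multi_pois_avg (a # as) (s + t) f = pois_avg (s * fst a + t * fst a) (snd a) (multi_pois_avg as s (multi_pois_avg as t f))"
      using Cons by (simp add: distrib_right)
    also have "\<dots> = pois_avg (s * fst a) (snd a) (pois_avg (t * fst a) (snd a) (multi_pois_avg as s (multi_pois_avg as t f)))"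
      by (rule pois_avg_add[OF p lst])
    also have "pois_avg (t * fst a) (snd a) (multi_pois_avg as s (multi_pois_avg as t f))
      = multi_pois_avg as s (pois_avg (t * fst a) (snd a) (multi_pois_avg as t f))"
      using commuting_multi_pois_avg[OF as Cons.prems(1) L1_element_pois[OF p(2)]] lt
      by (simp add: commuting_def pois_avg_def)
    finally show ?case by simp
  qed simp
next
  show "multi_pois_avg as 0 f = f" for f
    by (induction as) (auto simp: pois_avg_def shift_avg_def pois_def)
qed (use as in \<open>auto intro: averaging_multi_pois_avg\<close>)

text \<open>The sum is the generator of the compound Poisson process. In the induction the inner
  average is \<open>f + t R\<close> up to order \<open>t^2\<close>; the outer one is expanded to
  first order on \<open>f\<close>, but only to order zero on \<open>t R\<close>, which already
  carries a factor \<open>t\<close>. For the latter \<open>R\<close> has to be Lipschitz.\<close>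

lemma multi_pois_avg_first_order:
  fixes as :: "(real \<times> 'k::{real_normed_vector, second_countable_topology}) list"
  assumes as: "\<And>a. a \<in> set as \<Longrightarrow> 0 \<le> fst a" and L: "L-lipschitz_on UNIV f"
  shows "\<exists>C. \<forall>t y. 0 < t \<longrightarrow> t \<le> 1 \<longrightarrow>
    \<bar>multi_pois_avg as t f y - f y - t * (\<Sum>a\<leftarrow>as. fst a * (f (y + snd a) - f y))\<bar> \<le> C * t\<^sup>2"
  using as
proof (induction as)
  case Nil
  then show ?case by (intro exI[of _ 0]) simp
next
  case (Cons a as)
  define R where "R y = (\<Sum>a\<leftarrow>as. fst a * (f (y + snd a) - f y))" for y
  obtain K where K: "K-lipschitz_on UNIV R"
  proof -
    have 1: "L-lipschitz_on UNIV (\<lambda>y. f (y + v))" for v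
    proof (rule lipschitz_onI)
      show "dist (f (x + v)) (f (y + v)) \<le> L * dist x y" for x y
        using lipschitz_onD[OF L, of "x + v" "y + v"] by (simp add: dist_norm)
    qed (rule lipschitz_on_nonneg[OF L])
    have "\<exists>K. K-lipschitz_on UNIV (\<lambda>y. \<Sum>a\<leftarrow>bs. fst a * (f (y + snd a) - f y))" for bs
    proof (induction bs)
      case (Cons b bs)
      then obtain K where K: "K-lipschitz_on UNIV (\<lambda>y. \<Sum>a\<leftarrow>bs. fst a * (f (y + snd a) - f y))" by blast
      show ?case
        using lipschitz_on_add[OF lipschitz_on_cmult_real[OF lipschitz_on_diff[OF 1[of "snd b"] L], of "fst b"] K] by auto
    qed (auto intro!: exI[of _ 0] lipschitz_onI)
    from this[of as] show ?thesis using that by (auto simp: R_def[abs_def])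
  qed
  obtain C where C: "\<And>t y. 0 < t \<Longrightarrow> t \<le> 1 \<Longrightarrow> \<bar>multi_pois_avg as t f y - f y - t * R y\<bar> \<le> C * t\<^sup>2"
  proof -
    have "\<exists>C. \<forall>t y. 0 < t \<longrightarrow> t \<le> 1 \<longrightarrow> \<bar>multi_pois_avg as t f y - f y - t * R y\<bar> \<le> C * t\<^sup>2"
      using Cons.IH Cons.prems by (simp add: R_def)
    then show thesis using that by blast
  qed
  define p v where "p = fst a" and "v = snd a"
  have p: "0 \<le> p" using Cons.prems[of a] by (simp add: p_def)
  have f: "lipschitz_fun f" "lipschitz_fun R" using L K unfolding lipschitz_fun_def by blast+
  show ?case
  proof (intro exI allI impI)
    fix t :: real and y assume t: "0 < t" "t \<le> 1"
    have tp: "0 \<le> t * p" using t p by simp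
    have lip: "lipschitz_fun (\<lambda>y. f y + t * R y)"
      using lipschitz_on_add[OF L lipschitz_on_cmult_real[OF K, of t]] unfolding lipschitz_fun_def by blast
    have h1: "lipschitz_fun (multi_pois_avg as t f)"
      using averaging_lipschitz[OF averaging_multi_pois_avg f(1)] Cons.prems t by simp
    have h2: "averaging (pois_avg (t * p) v)"
      unfolding pois_avg_def by (intro averaging_shift_avg L1_element_pois tp)
    have h3: "\<bar>multi_pois_avg as t f y - (f y + t * R y)\<bar> \<le> C * t\<^sup>2" for y
      using C[OF t, of y] by (simp add: algebra_simps)
    have 1: "\<bar>pois_avg (t * p) v (multi_pois_avg as t f) y - pois_avg (t * p) v (\<lambda>y. f y + t * R y) y\<bar> \<le> C * t\<^sup>2"
      by (rule averaging_diff_bound[where A = "pois_avg (t * p) v" and f = "multi_pois_avg as t f"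
            and g = "\<lambda>y. f y + t * R y"]) (fact h1 h2 h3 lip)+
    have 2: "pois_avg (t * p) v (\<lambda>y. f y + t * R y) y = pois_avg (t * p) v f y + t * pois_avg (t * p) v R y"
      unfolding pois_avg_def shift_avg_def
      using integrable_shift[OF L1_element_pois[OF tp] f(1)] integrable_shift[OF L1_element_pois[OF tp] f(2)] by simp
    have "t * \<bar>pois_avg (t * p) v R y - R y\<bar> \<le> t * (K * norm v * (t * p))"
      using t by (intro mult_left_mono pois_avg_zeroth_order[OF tp K]) auto
    then have 3: "\<bar>t * pois_avg (t * p) v R y - t * R y\<bar> \<le> K * norm v * p * t\<^sup>2"
      using t by (simp add: right_diff_distrib[symmetric] abs_mult power2_eq_square mult_ac)
    have 4: "\<bar>pois_avg (t * p) v f y - f y - t * (p * (f (y + v) - f y))\<bar> \<le> 2 * L * norm v * p\<^sup>2 * t\<^sup>2"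
      using pois_avg_first_order[OF tp L, of v y] by (simp add: power_mult_distrib mult_ac)
    let ?L = "multi_pois_avg (a # as) t f y - f y - t * (\<Sum>a\<leftarrow>a # as. fst a * (f (y + snd a) - f y))"
    have "\<bar>?L\<bar>
      = \<bar>pois_avg (t * p) v (multi_pois_avg as t f) y - f y - t * (p * (f (y + v) - f y)) - t * R y\<bar>"
      by (simp add: R_def p_def v_def distrib_left)
    also have "\<dots> \<le> C * t\<^sup>2 + K * norm v * p * t\<^sup>2 + 2 * L * norm v * p\<^sup>2 * t\<^sup>2"
      using 1 3 4 unfolding 2 by linarith
    finally show "\<bar>?L\<bar>
       \<le> (C + K * norm v * p + 2 * L * norm v * p\<^sup>2) * t\<^sup>2"
      by (simp add: algebra_simps)
  qed
qed

section \<open>Counts of a Poisson random measure\<close>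

lemma shift_avg_distr:
  fixes f :: "'k::{real_normed_vector, second_countable_topology} \<Rightarrow> real"
  assumes [measurable]: "X \<in> measurable M N" "Y \<in> borel_measurable N" "f \<in> borel_measurable borel"
  shows "shift_avg (distr M N X) Y f = shift_avg M (\<lambda>\<omega>. Y (X \<omega>)) f"
  by (rule ext) (simp add: shift_avg_def integral_distr)

text \<open>For a Poisson random measure and an outcome in \<open>space M\<close> the value is
  already a natural number, so rounding only changes its type.\<close>

definition poisson_count :: "('a \<Rightarrow> 'b measure) \<Rightarrow> 'b set \<Rightarrow> 'a \<Rightarrow> nat" where
  "poisson_count N A \<omega> = nat \<lfloor>measure (N \<omega>) A\<rfloor>"

context
  fixes M :: "'a measure" and N :: "'a \<Rightarrow> 'b measure" and \<Lambda> :: "'b measure"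
  assumes M: "prob_space M" and prm: "poisson_random_measure M N \<Lambda>"
begin

interpretation prob_space M by (rule M)

lemma prm_finite_intensity: "finite_measure \<Lambda>"
  using prm by (simp add: poisson_random_measure_def)

abbreviation pcount :: "'b set \<Rightarrow> 'a \<Rightarrow> nat" where "pcount \<equiv> poisson_count N"

lemma prm_sets: "\<omega> \<in> space M \<Longrightarrow> sets (N \<omega>) = sets \<Lambda>"
  using prm by (simp add: poisson_random_measure_def)

lemma prm_space: "\<omega> \<in> space M \<Longrightarrow> space (N \<omega>) = space \<Lambda>"
  by (rule sets_eq_imp_space_eq[OF prm_sets])

lemma prm_emeasure: "\<omega> \<in> space M \<Longrightarrow> A \<in> sets \<Lambda> \<Longrightarrow> emeasure (N \<omega>) A = of_nat (pcount A \<omega>)"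
proof -
  assume "\<omega> \<in> space M" "A \<in> sets \<Lambda>"
  then obtain k :: nat where "emeasure (N \<omega>) A = of_nat k"
    using prm unfolding poisson_random_measure_def by blast
  moreover from this have "measure (N \<omega>) A = real k" by (simp add: measure_def)
  ultimately show ?thesis by (simp add: poisson_count_def)
qed

lemma prm_measure: "\<omega> \<in> space M \<Longrightarrow> A \<in> sets \<Lambda> \<Longrightarrow> measure (N \<omega>) A = real (pcount A \<omega>)"
  using prm_emeasure[of \<omega> A] by (simp add: measure_def)

lemma prm_finite: "\<omega> \<in> space M \<Longrightarrow> finite_measure (N \<omega>)"
  using prm_emeasure[of \<omega> "space \<Lambda>"] by (intro finite_measureI) (simp add: prm_space)

text \<open>Measurability and independence are assumed for \<open>emeasure\<close>; this form hands
  both on to the counts.\<close>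

lemma pcount_eq: "pcount A = (\<lambda>\<omega>. nat \<lfloor>enn2real (emeasure (N \<omega>) A)\<rfloor>)"
  by (simp add: poisson_count_def measure_def fun_eq_iff)

lemma pcount_measurable [measurable]: "A \<in> sets \<Lambda> \<Longrightarrow> pcount A \<in> measurable M (count_space UNIV)"
proof -
  assume "A \<in> sets \<Lambda>"
  then have [measurable]: "(\<lambda>\<omega>. emeasure (N \<omega>) A) \<in> borel_measurable M"
    using prm by (simp add: poisson_random_measure_def)
  show ?thesis unfolding pcount_eq by measurable
qed

lemma distr_pcount: "A \<in> sets \<Lambda> \<Longrightarrow> distr M (count_space UNIV) (pcount A) = measure_pmf (pois (measure \<Lambda> A))"
proof (rule measure_eqI_countable[where A = UNIV])
  fix k :: nat
  assume A: "A \<in> sets \<Lambda>"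
  have "emeasure (distr M (count_space UNIV) (pcount A)) {k} = emeasure M (pcount A -` {k} \<inter> space M)"
    using A by (intro emeasure_distr) auto
  also have "pcount A -` {k} \<inter> space M = {\<omega>\<in>space M. emeasure (N \<omega>) A = of_nat k}"
    using prm_emeasure[OF _ A] by auto
  also have "emeasure M \<dots> = ennreal (exp (- measure \<Lambda> A) * measure \<Lambda> A ^ k / fact k)"
    using prm A by (simp add: poisson_random_measure_def emeasure_eq_measure)
  also have "\<dots> = ennreal (pmf (pois (measure \<Lambda> A)) k)"
    by (simp add: pmf_pois mult.commute)
  finally show "emeasure (distr M (count_space UNIV) (pcount A)) {k} = emeasure (measure_pmf (pois (measure \<Lambda> A))) {k}"
    by (simp add: emeasure_pmf_single)
qed auto

lemma integral_pcount:
  fixes f :: "nat \<Rightarrow> real"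
  assumes A: "A \<in> sets \<Lambda>"
  shows "(LINT \<omega>|M. f (pcount A \<omega>)) = (LINT k|pois (measure \<Lambda> A). f k)"
    and "integrable M (\<lambda>\<omega>. f (pcount A \<omega>)) \<longleftrightarrow> integrable (pois (measure \<Lambda> A)) f"
  unfolding distr_pcount[OF A, symmetric] using A
  by (auto simp: integral_distr integrable_distr_eq)

lemma
  assumes A: "A \<in> sets \<Lambda>"
  shows pcount_integrable: "integrable M (\<lambda>\<omega>. real (pcount A \<omega>))"
    and pcount_mean: "(LINT \<omega>|M. real (pcount A \<omega>)) = measure \<Lambda> A"
    and pcount_integrable2: "integrable M (\<lambda>\<omega>. (real (pcount A \<omega>))\<^sup>2)"
    and pcount_moment2: "(LINT \<omega>|M. (real (pcount A \<omega>))\<^sup>2) = measure \<Lambda> A + (measure \<Lambda> A)\<^sup>2"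
proof -
  let ?p = "measure \<Lambda> A"
  have p: "0 \<le> ?p" by simp
  have e: "(real k)\<^sup>2 = real k * real (k - 1) + real k" for k
    by (cases k) (auto simp: power2_eq_square algebra_simps)
  show "integrable M (\<lambda>\<omega>. real (pcount A \<omega>))" "(LINT \<omega>|M. real (pcount A \<omega>)) = ?p"
    using integral_pcount[OF A, of real] pois_integrable[OF p] pois_mean[OF p] by auto
  show "integrable M (\<lambda>\<omega>. (real (pcount A \<omega>))\<^sup>2)"
    unfolding integral_pcount(2)[OF A, of "\<lambda>k. (real k)\<^sup>2"]
    unfolding e by (intro Bochner_Integration.integrable_add pois_integrable2 pois_integrable p)
  show "(LINT \<omega>|M. (real (pcount A \<omega>))\<^sup>2) = ?p + ?p\<^sup>2"
    unfolding integral_pcount(1)[OF A, of "\<lambda>k. (real k)\<^sup>2"]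
    unfolding e using pois_integrable2[OF p] pois_integrable[OF p] pois_mean[OF p] pois_factorial_moment2[OF p] by simp
qed

section \<open>Linear combinations of counts of disjoint sets\<close>

context
  fixes A :: "nat \<Rightarrow> 'b set" and m :: nat
  assumes A: "\<And>i. i < m \<Longrightarrow> A i \<in> sets \<Lambda>" and disj: "disjoint_family_on A {..<m}"
begin

lemma indep_pcount: "indep_vars (\<lambda>_. count_space UNIV) (\<lambda>i. pcount (A i)) {..<m}"
proof -
  have "indep_vars (\<lambda>_. borel) (\<lambda>i \<omega>. emeasure (N \<omega>) (A i)) {..<m}"
    using prm A disj unfolding poisson_random_measure_def by blast
  then have "indep_vars (\<lambda>_. count_space UNIV) (\<lambda>i \<omega>. nat \<lfloor>enn2real (emeasure (N \<omega>) (A i))\<rfloor>) {..<m}"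
    by (rule indep_vars_compose2) measurable
  then show ?thesis by (simp add: pcount_eq)
qed

lemma indep_pcount_sum:
  fixes v :: "nat \<Rightarrow> 'k::{real_normed_vector, second_countable_topology}"
  assumes j: "j < m"
  shows "indep_var borel (\<lambda>\<omega>. real (pcount (A j) \<omega>) *\<^sub>R v j) borel (\<lambda>\<omega>. \<Sum>i<j. real (pcount (A i) \<omega>) *\<^sub>R v i)"
proof -
  have "indep_var borel ((\<lambda>f. real (f j) *\<^sub>R v j) \<circ> (\<lambda>\<omega>. restrict (\<lambda>i. pcount (A i) \<omega>) {j}))
     borel ((\<lambda>f. \<Sum>i<j. real (f i) *\<^sub>R v i) \<circ> (\<lambda>\<omega>. restrict (\<lambda>i. pcount (A i) \<omega>) {..<j}))"
  proof (rule indep_var_compose[OF indep_var_restrict[OF indep_pcount]])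
    have [measurable]: "(\<lambda>f. f j) \<in> measurable (Pi\<^sub>M {j} (\<lambda>i. count_space UNIV :: nat measure)) (count_space UNIV)"
      by (rule measurable_component_singleton) simp
    show "(\<lambda>f. real (f j) *\<^sub>R v j) \<in> borel_measurable (Pi\<^sub>M {j} (\<lambda>i. count_space UNIV))"
      by measurable
    have [measurable]: "(\<lambda>f. f i) \<in> measurable (Pi\<^sub>M {..<j} (\<lambda>i. count_space UNIV :: nat measure)) (count_space UNIV)" if "i < j" for i
      by (rule measurable_component_singleton) (use that in simp)
    show "(\<lambda>f. \<Sum>i<j. real (f i) *\<^sub>R v i) \<in> borel_measurable (Pi\<^sub>M {..<j} (\<lambda>i. count_space UNIV))"
      by measurable
  qed (use j in auto)
  then show ?thesis by (simp add: comp_def)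
qed

lemma L1_element_pcount_sum:
  fixes v :: "nat \<Rightarrow> 'k::{real_normed_vector, second_countable_topology}"
  assumes "j \<le> m"
  shows "L1_element M (\<lambda>\<omega>. \<Sum>i<j. real (pcount (A i) \<omega>) *\<^sub>R v i)"
  unfolding L1_element_def
proof (intro conjI M)
  have [measurable]: "pcount (A i) \<in> measurable M (count_space UNIV)" if "i < j" for i
    using A assms that by auto
  show m: "(\<lambda>\<omega>. \<Sum>i<j. real (pcount (A i) \<omega>) *\<^sub>R v i) \<in> borel_measurable M" by measurable
  show "integrable M (\<lambda>\<omega>. norm (\<Sum>i<j. real (pcount (A i) \<omega>) *\<^sub>R v i))"
  proof (rule Bochner_Integration.integrable_bound)
    show "integrable M (\<lambda>\<omega>. \<Sum>i<j. real (pcount (A i) \<omega>) * norm (v i))"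
      using assms by (intro Bochner_Integration.integrable_sum integrable_mult_left pcount_integrable A) auto
    show "AE \<omega> in M. norm (norm (\<Sum>i<j. real (pcount (A i) \<omega>) *\<^sub>R v i)) \<le> norm (\<Sum>i<j. real (pcount (A i) \<omega>) * norm (v i))"
      by (intro AE_I2) (auto intro!: sum_norm_le order_trans[OF _ abs_ge_self])
  qed (use m in measurable)
qed

text \<open>Independence of the newest count from the earlier ones makes their joint law a product,
  so the average over the sum is a composition. The list is reversed because the newest set supplies
  the outermost factor.\<close>

lemma shift_avg_pcount_sum:
  fixes v :: "nat \<Rightarrow> 'k::{real_normed_vector, second_countable_topology}"
  assumes "j \<le> m" and f: "lipschitz_fun f"
  shows "shift_avg M (\<lambda>\<omega>. \<Sum>i<j. real (pcount (A i) \<omega>) *\<^sub>R v i) f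
    = multi_pois_avg (map (\<lambda>i. (measure \<Lambda> (A i), v i)) (rev [0..<j])) 1 f"
  using assms(1)
proof (induction j)
  case 0
  then show ?case by (simp add: shift_avg_def prob_space fun_eq_iff)
next
  case (Suc j)
  then have j: "j < m" "j \<le> m" and Aj: "A j \<in> sets \<Lambda>" using A by auto
  let ?S = "\<lambda>\<omega>. \<Sum>i<j. real (pcount (A i) \<omega>) *\<^sub>R v i"
  have mf: "f \<in> borel_measurable borel" using f by (rule borel_measurable_lipschitz)
  have LS: "L1_element M ?S" by (rule L1_element_pcount_sum[OF j(2)])
  then have mS: "?S \<in> borel_measurable M" by (simp add: L1_element_def)
  have mK: "pcount (A j) \<in> measurable M (count_space UNIV)" using Aj by measurable
  let ?K = "\<lambda>\<omega>. real (pcount (A j) \<omega>) *\<^sub>R v j"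
  have mKv: "?K \<in> borel_measurable M" using mK by measurable
  have J: "distr M borel ?K \<Otimes>\<^sub>M distr M borel ?S = distr M (borel \<Otimes>\<^sub>M borel) (\<lambda>\<omega>. (?K \<omega>, ?S \<omega>))"
    using indep_pcount_sum[OF j(1)] unfolding indep_var_distribution_eq by blast
  have "integrable M (\<lambda>\<omega>. norm (?K \<omega>))"
    using pcount_integrable[OF Aj] by simp
  then have LK: "L1_element (distr M borel ?K) (\<lambda>x. x)"
    using mKv by (auto simp: L1_element_def prob_space_distr integrable_distr_eq)
  have LD: "L1_element (distr M borel ?S) (\<lambda>x. x)"
    using LS mS by (auto simp: L1_element_def prob_space_distr integrable_distr_eq)
  have "shift_avg M (\<lambda>\<omega>. \<Sum>i<Suc j. real (pcount (A i) \<omega>) *\<^sub>R v i) f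
      = shift_avg (distr M (borel \<Otimes>\<^sub>M borel) (\<lambda>\<omega>. (?K \<omega>, ?S \<omega>))) (\<lambda>(x, y). x + y) f"
    using mS mKv mf by (subst shift_avg_distr) (auto simp: add.commute)
  also have "\<dots> = shift_avg (distr M borel ?K) (\<lambda>x. x) (shift_avg (distr M borel ?S) (\<lambda>x. x) f)"
    unfolding J[symmetric] by (rule shift_avg_compose(1)[OF LK LD f, symmetric])
  also have "shift_avg (distr M borel ?S) (\<lambda>x. x) f = shift_avg M ?S f"
    using mS mf by (subst shift_avg_distr) auto
  also have "\<dots> = multi_pois_avg (map (\<lambda>i. (measure \<Lambda> (A i), v i)) (rev [0..<j])) 1 f"
    by (rule Suc.IH[OF j(2)])
  also have "shift_avg (distr M borel ?K) (\<lambda>x. x) g = pois_avg (measure \<Lambda> (A j)) (v j) g" if g: "lipschitz_fun g" for g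
  proof -
    have mg: "g \<in> borel_measurable borel" using g by (rule borel_measurable_lipschitz)
    have "shift_avg (distr M borel ?K) (\<lambda>x. x) g = shift_avg (distr M (count_space UNIV) (pcount (A j))) (\<lambda>k. real k *\<^sub>R v j) g"
      using mKv mK mg by (subst (1 2) shift_avg_distr) auto
    then show ?thesis unfolding distr_pcount[OF Aj] by (simp add: pois_avg_def)
  qed
  finally show ?case
    using averaging_lipschitz[OF averaging_shift_avg[OF LS] f] Suc.IH[OF j(2)] by simp
qed

text \<open>Campbell's formula for step functions: the second moment of a Poisson integral is the
  integral of the square plus the square of the integral. The cross terms factor by
  independence.\<close>

lemma pcount_sum_moments:
  fixes a :: "nat \<Rightarrow> real"
  assumes "j \<le> m"
  shows "integrable M (\<lambda>\<omega>. (\<Sum>i<j. real (pcount (A i) \<omega>) * a i)\<^sup>2) \<and>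
    (LINT \<omega>|M. (\<Sum>i<j. real (pcount (A i) \<omega>) * a i)) = (\<Sum>i<j. measure \<Lambda> (A i) * a i) \<and>
    (LINT \<omega>|M. (\<Sum>i<j. real (pcount (A i) \<omega>) * a i)\<^sup>2)
      = (\<Sum>i<j. measure \<Lambda> (A i) * (a i)\<^sup>2) + (\<Sum>i<j. measure \<Lambda> (A i) * a i)\<^sup>2"
  using assms
proof (induction j)
  case (Suc j)
  then have j: "j < m" "j \<le> m" and Aj: "A j \<in> sets \<Lambda>" using A by auto
  define S where "S \<omega> = (\<Sum>i<j. real (pcount (A i) \<omega>) * a i)" for \<omega>
  define K where "K \<omega> = real (pcount (A j) \<omega>)" for \<omega>
  note IH = Suc.IH[OF j(2), folded S_def]
  have iS: "integrable M S"
  proof -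
    have "integrable M (\<lambda>\<omega>. \<Sum>i<j. real (pcount (A i) \<omega>) * a i)"
      using j by (intro Bochner_Integration.integrable_sum integrable_mult_left pcount_integrable A) auto
    then show ?thesis by (simp add: S_def[abs_def])
  qed
  have K: "integrable M K" "(LINT \<omega>|M. K \<omega>) = measure \<Lambda> (A j)" "integrable M (\<lambda>\<omega>. (K \<omega>)\<^sup>2)"
     "(LINT \<omega>|M. (K \<omega>)\<^sup>2) = measure \<Lambda> (A j) + (measure \<Lambda> (A j))\<^sup>2"
    unfolding K_def[abs_def] by (rule pcount_integrable pcount_mean pcount_integrable2 pcount_moment2, fact)+
  \<comment> \<open>Setting coefficient \<open>j\<close> to 1 makes the first variable the bare
    count \<open>K\<close>; the coefficients below \<open>j\<close>, and with them \<open>S\<close>,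
    are unchanged.\<close>
  have "indep_var borel (\<lambda>\<omega>. real (pcount (A j) \<omega>) *\<^sub>R (a(j := 1)) j) borel (\<lambda>\<omega>. \<Sum>i<j. real (pcount (A i) \<omega>) *\<^sub>R (a(j := 1)) i)"
    by (rule indep_pcount_sum[OF j(1)])
  moreover have "(\<lambda>\<omega>. \<Sum>i<j. real (pcount (A i) \<omega>) *\<^sub>R (a(j := 1)) i) = S"
    by (auto simp: S_def intro!: sum.cong)
  ultimately have ind: "indep_var borel K borel S" by (simp add: K_def[abs_def])
  have KS: "integrable M (\<lambda>\<omega>. K \<omega> * S \<omega>)" "(LINT \<omega>|M. K \<omega> * S \<omega>) = measure \<Lambda> (A j) * (LINT \<omega>|M. S \<omega>)"
    using indep_var_integrable[OF ind K(1) iS] indep_var_lebesgue_integral[OF ind K(1) iS] K(2) by auto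
  have e: "(S \<omega> + K \<omega> * a j)\<^sup>2 = (S \<omega>)\<^sup>2 + 2 * a j * (K \<omega> * S \<omega>) + (a j)\<^sup>2 * (K \<omega>)\<^sup>2" for \<omega>
    by (simp add: power2_eq_square algebra_simps)
  have "integrable M (\<lambda>\<omega>. (S \<omega> + K \<omega> * a j)\<^sup>2)"
    unfolding e using IH KS K by (intro Bochner_Integration.integrable_add integrable_mult_right) auto
  moreover have "(LINT \<omega>|M. S \<omega> + K \<omega> * a j) = (\<Sum>i<j. measure \<Lambda> (A i) * a i) + measure \<Lambda> (A j) * a j"
    using iS K IH by simp
  moreover have "(LINT \<omega>|M. (S \<omega> + K \<omega> * a j)\<^sup>2)
      = (\<Sum>i<j. measure \<Lambda> (A i) * (a i)\<^sup>2) + measure \<Lambda> (A j) * (a j)\<^sup>2 + ((\<Sum>i<j. measure \<Lambda> (A i) * a i) + measure \<Lambda> (A j) * a j)\<^sup>2"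
  proof -
    have "(LINT \<omega>|M. (S \<omega> + K \<omega> * a j)\<^sup>2) = (LINT \<omega>|M. (S \<omega>)\<^sup>2) + 2 * a j * (LINT \<omega>|M. K \<omega> * S \<omega>) + (a j)\<^sup>2 * (LINT \<omega>|M. (K \<omega>)\<^sup>2)"
      unfolding e using IH KS K by simp
    then show ?thesis using IH KS K by (simp add: power2_eq_square algebra_simps)
  qed
  ultimately show ?case by (simp add: S_def K_def)
qed simp

end

end

section \<open>Comparison of Poisson integrals with Gaussian elements\<close>

text \<open>The form in which the mesh is sent to 0: the error may have any factor \<open>C\<close>
  that is fixed before \<open>\<delta>\<close>.\<close>

lemma le_if_le_add_mult:
  fixes x a C :: real
  assumes "\<And>\<delta>. 0 < \<delta> \<Longrightarrow> \<delta> \<le> 1 \<Longrightarrow> x \<le> a + C * \<delta>"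
  shows "x \<le> a"
proof (rule field_le_epsilon)
  fix e :: real assume e: "0 < e"
  define \<delta> where "\<delta> = min 1 (e / (\<bar>C\<bar> + 1))"
  have "\<delta> \<le> e / (\<bar>C\<bar> + 1)" by (simp add: \<delta>_def)
  then have \<delta>: "0 < \<delta>" "\<delta> \<le> 1" "\<delta> * (\<bar>C\<bar> + 1) \<le> e"
    using e by (simp_all add: pos_le_divide_eq) (simp_all add: \<delta>_def)
  have "C * \<delta> \<le> (\<bar>C\<bar> + 1) * \<delta>" using \<delta> by (intro mult_right_mono) auto
  then show "x \<le> a + e" using assms[OF \<delta>(1,2)] \<delta>(3) by (simp add: mult.commute)
qed

text \<open>A cell obtained by making balls disjoint can be empty or miss its centre. The vector
  \<open>c i\<close> is thus not tied to a value of \<open>\<phi>\<close> on \<open>A i\<close>, and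
  its norm bound is a clause of its own.\<close>

definition approx_partition :: "'b measure \<Rightarrow> ('b \<Rightarrow> 'k::real_normed_vector) \<Rightarrow> real \<Rightarrow> nat \<Rightarrow> (nat \<Rightarrow> 'b set) \<Rightarrow> (nat \<Rightarrow> 'k) \<Rightarrow> bool" where
  "approx_partition L \<phi> \<delta> m A c \<longleftrightarrow> disjoint_family_on A {..<m} \<and> (\<forall>i<m. A i \<in> sets L) \<and>
     (\<Union>i<m. A i) = space L \<and> (\<forall>i<m. \<forall>x\<in>A i. norm (\<phi> x - c i) \<le> \<delta>) \<and> (\<forall>i<m. norm (c i) \<le> 1)"

text \<open>The step function with value \<open>g i\<close> on \<open>A i\<close> is uniformly
  within \<open>\<epsilon>\<close> of \<open>G\<close>. The measure \<open>L\<close> will be the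
  intensity as well as a realization of the random measure, and \<open>G\<close> will be
  \<open>\<phi>\<close> or a quadratic expression in it.\<close>

lemma partition_integral:
  fixes G :: "'b \<Rightarrow> 'd::{banach, second_countable_topology}" and A :: "nat \<Rightarrow> 'b set"
  assumes fin: "finite_measure L" and A: "\<And>i. i < m \<Longrightarrow> A i \<in> sets L" and disj: "disjoint_family_on A {..<m}"
    and cover: "(\<Union>i<m. A i) = space L" and G: "integrable L G"
    and le: "\<And>i x. i < m \<Longrightarrow> x \<in> A i \<Longrightarrow> norm (G x - g i) \<le> \<epsilon>"
  shows "norm ((LINT x|L. G x) - (\<Sum>i<m. measure L (A i) *\<^sub>R g i)) \<le> \<epsilon> * measure L (space L)"
proof -
  interpret finite_measure L by fact
  define s where "s x = (\<Sum>i<m. indicator (A i) x *\<^sub>R g i)" for x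
  have s: "s x = g i" if "i < m" "x \<in> A i" for i x
  proof -
    have "indicator (A j) x *\<^sub>R g j = (if j = i then g i else 0)" if "j < m" for j
      using disj that \<open>i < m\<close> \<open>x \<in> A i\<close> by (auto simp: disjoint_family_on_def indicator_def)
    then have "s x = (\<Sum>j<m. if j = i then g i else 0)" unfolding s_def by (intro sum.cong) auto
    also have "\<dots> = g i" using \<open>i < m\<close> by simp
    finally show ?thesis .
  qed
  have iA: "integrable L (\<lambda>x. indicator (A i) x *\<^sub>R g i)" if "i < m" for i
    using A[OF that] by (intro integrable_scaleR_left) (auto simp: emeasure_eq_measure)
  have ints: "integrable L s" unfolding s_def by (intro Bochner_Integration.integrable_sum iA) auto
  have "(LINT x|L. s x) = (\<Sum>i<m. LINT x|L. indicator (A i) x *\<^sub>R g i)"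
    unfolding s_def by (rule Bochner_Integration.integral_sum) (simp add: iA)
  also have "\<dots> = (\<Sum>i<m. measure L (A i) *\<^sub>R g i)"
    using A by (intro sum.cong refl) (auto simp: emeasure_eq_measure Int_absorb2 sets.sets_into_space)
  finally have "(LINT x|L. G x) - (\<Sum>i<m. measure L (A i) *\<^sub>R g i) = (LINT x|L. G x - s x)"
    using G ints by simp
  also have "norm \<dots> \<le> (LINT x|L. \<epsilon>)"
  proof (rule order_trans[OF integral_norm_bound integral_mono])
    fix x assume "x \<in> space L"
    then obtain i where i: "i < m" "x \<in> A i" using cover by blast
    show "norm (G x - s x) \<le> \<epsilon>" using le[OF i] s[OF i] by simp
  qed (use G ints in auto)
  finally show ?thesis by (simp add: mult.commute)
qed

definition poisson_integral :: "('a \<Rightarrow> 'b measure) \<Rightarrow> ('b \<Rightarrow> 'k::{banach, second_countable_topology}) \<Rightarrow> 'a \<Rightarrow> 'k" where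
  "poisson_integral N \<phi> \<omega> = (LINT x|N \<omega>. \<phi> x)"

section \<open>Poisson integrals of a map into the unit ball\<close>

context
  fixes M :: "'a measure" and N :: "'a \<Rightarrow> 'b measure" and \<Lambda> :: "'b measure"
    and \<phi> :: "'b \<Rightarrow> 'k::{real_inner, banach, second_countable_topology}"
  assumes M: "prob_space M" and prm: "poisson_random_measure M N \<Lambda>"
    and \<phi>_meas [measurable]: "\<phi> \<in> borel_measurable \<Lambda>"
    and \<phi>_le: "\<And>x. x \<in> space \<Lambda> \<Longrightarrow> norm (\<phi> x) \<le> 1"
    and part: "\<And>\<delta>. 0 < \<delta> \<Longrightarrow> \<exists>m A c. approx_partition \<Lambda> \<phi> \<delta> m A c"
    and \<phi>_mean: "(LINT x|\<Lambda>. \<phi> x) = 0"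
begin

interpretation prob_space M by (rule M)
interpretation \<Lambda>: finite_measure \<Lambda> by (rule prm_finite_intensity[OF M prm])

abbreviation pint :: "'a \<Rightarrow> 'k" where "pint \<equiv> poisson_integral N \<phi>"

abbreviation total :: "'a \<Rightarrow> real" where "total \<omega> \<equiv> real (poisson_count N (space \<Lambda>) \<omega>)"

abbreviation mass :: real where "mass \<equiv> measure \<Lambda> (space \<Lambda>)"

lemma \<phi>_integrable: "finite_measure \<eta> \<Longrightarrow> sets \<eta> = sets \<Lambda> \<Longrightarrow> integrable \<eta> \<phi>"
proof -
  assume \<eta>: "finite_measure \<eta>" "sets \<eta> = sets \<Lambda>"
  then have sp: "space \<eta> = space \<Lambda>" by (intro sets_eq_imp_space_eq)
  have "\<phi> \<in> borel_measurable \<eta>" using \<phi>_meas \<eta>(2) by (simp cong: measurable_cong_sets)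
  then show ?thesis using \<phi>_le sp by (intro finite_measure.integrable_const_bound[OF \<eta>(1), of _ 1]) auto
qed

lemma pint_approx:
  assumes "approx_partition \<Lambda> \<phi> \<delta> m A c" "\<omega> \<in> space M"
  shows "norm (pint \<omega> - (\<Sum>i<m. real (poisson_count N (A i) \<omega>) *\<^sub>R c i)) \<le> \<delta> * total \<omega>"
proof -
  note s = prm_sets[OF M prm assms(2)] and sp = prm_space[OF M prm assms(2)] and fin = prm_finite[OF M prm assms(2)]
  have "norm (pint \<omega> - (\<Sum>i<m. measure (N \<omega>) (A i) *\<^sub>R c i)) \<le> \<delta> * measure (N \<omega>) (space (N \<omega>))"
    unfolding poisson_integral_def using assms(1) \<phi>_integrable[OF fin s]
    by (intro partition_integral fin) (auto simp: approx_partition_def s sp)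
  also have "(\<Sum>i<m. measure (N \<omega>) (A i) *\<^sub>R c i) = (\<Sum>i<m. real (poisson_count N (A i) \<omega>) *\<^sub>R c i)"
    using assms by (intro sum.cong refl) (auto simp: approx_partition_def prm_measure[OF M prm])
  finally show ?thesis by (simp add: sp prm_measure[OF M prm assms(2)])
qed

lemma pint_le:
  assumes "\<omega> \<in> space M"
  shows "norm (pint \<omega>) \<le> total \<omega>"
proof -
  note s = prm_sets[OF M prm assms] and sp = prm_space[OF M prm assms] and fin = prm_finite[OF M prm assms]
  interpret N: finite_measure "N \<omega>" by (rule fin)
  have "norm (pint \<omega>) \<le> (LINT x|N \<omega>. 1)"
    unfolding poisson_integral_def
    by (rule order_trans[OF integral_norm_bound integral_mono])
       (use \<phi>_integrable[OF fin s] \<phi>_le sp in auto)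
  then show ?thesis by (simp add: sp prm_measure[OF M prm assms])
qed

text \<open>The outcome enters the integral through the whole measure \<open>N \<omega>\<close>,
  while measurability is known for counts of sets. Partitions of mesh \<open>1 / Suc n\<close>
  exhibit the integral as a pointwise limit of linear combinations of counts.\<close>

lemma pint_measurable [measurable]: "pint \<in> borel_measurable M"
proof -
  have "\<exists>m A c. approx_partition \<Lambda> \<phi> (1 / Suc n) m A c" for n by (rule part) simp
  then obtain m A c where P: "\<And>n. approx_partition \<Lambda> \<phi> (1 / Suc n) (m n) (A n) (c n)" by metis
  show ?thesis
  proof (rule borel_measurable_LIMSEQ_metric)
    show "(\<lambda>\<omega>. \<Sum>i<m n. real (poisson_count N (A n i) \<omega>) *\<^sub>R c n i) \<in> borel_measurable M" for n
    proof -
      have [measurable]: "poisson_count N (A n i) \<in> measurable M (count_space UNIV)" if "i < m n" for i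
        using P[of n] that by (intro pcount_measurable[OF M prm]) (auto simp: approx_partition_def)
      show ?thesis by measurable
    qed
    fix \<omega> assume \<omega>: "\<omega> \<in> space M"
    have "(\<lambda>n. 1 / Suc n * total \<omega>) \<longlonglongrightarrow> 0 * total \<omega>"
      by (rule tendsto_mult_right[OF LIMSEQ_Suc[OF lim_1_over_n]])
    then show "(\<lambda>n. \<Sum>i<m n. real (poisson_count N (A n i) \<omega>) *\<^sub>R c n i) \<longlonglongrightarrow> pint \<omega>"
    proof (rule metric_tendsto_imp_tendsto, intro always_eventually allI)
      fix n
      have "dist (\<Sum>i<m n. real (poisson_count N (A n i) \<omega>) *\<^sub>R c n i) (pint \<omega>) \<le> 1 / Suc n * total \<omega>"
        unfolding dist_norm using pint_approx[OF P \<omega>, of n] by (subst norm_minus_commute)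
      also have "\<dots> \<le> dist (1 / Suc n * total \<omega>) (0 * total \<omega>)" by (simp add: dist_norm)
      finally show "dist (\<Sum>i<m n. real (poisson_count N (A n i) \<omega>) *\<^sub>R c n i) (pint \<omega>) \<le> dist (1 / Suc n * total \<omega>) (0 * total \<omega>)" .
    qed
  qed
qed

lemma pint_integrable2: "integrable M (\<lambda>\<omega>. (norm (pint \<omega>))\<^sup>2)"
proof (rule Bochner_Integration.integrable_bound)
  show "integrable M (\<lambda>\<omega>. (total \<omega>)\<^sup>2)" by (rule pcount_integrable2[OF M prm]) simp
  show "AE \<omega> in M. norm ((norm (pint \<omega>))\<^sup>2) \<le> norm ((total \<omega>)\<^sup>2)"
    using pint_le by (auto intro!: AE_I2 power_mono)
qed measurable

lemma pint_inner_integrable2: "integrable M (\<lambda>\<omega>. (inner (pint \<omega>) u)\<^sup>2)"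
proof (rule Bochner_Integration.integrable_bound)
  show "integrable M (\<lambda>\<omega>. (norm (pint \<omega>))\<^sup>2 * (norm u)\<^sup>2)" using pint_integrable2 by simp
  have "\<bar>inner x u\<bar>\<^sup>2 \<le> (norm x * norm u)\<^sup>2" for x :: 'k
    by (intro power_mono Cauchy_Schwarz_ineq2) simp
  then show "AE \<omega> in M. norm ((inner (pint \<omega>) u)\<^sup>2) \<le> norm ((norm (pint \<omega>))\<^sup>2 * (norm u)\<^sup>2)"
    by (simp add: power_mult_distrib)
qed measurable

lemma pint_integrable: "integrable M (\<lambda>\<omega>. norm (pint \<omega>))"
  by (rule square_integrable_imp_integrable[OF _ pint_integrable2]) measurable

text \<open>Campbell's formula for \<open>\<phi>\<close>, by approximation: for step functions it is
  \<open>pcount_sum_moments\<close>, and the squared mean disappears in the limit because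
  \<open>\<phi>\<close> has mean zero.\<close>

lemma pint_inner_second_moment:
  "(LINT \<omega>|M. (inner (pint \<omega>) u)\<^sup>2) = (LINT x|\<Lambda>. (inner (\<phi> x) u)\<^sup>2)"
proof -
  let ?U = "norm u"
  define Q where "Q = (LINT \<omega>|M. (total \<omega>)\<^sup>2)"
  have iK: "integrable M (\<lambda>\<omega>. (total \<omega>)\<^sup>2)" by (rule pcount_integrable2[OF M prm]) simp
  have i\<phi>: "integrable \<Lambda> (\<lambda>x. (inner (\<phi> x) u)\<^sup>2)"
  proof (rule \<Lambda>.integrable_const_bound[of _ "?U\<^sup>2"])
    show "AE x in \<Lambda>. norm ((inner (\<phi> x) u)\<^sup>2) \<le> ?U\<^sup>2"
    proof (rule AE_I2)
      fix x assume "x \<in> space \<Lambda>"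
      then have "\<bar>inner (\<phi> x) u\<bar> \<le> 1 * ?U"
        using \<phi>_le by (intro order_trans[OF Cauchy_Schwarz_ineq2] mult_right_mono) auto
      then show "norm ((inner (\<phi> x) u)\<^sup>2) \<le> ?U\<^sup>2"
        using power_mono[of "\<bar>inner (\<phi> x) u\<bar>" ?U 2] by simp
    qed
  qed measurable
  let ?D = "\<bar>(LINT \<omega>|M. (inner (pint \<omega>) u)\<^sup>2) - (LINT x|\<Lambda>. (inner (\<phi> x) u)\<^sup>2)\<bar>"
  have "?D \<le> 0"
  proof (rule le_if_le_add_mult)
    fix \<delta> :: real assume \<delta>: "0 < \<delta>" "\<delta> \<le> 1"
    obtain m A c where P: "approx_partition \<Lambda> \<phi> \<delta> m A c" using part[OF \<delta>(1)] by blast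
    then have A: "\<And>i. i < m \<Longrightarrow> A i \<in> sets \<Lambda>" and disj: "disjoint_family_on A {..<m}"
      and cover: "(\<Union>i<m. A i) = space \<Lambda>" and ap: "\<And>i x. i < m \<Longrightarrow> x \<in> A i \<Longrightarrow> norm (\<phi> x - c i) \<le> \<delta>"
      and c: "\<And>i. i < m \<Longrightarrow> norm (c i) \<le> 1"
      by (auto simp: approx_partition_def)
    define b where "b \<omega> = (\<Sum>i<m. real (poisson_count N (A i) \<omega>) * inner (c i) u)" for \<omega>
    have b: "b \<omega> = inner (\<Sum>i<m. real (poisson_count N (A i) \<omega>) *\<^sub>R c i) u" for \<omega>
      by (simp add: b_def inner_sum_left)
    note mom = pcount_sum_moments[OF M prm A disj order_refl, of "\<lambda>i. inner (c i) u", folded b_def]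
    have 1: "\<bar>(LINT \<omega>|M. (inner (pint \<omega>) u)\<^sup>2) - (LINT \<omega>|M. (b \<omega>)\<^sup>2)\<bar> \<le> 3 * \<delta> * ?U\<^sup>2 * Q"
    proof -
      have "\<bar>LINT \<omega>|M. (inner (pint \<omega>) u)\<^sup>2 - (b \<omega>)\<^sup>2\<bar> \<le> (LINT \<omega>|M. 3 * \<delta> * ?U\<^sup>2 * (total \<omega>)\<^sup>2)"
      proof (rule order_trans[OF integral_abs_bound integral_mono])
        fix \<omega> assume \<omega>: "\<omega> \<in> space M"
        have d: "\<bar>inner (pint \<omega>) u - b \<omega>\<bar> \<le> \<delta> * total \<omega> * ?U"
          unfolding b inner_diff_left[symmetric] using pint_approx[OF P \<omega>]
          by (intro order_trans[OF Cauchy_Schwarz_ineq2] mult_right_mono) auto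
        have a: "\<bar>inner (pint \<omega>) u\<bar> \<le> total \<omega> * ?U"
          using pint_le[OF \<omega>] by (intro order_trans[OF Cauchy_Schwarz_ineq2] mult_right_mono) auto
        \<comment> \<open>In units of \<open>total \<omega> * ?U\<close> the integral is at most 1
          and \<open>b \<omega>\<close> differs from it by at most 1, so their sum is at most
          3.\<close>
        have "\<delta> * total \<omega> * ?U \<le> 1 * total \<omega> * ?U" using \<delta> by (intro mult_right_mono) auto
        with d a have s: "\<bar>inner (pint \<omega>) u + b \<omega>\<bar> \<le> 3 * total \<omega> * ?U" by linarith
        have "(inner (pint \<omega>) u)\<^sup>2 - (b \<omega>)\<^sup>2 = (inner (pint \<omega>) u - b \<omega>) * (inner (pint \<omega>) u + b \<omega>)"
          by (simp add: power2_eq_square algebra_simps)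
        also have "\<bar>\<dots>\<bar> \<le> (\<delta> * total \<omega> * ?U) * (3 * total \<omega> * ?U)"
          unfolding abs_mult using \<delta> by (intro mult_mono d s) auto
        finally show "\<bar>(inner (pint \<omega>) u)\<^sup>2 - (b \<omega>)\<^sup>2\<bar> \<le> 3 * \<delta> * ?U\<^sup>2 * (total \<omega>)\<^sup>2"
          by (simp add: power2_eq_square mult_ac)
      qed (use mom pint_inner_integrable2 iK in auto)
      then show ?thesis using mom pint_inner_integrable2 iK by (simp add: Q_def)
    qed
    have 2: "\<bar>(LINT x|\<Lambda>. (inner (\<phi> x) u)\<^sup>2) - (\<Sum>i<m. measure \<Lambda> (A i) * (inner (c i) u)\<^sup>2)\<bar> \<le> 2 * \<delta> * ?U\<^sup>2 * mass"
    proof -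
      have "norm ((LINT x|\<Lambda>. (inner (\<phi> x) u)\<^sup>2) - (\<Sum>i<m. measure \<Lambda> (A i) *\<^sub>R (inner (c i) u)\<^sup>2)) \<le> 2 * \<delta> * ?U\<^sup>2 * mass"
      proof (rule partition_integral[OF \<Lambda>.finite_measure_axioms A disj cover i\<phi>])
        fix i x assume i: "i < m" and x: "x \<in> A i"
        then have xs: "x \<in> space \<Lambda>" using cover by blast
        have "\<bar>inner (\<phi> x - c i) u\<bar> \<le> \<delta> * ?U"
          using ap[OF i x] by (intro order_trans[OF Cauchy_Schwarz_ineq2] mult_right_mono) auto
        moreover have "\<bar>inner (\<phi> x + c i) u\<bar> \<le> 2 * ?U"
          using norm_triangle_ineq[of "\<phi> x" "c i"] \<phi>_le[OF xs] c[OF i]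
          by (intro order_trans[OF Cauchy_Schwarz_ineq2] mult_right_mono) auto
        ultimately have "\<bar>inner (\<phi> x - c i) u\<bar> * \<bar>inner (\<phi> x + c i) u\<bar> \<le> (\<delta> * ?U) * (2 * ?U)"
          using \<delta> by (intro mult_mono) auto
        then have "\<bar>inner (\<phi> x - c i) u * inner (\<phi> x + c i) u\<bar> \<le> 2 * \<delta> * ?U\<^sup>2"
          by (simp add: power2_eq_square mult_ac abs_mult)
        also have "inner (\<phi> x - c i) u * inner (\<phi> x + c i) u = (inner (\<phi> x) u)\<^sup>2 - (inner (c i) u)\<^sup>2"
          by (simp add: inner_diff_left inner_add_left power2_eq_square algebra_simps)
        finally show "norm ((inner (\<phi> x) u)\<^sup>2 - (inner (c i) u)\<^sup>2) \<le> 2 * \<delta> * ?U\<^sup>2" by simp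
      qed
      then show ?thesis by simp
    qed
    \<comment> \<open>The step function has mean at most \<open>\<delta> * mass\<close>. The square
      of \<open>\<delta>\<close> is weakened to \<open>\<delta>\<close>, using
      \<open>\<delta> \<le> 1\<close>, to match the other two errors.\<close>
    have 3: "(\<Sum>i<m. measure \<Lambda> (A i) * inner (c i) u)\<^sup>2 \<le> \<delta> * (mass * ?U)\<^sup>2"
    proof -
      have "norm ((LINT x|\<Lambda>. \<phi> x) - (\<Sum>i<m. measure \<Lambda> (A i) *\<^sub>R c i)) \<le> \<delta> * mass"
        by (rule partition_integral[OF \<Lambda>.finite_measure_axioms A disj cover \<phi>_integrable ap]) (auto intro: \<Lambda>.finite_measure_axioms)
      then have n: "norm (\<Sum>i<m. measure \<Lambda> (A i) *\<^sub>R c i) \<le> \<delta> * mass" by (simp add: \<phi>_mean)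
      have "(\<Sum>i<m. measure \<Lambda> (A i) * inner (c i) u) = inner (\<Sum>i<m. measure \<Lambda> (A i) *\<^sub>R c i) u"
        by (simp add: inner_sum_left)
      also have "\<bar>\<dots>\<bar> \<le> (\<delta> * mass) * ?U"
        using n by (intro order_trans[OF Cauchy_Schwarz_ineq2] mult_right_mono) auto
      finally have "(\<Sum>i<m. measure \<Lambda> (A i) * inner (c i) u)\<^sup>2 \<le> ((\<delta> * mass) * ?U)\<^sup>2"
        by (subst power2_abs[symmetric], intro power_mono) auto
      also have "\<dots> = \<delta>\<^sup>2 * (mass * ?U)\<^sup>2" by (simp add: power_mult_distrib)
      also have "\<dots> \<le> \<delta> * (mass * ?U)\<^sup>2"
        using \<delta> by (intro mult_right_mono) (auto simp: power2_eq_square mult_le_cancel_left1)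
      finally show ?thesis .
    qed
    have "(LINT \<omega>|M. (b \<omega>)\<^sup>2) = (\<Sum>i<m. measure \<Lambda> (A i) * (inner (c i) u)\<^sup>2) + (\<Sum>i<m. measure \<Lambda> (A i) * inner (c i) u)\<^sup>2"
      using mom by simp
    then have "?D
       \<le> 3 * \<delta> * ?U\<^sup>2 * Q + 2 * \<delta> * ?U\<^sup>2 * mass + \<delta> * (mass * ?U)\<^sup>2"
      using 1 2 3 zero_le_power2[of "\<Sum>i<m. measure \<Lambda> (A i) * inner (c i) u"] by linarith
    then show "?D
       \<le> 0 + (3 * ?U\<^sup>2 * Q + 2 * ?U\<^sup>2 * mass + (mass * ?U)\<^sup>2) * \<delta>"
      by (simp add: algebra_simps)
  qed
  then show ?thesis by simp
qed

text \<open>The jumps have norm at most \<open>1 / sqrt r\<close> and total intensity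
  \<open>mass\<close>, so their third moment is at most \<open>mass / (r * sqrt r)\<close>; the
  Taylor remainder divides it by 6. The moments of order one and two match by
  \<open>\<phi>_mean\<close> and \<open>cov\<close>.\<close>

lemma poisson_gaussian_smooth_distance:
  fixes M' :: "'c measure" and Z :: "'c \<Rightarrow> 'k" and r :: real
  assumes M': "prob_space M'" and gauss: "gaussian_element M' Z" and centred: "centred_square_integrable M' Z"
    and e: "orthonormal_upto d e"
    and spanZ: "AE \<omega> in M'. Z \<omega> = (\<Sum>i<d. inner (Z \<omega>) (e i) *\<^sub>R e i)"
    and span\<phi>: "AE x in \<Lambda>. \<phi> x = (\<Sum>i<d. inner (\<phi> x) (e i) *\<^sub>R e i)"
    and r: "0 < r"
    and cov: "\<And>u. (LINT \<omega>|M'. (inner (Z \<omega>) u)\<^sup>2) = (LINT x|\<Lambda>. (inner (\<phi> x) u)\<^sup>2) / r"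
    and h: "h \<in> Cb3" "Cb3_norm h \<le> 1"
  shows "\<bar>(LINT \<omega>|M. h ((1 / sqrt r) *\<^sub>R pint \<omega>)) - (LINT \<omega>|M'. h (Z \<omega>))\<bar> \<le> mass / (6 * (r * sqrt r))"
proof (rule le_if_le_add_mult)
  fix \<delta> :: real assume \<delta>: "0 < \<delta>" "\<delta> \<le> 1"
  interpret M': prob_space M' by (rule M')
  have lip1: "1-lipschitz_on UNIV h"
    using Cb3_lipschitz[OF h] by (intro lipschitz_onI) (auto simp: dist_norm)
  then have lip: "lipschitz_fun h" unfolding lipschitz_fun_def by blast
  have hm [measurable]: "h \<in> borel_measurable borel" using lip by (rule borel_measurable_lipschitz)
  obtain m A c where P: "approx_partition \<Lambda> \<phi> \<delta> m A c" using part[OF \<delta>(1)] by blast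
  then have A: "\<And>i. i < m \<Longrightarrow> A i \<in> sets \<Lambda>" and disj: "disjoint_family_on A {..<m}"
    and cover: "(\<Union>i<m. A i) = space \<Lambda>" and ap: "\<And>i x. i < m \<Longrightarrow> x \<in> A i \<Longrightarrow> norm (\<phi> x - c i) \<le> \<delta>"
    and c: "\<And>i. i < m \<Longrightarrow> norm (c i) \<le> 1"
    by (auto simp: approx_partition_def)
  define q where "q = 1 / sqrt r"
  have q: "0 < q" "q\<^sup>2 = 1 / r" using r by (simp_all add: q_def power_divide)
  define p where "p i = measure \<Lambda> (A i)" for i
  have p0: "0 \<le> p i" for i by (simp add: p_def)
  have psum: "(\<Sum>i<m. p i) = mass"
    unfolding p_def cover[symmetric] using A disj by (intro \<Lambda>.finite_measure_finite_Union[symmetric]) auto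
  define v where "v i = q *\<^sub>R c i" for i
  define as where "as = map (\<lambda>i. (p i, v i)) (rev [0..<m])"
  define T where "T \<omega> = (\<Sum>i<m. real (poisson_count N (A i) \<omega>) *\<^sub>R v i)" for \<omega>
  have LT: "L1_element M T" unfolding T_def by (rule L1_element_pcount_sum[OF M prm A disj order_refl])
  have T: "T \<omega> = q *\<^sub>R (\<Sum>i<m. real (poisson_count N (A i) \<omega>) *\<^sub>R c i)" for \<omega>
    by (simp add: T_def v_def scaleR_sum_right mult.commute)
  have LP: "L1_element M (\<lambda>\<omega>. q *\<^sub>R pint \<omega>)"
    using pint_integrable by (simp add: L1_element_def M)
  have 1: "\<bar>(LINT \<omega>|M. h (q *\<^sub>R pint \<omega>)) - (LINT \<omega>|M. h (T \<omega>))\<bar> \<le> \<delta> * q * mass"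
  proof -
    have i: "integrable M (\<lambda>\<omega>. h (q *\<^sub>R pint \<omega>))" "integrable M (\<lambda>\<omega>. h (T \<omega>))"
      using integrable_shift[OF LP lip, of 0] integrable_shift[OF LT lip, of 0] by simp_all
    have K: "integrable M (\<lambda>\<omega>. total \<omega>)" "(LINT \<omega>|M. total \<omega>) = mass"
      by (rule pcount_integrable[OF M prm] pcount_mean[OF M prm], simp)+
    have "\<bar>LINT \<omega>|M. h (q *\<^sub>R pint \<omega>) - h (T \<omega>)\<bar> \<le> (LINT \<omega>|M. \<delta> * q * total \<omega>)"
    proof (rule order_trans[OF integral_abs_bound integral_mono])
      fix \<omega> assume \<omega>: "\<omega> \<in> space M"
      have "\<bar>h (q *\<^sub>R pint \<omega>) - h (T \<omega>)\<bar> \<le> norm (q *\<^sub>R pint \<omega> - T \<omega>)" by (rule Cb3_lipschitz[OF h])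
      also have "\<dots> = q * norm (pint \<omega> - (\<Sum>i<m. real (poisson_count N (A i) \<omega>) *\<^sub>R c i))"
        unfolding T scaleR_diff_right[symmetric] using q by simp
      also have "\<dots> \<le> q * (\<delta> * total \<omega>)" using q by (intro mult_left_mono pint_approx[OF P \<omega>]) auto
      finally show "\<bar>h (q *\<^sub>R pint \<omega>) - h (T \<omega>)\<bar> \<le> \<delta> * q * total \<omega>" by (simp add: mult_ac)
    qed (use i K in auto)
    then show ?thesis using i K by simp
  qed
  define B where "B y = fderiv (fderiv h) y" for y
  \<comment> \<open>\<open>g\<close> and \<open>g'\<close> are the generators of the two semigroups
    at \<open>h\<close>: a sum over jumps, and half the expected second derivative in the direction
    \<open>Z\<close>.\<close>
  define g where "g y = (\<Sum>a\<leftarrow>as. fst a * (h (y + snd a) - h y))" for y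
  define g' where "g' y = (LINT \<omega>|M'. B y (Z \<omega>) (Z \<omega>)) / 2" for y
  have g: "g y = (\<Sum>i<m. p i * (h (y + v i) - h y))" for y
    unfolding g_def as_def
    by (simp add: comp_def rev_map[symmetric] sum_list_rev interv_sum_list_conv_sum_set_nat atLeast0LessThan)
  \<comment> \<open>Each jump is expanded by Taylor. The linear terms nearly cancel since
    \<open>\<phi>\<close> has mean zero, the quadratic ones nearly equal \<open>g'\<close> by
    \<open>cov\<close>, both up to order \<open>\<delta>\<close>; the cubic remainder is what
    stays.\<close>
  have gg': "\<bar>g y - g' y\<bar> \<le> mass / (6 * (r * sqrt r)) + \<delta> * (q * mass + 5 * mass / (2 * r))" for y
  proof -
    have t: "\<bar>h (y + v i) - h y - q * fderiv h y (c i) - q\<^sup>2 * B y (c i) (c i) / 2\<bar> \<le> q ^ 3 / 6" if "i < m" for i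
    proof -
      have "norm (v i) ^ 3 \<le> q ^ 3"
        using c[OF that] q by (intro power_mono) (auto simp: v_def mult_le_cancel_left1)
      then show ?thesis
        using Cb3_taylor[OF h, of y "v i"]
        by (simp add: v_def B_def blinfun.scaleR_right blinfun.scaleR_left power2_eq_square mult.assoc)
    qed
    let ?b = "\<Sum>i<m. p i * B y (c i) (c i)" and ?d = "\<Sum>i<m. p i * fderiv h y (c i)"
    have a: "\<bar>g y - q * ?d - q\<^sup>2 * ?b / 2\<bar> \<le> mass * (q ^ 3 / 6)"
    proof -
      have "g y - q * ?d - q\<^sup>2 * ?b / 2
        = (\<Sum>i<m. p i * (h (y + v i) - h y - q * fderiv h y (c i) - q\<^sup>2 * B y (c i) (c i) / 2))"
        unfolding g by (simp add: sum_distrib_left sum_divide_distrib sum_subtractf[symmetric] algebra_simps)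
      also have "\<bar>\<dots>\<bar> \<le> (\<Sum>i<m. p i * (q ^ 3 / 6))"
      proof (rule order_trans[OF sum_abs sum_mono])
        fix i assume "i \<in> {..<m}"
        then show "\<bar>p i * (h (y + v i) - h y - q * fderiv h y (c i) - q\<^sup>2 * B y (c i) (c i) / 2)\<bar> \<le> p i * (q ^ 3 / 6)"
          unfolding abs_mult abs_of_nonneg[OF p0] by (intro mult_left_mono t p0) auto
      qed
      also have "\<dots> = mass * (q ^ 3 / 6)" by (simp add: psum sum_distrib_right[symmetric] del: times_divide_eq_right)
      finally show ?thesis .
    qed
    have b: "\<bar>\<Sum>i<m. p i * fderiv h y (c i)\<bar> \<le> \<delta> * mass"
    proof -
      have "norm ((LINT x|\<Lambda>. \<phi> x) - (\<Sum>i<m. measure \<Lambda> (A i) *\<^sub>R c i)) \<le> \<delta> * mass"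
        by (rule partition_integral[OF \<Lambda>.finite_measure_axioms A disj cover \<phi>_integrable ap]) (auto intro: \<Lambda>.finite_measure_axioms)
      then have n: "norm (\<Sum>i<m. p i *\<^sub>R c i) \<le> \<delta> * mass" by (simp add: \<phi>_mean p_def)
      have "?d = fderiv h y (\<Sum>i<m. p i *\<^sub>R c i)"
        by (simp add: blinfun.sum_right blinfun.scaleR_right)
      also have "\<bar>\<dots>\<bar> \<le> norm (\<Sum>i<m. p i *\<^sub>R c i)" by (rule Cb3_norm_D1[OF h(2)])
      finally show ?thesis using n by simp
    qed
    have [measurable]: "(\<lambda>x. B y x x) \<in> borel_measurable borel"
      by (intro borel_measurable_continuous_onI continuous_intros)
    have iB: "integrable \<Lambda> (\<lambda>x. B y (\<phi> x) (\<phi> x))"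
    proof (rule \<Lambda>.integrable_const_bound[of _ 1])
      show "AE x in \<Lambda>. norm (B y (\<phi> x) (\<phi> x)) \<le> 1"
      proof (rule AE_I2)
        fix x assume "x \<in> space \<Lambda>"
        then have "(norm (\<phi> x))\<^sup>2 \<le> 1\<^sup>2" by (intro power_mono \<phi>_le) auto
        then show "norm (B y (\<phi> x) (\<phi> x)) \<le> 1"
          using Cb3_norm_D2[OF h(2), of y "\<phi> x"] by (simp add: B_def)
      qed
    qed measurable
    have d: "\<bar>(LINT x|\<Lambda>. B y (\<phi> x) (\<phi> x)) - ?b\<bar> \<le> 5 * \<delta> * mass"
    proof -
      have "norm ((LINT x|\<Lambda>. B y (\<phi> x) (\<phi> x)) - (\<Sum>i<m. measure \<Lambda> (A i) *\<^sub>R B y (c i) (c i))) \<le> 5 * \<delta> * mass"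
      proof (rule partition_integral[OF \<Lambda>.finite_measure_axioms A disj cover iB])
        fix i x assume i: "i < m" and x: "x \<in> A i"
        then have xs: "x \<in> space \<Lambda>" using cover by blast
        show "norm (B y (\<phi> x) (\<phi> x) - B y (c i) (c i)) \<le> 5 * \<delta>"
          unfolding real_norm_def B_def
          by (rule bounded_quadratic_form_diff_le[OF Cb3_norm_D2[OF h(2)] \<phi>_le[OF xs] c[OF i] ap[OF i x] \<delta>])
      qed
      then show ?thesis by (simp add: p_def)
    qed
    \<comment> \<open>\<open>cov\<close> equates the second moments of the projections of
      \<open>Z\<close> and of \<open>q *\<^sub>R \<phi>\<close>. Both take values in the span of the
      \<open>e i\<close>, so polarization extends the equality to \<open>B y\<close>.\<close>
    have ee: "(LINT \<omega>|M'. B y (Z \<omega>) (Z \<omega>)) = q\<^sup>2 * (LINT x|\<Lambda>. B y (\<phi> x) (\<phi> x))"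
    proof -
      have Zm [measurable]: "Z \<in> borel_measurable M'" using gauss by (simp add: gaussian_element_def)
      have sp: "AE x in \<Lambda>. q *\<^sub>R \<phi> x = (\<Sum>i<d. inner (q *\<^sub>R \<phi> x) (e i) *\<^sub>R e i)"
        using span\<phi>
      proof eventually_elim
        case (elim x)
        then have "q *\<^sub>R \<phi> x = q *\<^sub>R (\<Sum>i<d. inner (\<phi> x) (e i) *\<^sub>R e i)" by (rule arg_cong)
        also have "\<dots> = (\<Sum>i<d. inner (q *\<^sub>R \<phi> x) (e i) *\<^sub>R e i)" by (simp add: scaleR_sum_right)
        finally show ?case .
      qed
      have "(LINT \<omega>|M'. B y (Z \<omega>) (Z \<omega>)) = (LINT x|\<Lambda>. B y (q *\<^sub>R \<phi> x) (q *\<^sub>R \<phi> x))"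
      proof (rule quadratic_form_integral_eq[OF Zm _ spanZ sp])
        fix u
        show "integrable M' (\<lambda>\<omega>. (inner (Z \<omega>) u)\<^sup>2)"
          using gaussian_real_moments[OF M', of "\<lambda>\<omega>. inner (Z \<omega>) u" 2] gauss by (simp add: gaussian_element_def)
        show "integrable \<Lambda> (\<lambda>x. (inner (q *\<^sub>R \<phi> x) u)\<^sup>2)"
        proof (rule \<Lambda>.integrable_const_bound[of _ "(q * norm u)\<^sup>2"])
          show "AE x in \<Lambda>. norm ((inner (q *\<^sub>R \<phi> x) u)\<^sup>2) \<le> (q * norm u)\<^sup>2"
          proof (rule AE_I2)
            fix x assume "x \<in> space \<Lambda>"
            then have "\<bar>inner (q *\<^sub>R \<phi> x) u\<bar> \<le> q * norm u"
              using \<phi>_le[of x] q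
              by (intro order_trans[OF Cauchy_Schwarz_ineq2] mult_right_mono) (auto simp: mult_le_cancel_left1)
            then show "norm ((inner (q *\<^sub>R \<phi> x) u)\<^sup>2) \<le> (q * norm u)\<^sup>2"
              using power_mono[of "\<bar>inner (q *\<^sub>R \<phi> x) u\<bar>" "q * norm u" 2] by simp
          qed
        qed measurable
        show "(LINT \<omega>|M'. (inner (Z \<omega>) u)\<^sup>2) = (LINT x|\<Lambda>. (inner (q *\<^sub>R \<phi> x) u)\<^sup>2)"
          using q by (simp add: cov power_mult_distrib)
      qed measurable
      then show ?thesis by (simp add: blinfun.scaleR_right blinfun.scaleR_left power2_eq_square mult.assoc)
    qed
    have q3: "q ^ 3 = 1 / (r * sqrt r)"
      using r by (simp add: q_def power3_eq_cube)
    have "\<bar>q * ?d\<bar> \<le> q * (\<delta> * mass)"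
      using b q by (simp add: abs_mult)
    moreover have "\<bar>q\<^sup>2 * ?b / 2 - g' y\<bar> \<le> q\<^sup>2 * (5 * \<delta> * mass) / 2"
    proof -
      have "q\<^sup>2 * ?b / 2 - g' y = - (q\<^sup>2 / 2 * ((LINT x|\<Lambda>. B y (\<phi> x) (\<phi> x)) - ?b))"
        unfolding g'_def ee by (simp add: algebra_simps diff_divide_distrib)
      also have "\<bar>\<dots>\<bar> = q\<^sup>2 / 2 * \<bar>(LINT x|\<Lambda>. B y (\<phi> x) (\<phi> x)) - ?b\<bar>"
        by (simp add: abs_mult)
      also have "\<dots> \<le> q\<^sup>2 / 2 * (5 * \<delta> * mass)" by (intro mult_left_mono d) auto
      finally show ?thesis by simp
    qed
    ultimately have "\<bar>g y - g' y\<bar> \<le> mass * (q ^ 3 / 6) + q * (\<delta> * mass) + q\<^sup>2 * (5 * \<delta> * mass) / 2"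
      using a by linarith
    also have "\<dots> = mass / (6 * (r * sqrt r)) + \<delta> * (q * mass + 5 * mass / (2 * r))"
      unfolding q3 q(2) by (simp add: algebra_simps)
    finally show ?thesis .
  qed
  have as0: "\<And>a. a \<in> set as \<Longrightarrow> 0 \<le> fst a" by (auto simp: as_def p0)
  obtain C where C: "\<And>t y. 0 < t \<Longrightarrow> t \<le> 1 \<Longrightarrow> \<bar>multi_pois_avg as t h y - h y - t * g y\<bar> \<le> C * t\<^sup>2"
  proof -
    have "\<exists>C. \<forall>t y. 0 < t \<longrightarrow> t \<le> 1 \<longrightarrow> \<bar>multi_pois_avg as t h y - h y - t * g y\<bar> \<le> C * t\<^sup>2"
      unfolding g_def by (rule multi_pois_avg_first_order[OF as0 lip1])
    then show thesis using that by blast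
  qed
  let ?G = "\<lambda>s. shift_avg M' (\<lambda>\<omega>. sqrt s *\<^sub>R Z \<omega>)"
  \<comment> \<open>Time 1 and starting point 0 turn the semigroups into the two expectations of
    \<open>h\<close>.\<close>
  have "\<bar>multi_pois_avg as 1 h 0 - ?G 1 h 0\<bar> \<le> mass / (6 * (r * sqrt r)) + \<delta> * (q * mass + 5 * mass / (2 * r))"
  proof (rule averaging_semigroup_compare[where g = g and g' = g' and f = h])
    show "averaging_semigroup (multi_pois_avg as)" by (rule multi_pois_avg_semigroup[OF as0])
    show "averaging_semigroup ?G" by (rule gaussian_averaging_semigroup[OF M' gauss centred e spanZ])
    show "commuting (multi_pois_avg as s) (?G t)" if "0 \<le> s" "0 \<le> t" for s t
      by (rule commuting_multi_pois_avg[OF as0 that(1) gaussian_element_L1[OF M' gauss centred e spanZ]])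
    show "lipschitz_fun h" by (rule lip)
    show "\<bar>multi_pois_avg as t h y - h y - t * g y\<bar> \<le> C * t\<^sup>2" if "0 < t" "t \<le> 1" for t y by (rule C[OF that])
    show "\<bar>?G t h y - h y - t * g' y\<bar> \<le> (LINT \<omega>|M'. norm (Z \<omega>) ^ 3) / 6 * (t * sqrt t)" if "0 < t" "t \<le> 1" for t y
      unfolding g'_def B_def using that by (intro gaussian_second_order[OF M' gauss centred e spanZ h]) auto
    show "\<bar>g y - g' y\<bar> \<le> mass / (6 * (r * sqrt r)) + \<delta> * (q * mass + 5 * mass / (2 * r))" for y by (rule gg')
  qed
  moreover have "multi_pois_avg as 1 h 0 = (LINT \<omega>|M. h (T \<omega>))"
    using fun_cong[OF shift_avg_pcount_sum[OF M prm A disj order_refl lip, of v], of 0]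
    by (simp add: as_def p_def T_def shift_avg_def)
  moreover have "?G 1 h 0 = (LINT \<omega>|M'. h (Z \<omega>))" by (simp add: shift_avg_def)
  \<comment> \<open>One \<open>q * mass\<close> comes from replacing the integral by the discrete
    sum, the other from the linear term of the generator.\<close>
  ultimately show "\<bar>(LINT \<omega>|M. h ((1 / sqrt r) *\<^sub>R pint \<omega>)) - (LINT \<omega>|M'. h (Z \<omega>))\<bar>
      \<le> mass / (6 * (r * sqrt r)) + (2 * q * mass + 5 * mass / (2 * r)) * \<delta>"
    using 1 unfolding q_def[symmetric] by (simp add: algebra_simps)
qed

end

section \<open>Zonal integrals on the sphere\<close>

lemma distr_lborel_orthogonal_transformation:
  fixes f :: "real^'n::{finite,wellorder} \<Rightarrow> real^'n::_"
  assumes f: "orthogonal_transformation f"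
  shows "distr lborel borel f = lborel"
proof (rule lborel_eqI[symmetric])
  have lin: "linear f" using f by (rule orthogonal_transformation_linear)
  then have fm [measurable]: "f \<in> borel_measurable borel"
    by (intro borel_measurable_continuous_onI linear_continuous_on) (simp add: linear_linear)
  define g where "g = inv f"
  have g: "orthogonal_transformation g" unfolding g_def by (rule orthogonal_transformation_inv[OF f])
  fix l u :: "(real, 'n) vec" assume lu: "\<And>b. b \<in> Basis \<Longrightarrow> l \<bullet> b \<le> u \<bullet> b"
  \<comment> \<open>Boxes determine \<open>lborel\<close>. The preimage of a box is its image under
    the inverse transformation; this image is Borel, so the invariance of \<open>lebesgue\<close>
    under orthogonal images carries over.\<close>
  have vim: "f -` box l u = g ` box l u"
    using orthogonal_transformation_bij[OF f] unfolding g_def by (simp add: bij_vimage_eq_inv_image)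
  have m: "g ` box l u \<in> lmeasurable" and eq: "measure lebesgue (g ` box l u) = measure lebesgue (box l u)"
    using measurable_orthogonal_image[OF g lmeasurable_box] measure_orthogonal_image[OF g lmeasurable_box] by auto
  have b: "g ` box l u \<in> sets borel" unfolding vim[symmetric] using measurable_sets[OF fm, of "box l u"] by simp
  have "emeasure (distr lborel borel f) (box l u) = emeasure lborel (g ` box l u)"
    by (subst emeasure_distr) (auto simp: vim)
  also have "\<dots> = emeasure lebesgue (g ` box l u)" using b by (simp add: emeasure_completion)
  also have "\<dots> = ennreal (measure lebesgue (g ` box l u))"
    by (rule emeasure_eq_measure2[OF m])
  also have "\<dots> = ennreal (measure lebesgue (box l u))" by (simp only: eq)
  also have "\<dots> = (\<Prod>b\<in>Basis. (u - l) \<bullet> b)" using lu by (simp add: measure_completion)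
  finally show "emeasure (distr lborel borel f) (box l u) = (\<Prod>b\<in>Basis. (u - l) \<bullet> b)" .
qed simp

lemma emeasure_sphere_measure:
  assumes A: "A \<in> sets sphere_measure"
  shows "emeasure sphere_measure A = 3 * emeasure lborel {x \<in> ball 0 1 - {0}. x /\<^sub>R norm x \<in> A}"
proof -
  let ?B = "ball (0 :: real^3) 1 - {0}"
  have m0: "(\<lambda>x :: real^3. x /\<^sub>R norm x) \<in> restrict_space lborel ?B \<rightarrow>\<^sub>M restrict_space borel (sphere 0 1)"
    by (intro measurable_restrict_space2 measurable_restrict_space1)
       (auto simp: space_restrict_space)
  have m: "(\<lambda>x :: real^3. x /\<^sub>R norm x) \<in> scale_measure 3 (restrict_space lborel ?B) \<rightarrow>\<^sub>M restrict_space borel (sphere 0 1)"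
    using m0 by (simp cong: measurable_cong_sets)
  have A': "A \<in> sets (restrict_space borel (sphere 0 1))" using A by (simp add: sets_sphere_measure)
  have S: "(\<lambda>x. x /\<^sub>R norm x) -` A \<inter> ?B \<in> sets (restrict_space lborel ?B)"
    using measurable_sets[OF m0 A'] by (simp add: space_restrict_space)
  have "emeasure sphere_measure A = 3 * emeasure (restrict_space lborel ?B) ((\<lambda>x. x /\<^sub>R norm x) -` A \<inter> ?B)"
    unfolding sphere_measure_def by (subst emeasure_distr[OF m A']) (simp add: space_scale_measure space_restrict_space)
  also have "emeasure (restrict_space lborel ?B) ((\<lambda>x. x /\<^sub>R norm x) -` A \<inter> ?B) = emeasure lborel ((\<lambda>x. x /\<^sub>R norm x) -` A \<inter> ?B)"
    by (rule emeasure_restrict_space) auto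
  also have "(\<lambda>x. x /\<^sub>R norm x) -` A \<inter> ?B = {x \<in> ?B. x /\<^sub>R norm x \<in> A}" by auto
  finally show ?thesis .
qed

lemma orthogonal_transformation_measurable_sphere:
  assumes f: "orthogonal_transformation f"
  shows "f \<in> sphere_measure \<rightarrow>\<^sub>M sphere_measure"
proof -
  have "f \<in> borel_measurable borel"
    using orthogonal_transformation_linear[OF f]
    by (intro borel_measurable_continuous_onI linear_continuous_on) (simp add: linear_linear)
  then have "f \<in> restrict_space borel (sphere 0 1) \<rightarrow>\<^sub>M restrict_space borel (sphere 0 1)"
    by (intro measurable_restrict_space3) (auto simp: orthogonal_transformation_norm[OF f])
  then show ?thesis by (simp add: sets_sphere_measure cong: measurable_cong_sets)
qed

text \<open>As \<open>f\<close> is linear and preserves norms, the cone over the preimage of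
  \<open>A\<close> is the preimage of the cone over \<open>A\<close>, and invariance passes from the
  ball to the sphere.\<close>

lemma distr_sphere_measure_orthogonal_transformation:
  assumes f: "orthogonal_transformation f"
  shows "distr sphere_measure sphere_measure f = sphere_measure"
proof (rule measure_eqI)
  note fm = orthogonal_transformation_measurable_sphere[OF f]
  have fb: "f \<in> borel_measurable borel"
    using orthogonal_transformation_linear[OF f]
    by (intro borel_measurable_continuous_onI linear_continuous_on) (simp add: linear_linear)
  have nf: "norm (f x) = norm x" for x by (rule orthogonal_transformation_norm[OF f])
  have sf: "f (c *\<^sub>R x) = c *\<^sub>R f x" for c x
    using orthogonal_transformation_linear[OF f] by (rule linear_scale)
  fix A assume "A \<in> sets (distr sphere_measure sphere_measure f)"
  then have A: "A \<in> sets sphere_measure" by simp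
  let ?B = "ball (0 :: real^3) 1 - {0}"
  have S: "{x \<in> ?B. x /\<^sub>R norm x \<in> A} \<in> sets borel"
  proof -
    obtain C where C: "C \<in> sets borel" "A = sphere 0 1 \<inter> C"
      using A by (auto simp: sets_sphere_measure sets_restrict_space)
    have bm: "(\<lambda>x :: real^3. x /\<^sub>R norm x) \<in> borel_measurable borel" by measurable
    have "{x \<in> ?B. x /\<^sub>R norm x \<in> A} = ?B \<inter> ((\<lambda>x. x /\<^sub>R norm x) -` C \<inter> space borel)"
      using C by auto
    also have "\<dots> \<in> sets borel" using measurable_sets[OF bm C(1)] by auto
    finally show ?thesis .
  qed
  have "emeasure (distr sphere_measure sphere_measure f) A = emeasure sphere_measure (f -` A \<inter> space sphere_measure)"
    using fm A by (rule emeasure_distr)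
  also have "\<dots> = 3 * emeasure lborel {x \<in> ?B. x /\<^sub>R norm x \<in> f -` A \<inter> space sphere_measure}"
    by (rule emeasure_sphere_measure) (use measurable_sets[OF fm A] in simp)
  also have "{x \<in> ?B. x /\<^sub>R norm x \<in> f -` A \<inter> space sphere_measure} = f -` {x \<in> ?B. x /\<^sub>R norm x \<in> A} \<inter> space lborel"
  proof -
    have f0: "f x = 0 \<longleftrightarrow> x = 0" for x using nf[of x] by (metis norm_eq_zero)
    show ?thesis by (auto simp: sf nf f0)
  qed
  also have "emeasure lborel (f -` {x \<in> ?B. x /\<^sub>R norm x \<in> A} \<inter> space lborel) = emeasure (distr lborel borel f) {x \<in> ?B. x /\<^sub>R norm x \<in> A}"
    using fb S by (intro emeasure_distr[symmetric]) auto
  also have "\<dots> = emeasure lborel {x \<in> ?B. x /\<^sub>R norm x \<in> A}"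
    by (simp only: distr_lborel_orthogonal_transformation[OF f])
  also have "3 * \<dots> = emeasure sphere_measure A" by (rule emeasure_sphere_measure[OF A, symmetric])
  finally show "emeasure (distr sphere_measure sphere_measure f) A = emeasure sphere_measure A" .
qed simp

lemma borel_measurable_sphere:
  assumes "continuous_on UNIV f"
  shows "f \<in> borel_measurable sphere_measure"
proof -
  have "f \<in> borel_measurable (restrict_space borel (sphere 0 1))"
    by (intro measurable_restrict_space1 borel_measurable_continuous_onI assms)
  then show ?thesis unfolding measurable_cong_sets[OF sets_sphere_measure refl] .
qed

lemma continuous_bounded_on_sphere:
  fixes f :: "real^3 \<Rightarrow> real"
  assumes "continuous_on UNIV f"
  shows "\<exists>C. \<forall>x\<in>sphere 0 1. \<bar>f x\<bar> \<le> C"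
proof -
  have "compact (f ` sphere 0 1)"
    using assms by (intro compact_continuous_image continuous_on_subset[OF assms]) auto
  then have "bounded (f ` sphere 0 1)" by (rule compact_imp_bounded)
  then show ?thesis by (simp add: bounded_iff)
qed

lemma integrable_sphere_finite:
  fixes f :: "real^3 \<Rightarrow> real"
  assumes "finite_measure \<eta>" "sets \<eta> = sets sphere_measure" "continuous_on UNIV f"
  shows "integrable \<eta> f"
proof -
  obtain C where C: "\<forall>x\<in>sphere 0 1. \<bar>f x\<bar> \<le> C" using continuous_bounded_on_sphere[OF assms(3)] by blast
  have sp: "space \<eta> = sphere 0 1" using sets_eq_imp_space_eq[OF assms(2)] by simp
  have "f \<in> borel_measurable \<eta>"
    using borel_measurable_sphere[OF assms(3)] unfolding measurable_cong_sets[OF assms(2) refl] .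
  then show ?thesis
    using C sp by (intro finite_measure.integrable_const_bound[OF assms(1), of _ C]) auto
qed

lemmas integrable_sphere = integrable_sphere_finite[OF sphere_measure.finite_measure_axioms refl]

lemma integral_sphere_orthogonal_transformation:
  fixes g :: "real^3 \<Rightarrow> real"
  assumes f: "orthogonal_transformation f" and g: "continuous_on UNIV g"
  shows "(LINT x|sphere_measure. g (f x)) = (LINT x|sphere_measure. g x)"
  using integral_distr[OF orthogonal_transformation_measurable_sphere[OF f] borel_measurable_sphere[OF g]]
  unfolding distr_sphere_measure_orthogonal_transformation[OF f] by (rule sym)

section \<open>Moments of a coordinate on the sphere\<close>

definition sphere_moment :: "nat \<Rightarrow> real" where
  "sphere_moment n = (LINT x|sphere_measure. (x $ 3) ^ n)"

text \<open>Some orthogonal transformation takes the third axis to \<open>a / norm a\<close>, and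
  the surface measure does not see it.\<close>

lemma sphere_moment_inner:
  fixes a :: "real^3"
  shows "(LINT x|sphere_measure. (inner x a) ^ n) = norm a ^ n * sphere_moment n"
proof -
  have unit: "(LINT x|sphere_measure. (inner x b) ^ n) = sphere_moment n" if "norm b = 1" for b :: "real^3"
  proof -
    have "norm (axis 3 1 :: real^3) = 1" by (simp add: norm_axis_1)
    then obtain f :: "real^3 \<Rightarrow> real^3" where f: "orthogonal_transformation f" "f (axis 3 1) = b"
      using orthogonal_transformation_exists_1[of "axis 3 1 :: real^3" b] \<open>norm b = 1\<close> by metis
    have "(LINT x|sphere_measure. (inner x b) ^ n) = (LINT x|sphere_measure. (inner (f x) b) ^ n)"
      by (rule integral_sphere_orthogonal_transformation[OF f(1), symmetric]) (intro continuous_intros)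
    also have "\<dots> = (LINT x|sphere_measure. (inner x (axis 3 1)) ^ n)"
      using f by (simp add: f(2)[symmetric] orthogonal_transformation_def)
    finally show ?thesis by (simp add: sphere_moment_def inner_axis)
  qed
  show ?thesis
  proof (cases "a = 0")
    \<comment> \<open>For \<open>n = 0\<close> both sides are the total mass, as
      \<open>0 ^ 0 = 1\<close>; otherwise both are 0.\<close>
    case True
    show ?thesis
    proof (cases n)
      case 0
      then show ?thesis by (simp add: sphere_moment_def)
    qed (simp add: True)
  next
    case False
    have "(LINT x|sphere_measure. (inner x a) ^ n) = (LINT x|sphere_measure. norm a ^ n * (inner x (a /\<^sub>R norm a)) ^ n)"
      using False by (intro Bochner_Integration.integral_cong) (auto simp: power_mult_distrib field_simps)
    also have "\<dots> = norm a ^ n * sphere_moment n"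
      using unit[of "a /\<^sub>R norm a"] False by simp
    finally show ?thesis .
  qed
qed

text \<open>The moment depends on the vector through its norm alone, while negating the axis changes
  its sign.\<close>

lemma sphere_moment_odd: "odd n \<Longrightarrow> sphere_moment n = 0"
proof -
  assume n: "odd n"
  have "sphere_moment n = (LINT x|sphere_measure. (inner x (- axis 3 1)) ^ n)"
    by (subst sphere_moment_inner) (simp add: norm_axis_1)
  also have "\<dots> = - (LINT x|sphere_measure. (inner x (axis 3 1)) ^ n)"
    using n by simp
  also have "\<dots> = - sphere_moment n" by (simp add: sphere_moment_inner norm_axis_1)
  finally show ?thesis by simp
qed

text \<open>
  By rotation invariance the moment of \<open>x\<^sub>3 + s * x\<^sub>k\<close> is \<open>(1 + s\<^sup>2) ^ j\<close> times that of \<open>x\<^sub>3\<close>;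
  the coefficients of \<open>s\<^sup>2\<close> give the mixed moment.
\<close>

lemma sphere_mixed_moment:
  assumes k: "k = 1 \<or> k = (2 :: 3)"
  shows "real (2 * j + 1) * (LINT x|sphere_measure. (x $ 3) ^ (2 * j) * (x $ k)\<^sup>2) = sphere_moment (2 * j + 2)"
proof -
  let ?n = "2 * j + 2"
  define c where "c i = real (?n choose i) * (LINT x|sphere_measure. (x $ k) ^ i * (x $ 3) ^ (?n - i))" for i
  define P where "P = (\<Sum>i\<le>?n. monom (c i) i)"
  define Q where "Q = smult (sphere_moment ?n) ([:1, 0, 1:] ^ (j + 1))"
  have "poly P s = poly Q s" for s
  proof -
    let ?a = "axis 3 1 + s *\<^sub>R axis k 1 :: real^3"
    have k3: "k \<noteq> 3" using k by auto
    have ia: "inner x ?a = s * x $ k + x $ 3" for x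
      by (simp add: inner_add_right inner_axis)
    have na: "norm ?a ^ ?n = (1 + s\<^sup>2) ^ (j + 1)"
    proof -
      have "(norm ?a)\<^sup>2 = inner ?a ?a" by (rule power2_norm_eq_inner)
      also have "\<dots> = 1 + s\<^sup>2" unfolding ia using k3 by (simp add: axis_def power2_eq_square)
      finally have "((norm ?a)\<^sup>2) ^ (j + 1) = (1 + s\<^sup>2) ^ (j + 1)" by simp
      then show ?thesis unfolding power_mult[symmetric] by (simp only: distrib_left mult_1_right)
    qed
    have "poly Q s = sphere_moment ?n * (1 + s\<^sup>2) ^ (j + 1)"
      by (simp add: Q_def poly_power power2_eq_square del: power_Suc)
    also have "\<dots> = (LINT x|sphere_measure. (s * x $ k + x $ 3) ^ ?n)"
      using sphere_moment_inner[of ?a ?n] unfolding ia na by (simp only: mult.commute)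
    also have "\<dots> = (LINT x|sphere_measure. (\<Sum>i\<le>?n. s ^ i * (real (?n choose i) * ((x $ k) ^ i * (x $ 3) ^ (?n - i)))))"
      unfolding binomial_ring by (intro Bochner_Integration.integral_cong sum.cong refl) (simp add: power_mult_distrib mult_ac)
    also have "\<dots> = (\<Sum>i\<le>?n. s ^ i * c i)"
      unfolding c_def
      by (subst Bochner_Integration.integral_sum) (auto intro!: integrable_sphere continuous_intros)
    also have "\<dots> = poly P s" by (simp add: P_def poly_sum poly_monom mult.commute)
    finally show ?thesis by simp
  qed
  then have "P = Q" by (intro poly_eqI_degree_lead_coeff poly_eq_poly_eq_iff[THEN iffD1] ext)
  moreover have "coeff P 2 = c 2" by (simp add: P_def coeff_sum numeral_2_eq_2)
  moreover have "coeff Q 2 = sphere_moment ?n * real (j + 1)"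
  proof -
    have "coeff ([:1, 0, 1 :: real:] ^ i) 0 = 1 \<and> coeff ([:1, 0, 1 :: real:] ^ i) 2 = real i" for i
      by (induction i) (auto simp: mult_pCons_left coeff_pCons numeral_2_eq_2 split: nat.splits)
    from this[of "j + 1"] show ?thesis by (simp only: Q_def coeff_smult)
  qed
  ultimately have "real (?n choose 2) * (LINT x|sphere_measure. (x $ k)\<^sup>2 * (x $ 3) ^ (2 * j)) = sphere_moment ?n * real (j + 1)"
    by (simp add: c_def)
  moreover have "real (?n choose 2) = real (j + 1) * real (2 * j + 1)"
    by (simp add: choose_two algebra_simps)
  ultimately show ?thesis by (simp add: mult.commute[of "(x $ k)\<^sup>2" for x] mult.assoc)
qed

text \<open>Multiply the integrand by \<open>1\<close>, written as the sum of the squared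
  coordinates. The two mixed moments that appear are each \<open>sphere_moment (2 * j + 2)\<close>
  divided by \<open>2 * j + 1\<close>.\<close>

lemma sphere_moment_step: "real (2 * j + 3) * sphere_moment (2 * j + 2) = real (2 * j + 1) * sphere_moment (2 * j)"
proof -
  have i: "integrable sphere_measure (\<lambda>x. (x $ 3) ^ (2 * j) * (x $ k)\<^sup>2)" for k
    by (intro integrable_sphere continuous_intros)
  let ?q = "\<lambda>x k. (x $ 3) ^ (2 * j) * (x $ k)\<^sup>2 :: real"
  have "sphere_moment (2 * j) = (LINT x|sphere_measure. ?q x 1 + ?q x 2 + ?q x 3)"
    unfolding sphere_moment_def
  proof (rule Bochner_Integration.integral_cong[OF refl])
    fix x :: "real^3" assume "x \<in> space sphere_measure"
    then have "inner x x = 1" by (simp add: norm_eq_1)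
    then have s: "(x $ 1)\<^sup>2 + (x $ 2)\<^sup>2 + (x $ 3)\<^sup>2 = 1" by (simp add: inner_vec_def sum_3 power2_eq_square)
    have "(x $ 3) ^ (2 * j) * ((x $ 1)\<^sup>2 + (x $ 2)\<^sup>2 + (x $ 3)\<^sup>2) = (x $ 3) ^ (2 * j)" unfolding s by simp
    then show "(x $ 3) ^ (2 * j) = ?q x 1 + ?q x 2 + ?q x 3"
      by (simp add: distrib_left)
  qed
  also have "\<dots> = (LINT x|sphere_measure. ?q x 1) + (LINT x|sphere_measure. ?q x 2) + sphere_moment (2 * j + 2)"
    using i by (simp add: sphere_moment_def power_add power2_eq_square mult_ac)
  finally have "real (2 * j + 1) * sphere_moment (2 * j) = 2 * sphere_moment (2 * j + 2) + real (2 * j + 1) * sphere_moment (2 * j + 2)"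
    using sphere_mixed_moment[of 1 j] sphere_mixed_moment[of 2 j] by (simp add: distrib_left)
  then show ?thesis by (simp add: algebra_simps)
qed

lemma sphere_moment_even: "sphere_moment (2 * j) = 4 * pi / real (2 * j + 1)"
proof (induction j)
  case 0
  then show ?case
    by (simp add: sphere_moment_def measure_def emeasure_sphere_measure_space)
next
  case (Suc j)
  have "real (2 * j + 3) * sphere_moment (2 * j + 2) = 4 * pi" using sphere_moment_step[of j] Suc by simp
  then show ?case by (simp add: field_simps)
qed

section \<open>Integrals of polynomials over the interval from -1 to 1\<close>

definition poly_int :: "real poly \<Rightarrow> real" where
  "poly_int p = integral {-1..1} (poly p)"

text \<open>Archimedes' hat-box theorem for polynomials: a coordinate on the sphere is uniformly
  distributed, with density \<open>2 * pi\<close>. It follows from the moments, which are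
  \<open>4 * pi / (n + 1)\<close> for even \<open>n\<close> and 0 for odd \<open>n\<close>.\<close>

lemma sphere_integral_poly:
  assumes \<xi>: "norm \<xi> = 1"
  shows "(LINT x|sphere_measure. poly p (inner x \<xi>)) = 2 * pi * poly_int p"
proof -
  have mono: "((\<lambda>t. t ^ n) has_integral (sphere_moment n / (2 * pi))) {-1..1}" for n
  proof -
    have "((\<lambda>t::real. t ^ n) has_integral (1 ^ Suc n / Suc n - (-1) ^ Suc n / Suc n)) {-1..1}"
      by (rule fundamental_theorem_of_calculus)
         (auto intro!: derivative_eq_intros simp: has_real_derivative_iff_has_vector_derivative[symmetric] simp del: power_Suc of_nat_Suc)
    moreover have "(1::real) ^ Suc n / Suc n - (-1) ^ Suc n / Suc n = sphere_moment n / (2 * pi)"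
    proof (cases "even n")
      case True
      then obtain j where "n = 2 * j" by (rule evenE)
      then show ?thesis using sphere_moment_even[of j] by (simp add: field_simps)
    qed (simp add: sphere_moment_odd)
    ultimately show ?thesis by simp
  qed
  have "(poly p has_integral (\<Sum>i\<le>degree p. coeff p i * (sphere_moment i / (2 * pi)))) {-1..1}"
    unfolding poly_altdef[abs_def] by (intro has_integral_sum has_integral_mult_right mono) auto
  then have "2 * pi * poly_int p = (\<Sum>i\<le>degree p. coeff p i * sphere_moment i)"
    by (simp add: poly_int_def integral_unique sum_distrib_left)
  also have "\<dots> = (\<Sum>i\<le>degree p. LINT x|sphere_measure. coeff p i * (inner x \<xi>) ^ i)"
    by (simp add: sphere_moment_inner \<xi>)
  also have "\<dots> = (LINT x|sphere_measure. poly p (inner x \<xi>))"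
    unfolding poly_altdef
    by (rule Bochner_Integration.integral_sum[symmetric]) (intro integrable_sphere continuous_intros)
  finally show ?thesis by simp
qed

lemma poly_int_pderiv: "poly_int (pderiv p) = poly p 1 - poly p (-1)"
  unfolding poly_int_def
  by (rule integral_unique, rule fundamental_theorem_of_calculus)
     (auto simp: has_real_derivative_iff_has_vector_derivative[symmetric] intro: DERIV_subset[OF poly_DERIV])

lemma poly_integrable: "poly p integrable_on {-1..1 :: real}"
  by (intro integrable_continuous_real continuous_intros)

lemma poly_int_add: "poly_int (p + q) = poly_int p + poly_int q"
proof -
  have "poly (p + q) = (\<lambda>x. poly p x + poly q x)" by (simp add: fun_eq_iff)
  then show ?thesis
    using Henstock_Kurzweil_Integration.integral_add[OF poly_integrable poly_integrable, of p q]
    by (simp add: poly_int_def)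
qed

lemma poly_int_smult: "poly_int (smult c p) = c * poly_int p"
proof -
  have "poly (smult c p) = (\<lambda>x. c * poly p x)" by (simp add: fun_eq_iff)
  then show ?thesis by (simp add: poly_int_def)
qed

lemma poly_int_diff: "poly_int (p - q) = poly_int p - poly_int q"
  using poly_int_add[of p "smult (-1) q"] poly_int_smult[of "-1" q] by simp

lemma poly_int_parts:
  assumes "poly p 1 = 0" "poly p (-1) = (0::real)"
  shows "poly_int (pderiv p * q) = - poly_int (p * pderiv q)"
proof -
  have "poly_int (pderiv (p * q)) = 0"
    unfolding poly_int_pderiv using assms by simp
  also have "pderiv (p * q) = pderiv p * q + p * pderiv q" by (simp add: pderiv_mult add.commute mult.commute)
  finally show ?thesis by (simp only: poly_int_add)
qed

lemma power_dvd_pderiv: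
  fixes a :: real
  assumes "[:-a, 1:] ^ Suc n dvd p"
  shows "[:-a, 1:] ^ n dvd pderiv p"
proof -
  obtain q where p: "p = [:-a, 1:] ^ Suc n * q" using assms by (rule dvdE)
  have "pderiv p = [:-a, 1:] ^ n * (smult (1 + real n) q + [:-a, 1:] * pderiv q)"
    unfolding p by (simp add: pderiv_mult pderiv_power_Suc pderiv_pCons algebra_simps del: power_Suc)
      (simp add: algebra_simps)
  then show ?thesis by simp
qed

text \<open>Each derivative lowers the order of a zero by at most one, so fewer than
  \<open>n\<close> of them leave a zero at \<open>a\<close>.\<close>

lemma power_dvd_higher_pderiv:
  fixes a :: real
  assumes "[:-a, 1:] ^ n dvd p" "k < n"
  shows "poly ((pderiv ^^ k) p) a = 0"
proof -
  have "[:-a, 1:] ^ (n - k) dvd (pderiv ^^ k) p" if "k \<le> n" for k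
    using that
  proof (induction k)
    case (Suc k)
    then have "[:-a, 1:] ^ Suc (n - Suc k) dvd (pderiv ^^ k) p" by (simp add: Suc_diff_Suc)
    then show ?case by (simp add: power_dvd_pderiv)
  qed (use assms in simp)
  then have "[:-a, 1:] ^ (n - k) dvd (pderiv ^^ k) p" using assms(2) by simp
  moreover have "[:-a, 1:] ^ 1 dvd [:-a, 1:] ^ (n - k)" using assms(2) by (intro le_imp_power_dvd) simp
  ultimately have "[:-a, 1:] ^ 1 dvd (pderiv ^^ k) p" by (rule dvd_trans[rotated])
  then show ?thesis by (simp add: poly_eq_0_iff_dvd)
qed

lemma rodrigues_roots:
  assumes "k < l"
  shows "poly ((pderiv ^^ k) ([:-1, 0, 1:] ^ l)) 1 = (0::real)" "poly ((pderiv ^^ k) ([:-1, 0, 1:] ^ l)) (-1) = (0::real)"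
proof -
  have "[:-1, 0, 1 :: real:] = [:-1, 1:] * [:-(-1), 1:]" by simp
  then have e: "[:-1, 0, 1 :: real:] ^ l = [:-1, 1:] ^ l * [:-(-1), 1:] ^ l" by (simp only: power_mult_distrib)
  show "poly ((pderiv ^^ k) ([:-1, 0, 1:] ^ l)) 1 = (0::real)"
    by (rule power_dvd_higher_pderiv[OF _ assms]) (unfold e, rule dvd_triv_left)
  show "poly ((pderiv ^^ k) ([:-1, 0, 1:] ^ l)) (-1) = (0::real)"
    by (rule power_dvd_higher_pderiv[OF _ assms]) (unfold e, rule dvd_triv_right)
qed

text \<open>For \<open>l \<ge> 1\<close> Rodrigues' formula makes the polynomial a derivative, of a
  polynomial that vanishes at both endpoints.\<close>

lemma poly_int_legendre:
  assumes "1 \<le> l"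
  shows "poly_int (legendre_poly l) = 0"
proof -
  obtain k where l: "l = Suc k" using assms by (cases l) auto
  have "poly_int (pderiv ((pderiv ^^ k) ([:-1, 0, 1:] ^ l))) = 0"
    unfolding poly_int_pderiv using rodrigues_roots[of k l] l by simp
  then have "poly_int ((pderiv ^^ l) ([:-1, 0, 1:] ^ l)) = 0" by (simp only: l funpow.simps o_apply)
  then show ?thesis by (simp only: legendre_poly_def poly_int_smult mult_zero_right)
qed

text \<open>The derivative of \<open>t * (1 - t^2) ^ (l + 1)\<close> integrates to 0 and is a
  combination of the powers \<open>l + 1\<close> and \<open>l\<close> of \<open>1 - t^2\<close>;
  this is the recursion \<open>step\<close>.\<close>

lemma poly_int_one_minus_square_power:
  "poly_int ([:1, 0, -1:] ^ l) * (real (2 * l + 1) * fact (2 * l)) = 2 * 4 ^ l * (fact l)\<^sup>2"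
proof (induction l)
  case 0
  have "poly_int 1 = poly_int (pderiv [:0, 1:])" by (simp add: pderiv_pCons one_pCons)
  also have "\<dots> = 2" unfolding poly_int_pderiv by simp
  finally show ?case by simp
next
  case (Suc l)
  let ?V = "\<lambda>l. [:1, 0, -1 :: real:] ^ l" and ?w = "\<lambda>l. poly_int ([:1, 0, -1:] ^ l)"
  have "pderiv ([:0, 1:] * ?V (Suc l)) = smult (real (2 * l + 3)) (?V (Suc l)) - smult (real (2 * l + 2)) (?V l)"
  proof (rule poly_eq_poly_eq_iff[THEN iffD1], rule ext)
    fix t :: real
    have "poly (pderiv ([:0, 1:] * ?V (Suc l))) t = (1 - t\<^sup>2) ^ Suc l - real (2 * l + 2) * t\<^sup>2 * (1 - t\<^sup>2) ^ l"
      by (simp add: pderiv_mult pderiv_power_Suc pderiv_pCons poly_power power2_eq_square algebra_simps del: power_Suc)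
    also have "\<dots> = real (2 * l + 3) * (1 - t\<^sup>2) ^ Suc l - real (2 * l + 2) * (1 - t\<^sup>2) ^ l"
      by (simp add: algebra_simps)
    finally show "poly (pderiv ([:0, 1:] * ?V (Suc l))) t
       = poly (smult (real (2 * l + 3)) (?V (Suc l)) - smult (real (2 * l + 2)) (?V l)) t"
      by (simp add: poly_power power2_eq_square del: power_Suc)
  qed
  then have "poly_int (smult (real (2 * l + 3)) (?V (Suc l)) - smult (real (2 * l + 2)) (?V l)) = 0"
    using poly_int_pderiv[of "[:0, 1:] * ?V (Suc l)"] by simp
  then have step: "real (2 * l + 3) * ?w (Suc l) = real (2 * l + 2) * ?w l"
    by (simp only: poly_int_diff poly_int_smult)
  have f: "fact (2 * Suc l) = real (2 * l + 2) * (real (2 * l + 1) * fact (2 * l))" by (simp add: algebra_simps)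
  have "?w (Suc l) * (real (2 * Suc l + 1) * fact (2 * Suc l)) = (real (2 * l + 3) * ?w (Suc l)) * (real (2 * l + 2) * (real (2 * l + 1) * fact (2 * l)))"
    unfolding f by (simp add: mult_ac del: power_Suc)
  also have "\<dots> = real (2 * l + 2) * real (2 * l + 2) * (?w l * (real (2 * l + 1) * fact (2 * l)))"
    unfolding step by (simp only: mult_ac)
  also have "\<dots> = 2 * 4 ^ Suc l * (fact (Suc l))\<^sup>2"
    unfolding Suc by (simp add: power2_eq_square algebra_simps)
  finally show ?case .
qed

text \<open>Integration by parts, \<open>l\<close> times, moves all derivatives to one factor:
  boundary terms vanish by \<open>rodrigues_roots\<close>, and the derivative of order
  \<open>2 * l\<close> of the monic polynomial \<open>W\<close> of degree \<open>2 * l\<close> is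
  the constant \<open>fact (2 * l)\<close>.\<close>

lemma poly_int_legendre_square:
  "poly_int ((legendre_poly l)\<^sup>2) = 2 / real (2 * l + 1)"
proof -
  define W where "W = [:-1, 0, 1 :: real:] ^ l"
  have parts: "poly_int ((pderiv ^^ l) W * q) = (-1) ^ k * poly_int ((pderiv ^^ (l - k)) W * (pderiv ^^ k) q)"
    if "k \<le> l" for k q
    using that
  proof (induction k)
    case (Suc k)
    then have e: "(pderiv ^^ (l - k)) W = pderiv ((pderiv ^^ (l - Suc k)) W)"
      by (metis Suc_diff_le diff_Suc_Suc funpow.simps(2) o_apply)
    have "poly_int (pderiv ((pderiv ^^ (l - Suc k)) W) * (pderiv ^^ k) q)
       = - poly_int ((pderiv ^^ (l - Suc k)) W * pderiv ((pderiv ^^ k) q))"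
      by (rule poly_int_parts) (use rodrigues_roots[of "l - Suc k" l] Suc.prems in \<open>auto simp: W_def\<close>)
    then show ?case using Suc.IH Suc.prems by (simp add: e)
  qed simp
  have dW: "degree W = 2 * l" unfolding W_def by (subst degree_power_eq) auto
  have lW: "coeff W (2 * l) = 1" using dW lead_coeff_power[of "[:-1, 0, 1 :: real:]" l] by (simp add: W_def)
  have D: "(pderiv ^^ l) ((pderiv ^^ l) W) = [:fact (2 * l):]"
  proof -
    have "(pderiv ^^ (2 * l)) W = [:fact (2 * l):]"
    proof (rule poly_eqI)
      fix i show "coeff ((pderiv ^^ (2 * l)) W) i = coeff [:fact (2 * l):] i"
        using lW dW by (cases i) (auto simp: coeff_higher_pderiv pochhammer_fact[symmetric] coeff_eq_0)
    qed
    then show ?thesis by (simp add: mult_2 funpow_add)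
  qed
  \<comment> \<open>The sign that relates \<open>W\<close> to a power of \<open>1 - t^2\<close>
    cancels the sign from integration by parts.\<close>
  have Wm: "W * [:fact (2 * l):] = smult ((-1) ^ l * fact (2 * l)) ([:1, 0, -1:] ^ l)"
  proof -
    have a: "[:-1, 0, 1 :: real:] = smult (-1) [:1, 0, -1:]" by simp
    have "W = smult ((-1) ^ l) ([:1, 0, -1:] ^ l)" by (simp only: W_def a smult_power)
    then show ?thesis by (simp add: mult.commute)
  qed
  have "poly_int ((pderiv ^^ l) W * (pderiv ^^ l) W) = (-1) ^ l * poly_int (W * [:fact (2 * l):])"
    using parts[of l "(pderiv ^^ l) W"] by (simp only: D diff_self_eq_0 funpow_0 order_refl simp_thms)
  also have "\<dots> = fact (2 * l) * poly_int ([:1, 0, -1:] ^ l)"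
    unfolding Wm poly_int_smult by (simp add: mult.assoc[symmetric] power_mult_distrib[symmetric])
  finally have I: "poly_int ((pderiv ^^ l) W * (pderiv ^^ l) W) = fact (2 * l) * poly_int ([:1, 0, -1:] ^ l)" .
  have sq: "(legendre_poly l)\<^sup>2 = smult ((1 / (2 ^ l * fact l))\<^sup>2) ((pderiv ^^ l) W * (pderiv ^^ l) W)"
    by (simp add: legendre_poly_def W_def power2_eq_square)
  have "poly_int ((legendre_poly l)\<^sup>2) * real (2 * l + 1)
     = (1 / (2 ^ l * fact l))\<^sup>2 * (poly_int ([:1, 0, -1:] ^ l) * (real (2 * l + 1) * fact (2 * l)))"
    unfolding sq poly_int_smult I by (simp only: mult_ac)
  also have "\<dots> = (1 / (2 ^ l * fact l))\<^sup>2 * (2 * 4 ^ l * (fact l)\<^sup>2)"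
    unfolding poly_int_one_minus_square_power ..
  also have "(4 :: real) ^ l = (2 ^ l)\<^sup>2" by (simp add: power_mult[symmetric] mult.commute[of l] power_mult)
  also have "(1 / (2 ^ l * fact l))\<^sup>2 * (2 * (2 ^ l)\<^sup>2 * (fact l)\<^sup>2) = (2 :: real)" by (simp add: power_mult_distrib power_divide)
  finally show ?thesis by (simp add: field_simps)
qed

section \<open>The Poisson spherical wave\<close>

lemma square_integrable_sphere_continuous:
  "continuous_on UNIV f \<Longrightarrow> square_integrable_sphere f"
  using continuous_bounded_on_sphere[of f] borel_measurable_sphere[of f]
  by (auto intro: square_integrable_sphere_bounded)

text \<open>Such a kernel reduces every integral over \<open>\<xi>\<close>, pointwise or with values
  in \<open>sphere_L2\<close>, to finitely many scalar integrals, and gives its sections a common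
  finite-dimensional span.\<close>

definition separable_kernel :: "(real^3 \<Rightarrow> real^3 \<Rightarrow> real) \<Rightarrow> bool" where
  "separable_kernel F \<longleftrightarrow> (\<exists>ps. (\<forall>(a, b)\<in>set ps. continuous_on UNIV a \<and> continuous_on UNIV b) \<and>
     F = (\<lambda>x \<xi>. \<Sum>(a, b)\<leftarrow>ps. a x * b \<xi>))"

lemma separable_kernel_single:
  "continuous_on UNIV a \<Longrightarrow> continuous_on UNIV b \<Longrightarrow> separable_kernel (\<lambda>x \<xi>. a x * b \<xi>)"
  unfolding separable_kernel_def by (intro exI[of _ "[(a, b)]"]) auto

lemma separable_kernel_add:
  assumes "separable_kernel F" "separable_kernel G"
  shows "separable_kernel (\<lambda>x \<xi>. F x \<xi> + G x \<xi>)"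
proof -
  obtain ps qs where "\<forall>(a, b)\<in>set ps. continuous_on UNIV a \<and> continuous_on UNIV b" "F = (\<lambda>x \<xi>. \<Sum>(a, b)\<leftarrow>ps. a x * b \<xi>)"
    "\<forall>(a, b)\<in>set qs. continuous_on UNIV a \<and> continuous_on UNIV b" "G = (\<lambda>x \<xi>. \<Sum>(a, b)\<leftarrow>qs. a x * b \<xi>)"
    using assms unfolding separable_kernel_def by blast
  then show ?thesis unfolding separable_kernel_def by (intro exI[of _ "ps @ qs"]) auto
qed

lemma separable_kernel_mult_single:
  assumes F: "separable_kernel F" and ab: "continuous_on UNIV a" "continuous_on UNIV b"
  shows "separable_kernel (\<lambda>x \<xi>. a x * b \<xi> * F x \<xi>)"
proof -
  obtain ps where ps: "\<forall>(a, b)\<in>set ps. continuous_on UNIV a \<and> continuous_on UNIV b" "F = (\<lambda>x \<xi>. \<Sum>(a, b)\<leftarrow>ps. a x * b \<xi>)"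
    using F unfolding separable_kernel_def by blast
  define qs where "qs = map (\<lambda>(f, g). (\<lambda>x. a x * f x, \<lambda>\<xi>. b \<xi> * g \<xi>)) ps"
  have "\<forall>(f, g)\<in>set qs. continuous_on UNIV f \<and> continuous_on UNIV g"
    using ps(1) ab by (auto simp: qs_def intro!: continuous_on_mult)
  moreover have "a x * b \<xi> * F x \<xi> = (\<Sum>(f, g)\<leftarrow>qs. f x * g \<xi>)" for x \<xi>
    unfolding ps(2) qs_def sum_list_const_mult[symmetric] by (simp add: comp_def case_prod_unfold mult_ac)
  ultimately show ?thesis unfolding separable_kernel_def by blast
qed

text \<open>Horner's scheme: each step multiplies by \<open>inner x \<xi>\<close>, which is a sum of
  three products of coordinates.\<close>

lemma separable_kernel_poly: "separable_kernel (\<lambda>x \<xi>. poly p (inner x \<xi>))"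
proof (induction p)
  case 0
  show ?case using separable_kernel_single[of "\<lambda>_. 0" "\<lambda>_. 0"] by simp
next
  case (pCons c p)
  have "poly (pCons c p) (inner x \<xi>) = c * 1 + (x $ 1 * \<xi> $ 1 * poly p (inner x \<xi>) + (x $ 2 * \<xi> $ 2 * poly p (inner x \<xi>) + x $ 3 * \<xi> $ 3 * poly p (inner x \<xi>)))"
    for x \<xi> :: "real^3"
    by (simp add: inner_vec_def sum_3 algebra_simps)
  moreover have "separable_kernel (\<lambda>x \<xi>. c * 1 + (x $ 1 * \<xi> $ 1 * poly p (inner x \<xi>) + (x $ 2 * \<xi> $ 2 * poly p (inner x \<xi>) + x $ 3 * \<xi> $ 3 * poly p (inner x \<xi>))))"
    by (intro separable_kernel_add separable_kernel_mult_single pCons.IH separable_kernel_single[of "\<lambda>_. c" "\<lambda>_. 1"] continuous_intros)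
  ultimately show ?case by simp
qed

lemma separable_kernelE:
  assumes "separable_kernel F"
  obtains d a b where "\<And>i. i < (d::nat) \<Longrightarrow> continuous_on UNIV (a i)" "\<And>i. i < d \<Longrightarrow> continuous_on UNIV (b i)"
    "\<And>x \<xi>. F x \<xi> = (\<Sum>i<d. b i \<xi> * a i x)"
proof -
  obtain ps where ps: "\<forall>(a, b)\<in>set ps. continuous_on UNIV a \<and> continuous_on UNIV b" "F = (\<lambda>x \<xi>. \<Sum>(a, b)\<leftarrow>ps. a x * b \<xi>)"
    using assms unfolding separable_kernel_def by blast
  show thesis
  proof (rule that[of "length ps" "\<lambda>i. fst (ps ! i)" "\<lambda>i. snd (ps ! i)"])
    show "F x \<xi> = (\<Sum>i<length ps. snd (ps ! i) \<xi> * fst (ps ! i) x)" for x \<xi>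
      unfolding ps(2) by (simp add: sum_list_sum_nth atLeast0LessThan case_prod_unfold mult.commute)
  qed (use ps(1) nth_mem in \<open>fastforce simp: case_prod_unfold\<close>)+
qed

lemma abs_sphere_L2_sum:
  assumes "\<And>i. i < d \<Longrightarrow> square_integrable_sphere (f i)"
  shows "square_integrable_sphere (\<lambda>x. \<Sum>i<d. c i * f i x)"
    and "abs_sphere_L2 (\<lambda>x. \<Sum>i<(d::nat). c i * f i x) = (\<Sum>i<d. c i *\<^sub>R abs_sphere_L2 (f i))"
proof -
  have "square_integrable_sphere (\<lambda>x. \<Sum>i<d. c i * f i x) \<and>
     abs_sphere_L2 (\<lambda>x. \<Sum>i<d. c i * f i x) = (\<Sum>i<d. c i *\<^sub>R abs_sphere_L2 (f i))"
    using assms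
  proof (induction d)
    case 0
    then show ?case by (simp add: square_integrable_sphere_zero zero_sphere_L2.abs_eq[symmetric])
  next
    case (Suc d)
    then have IH: "square_integrable_sphere (\<lambda>x. \<Sum>i<d. c i * f i x)"
      "abs_sphere_L2 (\<lambda>x. \<Sum>i<d. c i * f i x) = (\<Sum>i<d. c i *\<^sub>R abs_sphere_L2 (f i))"
      and f: "square_integrable_sphere (f d)" by auto
    have cf: "square_integrable_sphere (\<lambda>x. c d * f d x)" by (rule square_integrable_sphere_cmult[OF f])
    show ?case
      using square_integrable_sphere_add[OF IH(1) cf] plus_abs_sphere_L2[OF IH(1) cf] IH(2) scaleR_abs_sphere_L2[OF f]
      by simp
  qed
  then show "square_integrable_sphere (\<lambda>x. \<Sum>i<d. c i * f i x)"
    "abs_sphere_L2 (\<lambda>x. \<Sum>i<d. c i * f i x) = (\<Sum>i<d. c i *\<^sub>R abs_sphere_L2 (f i))" by auto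
qed

text \<open>The class of the pointwise integral and the Bochner integral of the classes have the
  same expansion, with the integrals of the \<open>b i\<close> as coefficients.\<close>

lemma
  assumes a: "\<forall>i<d::nat. continuous_on UNIV (a i)" and b: "\<forall>i<d. continuous_on UNIV (b i)"
    and F: "\<And>x \<xi>. F x \<xi> = (\<Sum>i<d. b i \<xi> * a i x)"
  shows separable_kernel_abs: "abs_sphere_L2 (\<lambda>x. F x \<xi>) = (\<Sum>i<d. b i \<xi> *\<^sub>R abs_sphere_L2 (a i))"
    and separable_kernel_integral: "finite_measure \<eta> \<Longrightarrow> sets \<eta> = sets sphere_measure \<Longrightarrow>
      abs_sphere_L2 (\<lambda>x. LINT \<xi>|\<eta>. F x \<xi>) = (LINT \<xi>|\<eta>. abs_sphere_L2 (\<lambda>x. F x \<xi>))"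
    and separable_kernel_integral_square_integrable: "finite_measure \<eta> \<Longrightarrow> sets \<eta> = sets sphere_measure \<Longrightarrow>
      square_integrable_sphere (\<lambda>x. LINT \<xi>|\<eta>. F x \<xi>)"
proof -
  have sq: "square_integrable_sphere (a i)" if "i < d" for i
    using a[rule_format, OF that] by (rule square_integrable_sphere_continuous)
  show e: "abs_sphere_L2 (\<lambda>x. F x \<xi>) = (\<Sum>i<d. b i \<xi> *\<^sub>R abs_sphere_L2 (a i))" for \<xi>
    unfolding F by (rule abs_sphere_L2_sum(2)) (rule sq)
  assume \<eta>: "finite_measure \<eta>" "sets \<eta> = sets sphere_measure"
  have ib: "integrable \<eta> (b i)" if "i < d" for i by (rule integrable_sphere_finite[OF \<eta> b[rule_format, OF that]])
  have "(LINT \<xi>|\<eta>. abs_sphere_L2 (\<lambda>x. F x \<xi>)) = (\<Sum>i<d. (LINT \<xi>|\<eta>. b i \<xi>) *\<^sub>R abs_sphere_L2 (a i))"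
    unfolding e by (subst Bochner_Integration.integral_sum) (use ib in auto)
  moreover have FI: "(LINT \<xi>|\<eta>. F x \<xi>) = (\<Sum>i<d. (LINT \<xi>|\<eta>. b i \<xi>) * a i x)" for x
    unfolding F by (subst Bochner_Integration.integral_sum) (use ib in auto)
  moreover have "abs_sphere_L2 (\<lambda>x. \<Sum>i<d. (LINT \<xi>|\<eta>. b i \<xi>) * a i x) = (\<Sum>i<d. (LINT \<xi>|\<eta>. b i \<xi>) *\<^sub>R abs_sphere_L2 (a i))"
    by (rule abs_sphere_L2_sum(2)) (rule sq)
  ultimately show "abs_sphere_L2 (\<lambda>x. LINT \<xi>|\<eta>. F x \<xi>) = (LINT \<xi>|\<eta>. abs_sphere_L2 (\<lambda>x. F x \<xi>))" by simp
  show "square_integrable_sphere (\<lambda>x. LINT \<xi>|\<eta>. F x \<xi>)"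
    unfolding FI by (rule abs_sphere_L2_sum(1)) (rule sq)
qed

section \<open>The wave as a Poisson integral of unit vectors\<close>

definition wave_kernel :: "nat \<Rightarrow> real^3 \<Rightarrow> real^3 \<Rightarrow> real" where
  "wave_kernel l x \<xi> = sqrt ((2 * real l + 1) / (4 * pi)) * poly (legendre_poly l) (inner x \<xi>)"

definition wave_element :: "nat \<Rightarrow> real^3 \<Rightarrow> sphere_L2" where
  "wave_element l \<xi> = abs_sphere_L2 (\<lambda>x. wave_kernel l x \<xi>)"

lemma wave_kernelE:
  obtains d a b where "\<forall>i<d::nat. continuous_on UNIV (a i)" "\<forall>i<d. continuous_on UNIV (b i)"
    "\<And>x \<xi>. wave_kernel l x \<xi> = (\<Sum>i<d. b i \<xi> * a i x)"
proof -
  have "wave_kernel l = (\<lambda>x \<xi>. poly (smult (sqrt ((2 * real l + 1) / (4 * pi))) (legendre_poly l)) (inner x \<xi>))"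
    by (simp add: wave_kernel_def fun_eq_iff)
  then have "separable_kernel (wave_kernel l)" by (simp only: separable_kernel_poly)
  then show thesis using separable_kernelE that by blast
qed

lemma poisson_wave_eq:
  assumes "finite_measure \<eta>" "sets \<eta> = sets sphere_measure"
  shows "poisson_wave l r \<eta> = (1 / sqrt r) *\<^sub>R (LINT \<xi>|\<eta>. wave_element l \<xi>)"
proof -
  obtain d a b where k: "\<forall>i<d::nat. continuous_on UNIV (a i)" "\<forall>i<d. continuous_on UNIV (b i)"
    "\<And>x \<xi>. wave_kernel l x \<xi> = (\<Sum>i<d. b i \<xi> * a i x)" using wave_kernelE[of l] by blast
  have "poisson_wave l r \<eta> = abs_sphere_L2 (\<lambda>x. 1 / sqrt r * (LINT \<xi>|\<eta>. wave_kernel l x \<xi>))"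
    by (simp only: poisson_wave_def wave_kernel_def)
  also have "\<dots> = (1 / sqrt r) *\<^sub>R abs_sphere_L2 (\<lambda>x. LINT \<xi>|\<eta>. wave_kernel l x \<xi>)"
    by (rule scaleR_abs_sphere_L2[symmetric]) (rule separable_kernel_integral_square_integrable[OF k assms])
  also have "abs_sphere_L2 (\<lambda>x. LINT \<xi>|\<eta>. wave_kernel l x \<xi>) = (LINT \<xi>|\<eta>. wave_element l \<xi>)"
    unfolding wave_element_def by (rule separable_kernel_integral[OF k assms])
  finally show ?thesis .
qed

lemma continuous_wave_element: "continuous_on UNIV (wave_element l)"
proof -
  obtain d a b where k: "\<forall>i<d::nat. continuous_on UNIV (a i)" "\<forall>i<d. continuous_on UNIV (b i)"
    "\<And>x \<xi>. wave_kernel l x \<xi> = (\<Sum>i<d. b i \<xi> * a i x)" using wave_kernelE[of l] by blast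
  have "wave_element l = (\<lambda>\<xi>. \<Sum>i<d. b i \<xi> *\<^sub>R abs_sphere_L2 (a i))"
    unfolding wave_element_def by (rule ext) (rule separable_kernel_abs[OF k])
  moreover have "continuous_on UNIV (\<lambda>\<xi>. \<Sum>i<d. b i \<xi> *\<^sub>R abs_sphere_L2 (a i))"
    by (intro continuous_on_sum continuous_on_scaleR continuous_on_const) (use k(2) in auto)
  ultimately show ?thesis by simp
qed

lemma continuous_wave_kernel: "continuous_on UNIV (\<lambda>x. wave_kernel l x \<xi>)"
  unfolding wave_kernel_def by (intro continuous_intros)

text \<open>The squared Legendre polynomial has integral \<open>2 * pi * (2 / (2 * l + 1))\<close>
  over the sphere, the reciprocal of the squared factor in the kernel.\<close>

lemma norm_wave_element:
  assumes "norm \<xi> = 1"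
  shows "norm (wave_element l \<xi>) = 1"
proof -
  have "(norm (wave_element l \<xi>))\<^sup>2 = (LINT x|sphere_measure. (wave_kernel l x \<xi>)\<^sup>2)"
    unfolding wave_element_def
    by (rule norm_abs_sphere_L2) (intro square_integrable_sphere_continuous continuous_wave_kernel)
  also have "\<dots> = (LINT x|sphere_measure. (2 * real l + 1) / (4 * pi) * poly ((legendre_poly l)\<^sup>2) (inner x \<xi>))"
    by (simp add: wave_kernel_def power_mult_distrib poly_power)
  also have "\<dots> = (2 * real l + 1) / (4 * pi) * (2 * pi * (2 / real (2 * l + 1)))"
    by (simp only: integral_mult_right_zero sphere_integral_poly[OF assms] poly_int_legendre_square)
  also have "\<dots> = 1"
  proof -
    have "c / (4 * pi) * (2 * pi * (2 / c)) = 1" if "0 < c" for c :: real using that by simp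
    from this[of "2 * real l + 1"] show ?thesis by simp
  qed
  finally have "(norm (wave_element l \<xi>))\<^sup>2 = 1\<^sup>2" by simp
  then show ?thesis by (rule power2_eq_imp_eq) auto
qed

text \<open>For \<open>l \<ge> 1\<close> the Legendre polynomial has integral zero, and
  \<open>inner x \<xi>\<close> is symmetric, so integrating over \<open>\<xi>\<close> gives 0 at
  each point \<open>x\<close> of the sphere.\<close>

lemma integral_wave_element:
  assumes "1 \<le> l"
  shows "(LINT \<xi>|sphere_measure. wave_element l \<xi>) = 0"
proof -
  obtain d a b where k: "\<forall>i<d::nat. continuous_on UNIV (a i)" "\<forall>i<d. continuous_on UNIV (b i)"
    "\<And>x \<xi>. wave_kernel l x \<xi> = (\<Sum>i<d. b i \<xi> * a i x)" using wave_kernelE[of l] by blast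
  note s = sphere_measure.finite_measure_axioms refl[of "sets sphere_measure"]
  have z: "(LINT \<xi>|sphere_measure. wave_kernel l x \<xi>) = 0" if "x \<in> sphere 0 1" for x
    using that sphere_integral_poly[of x "legendre_poly l"] poly_int_legendre[OF assms]
    by (simp add: wave_kernel_def inner_commute[of x])
  have "(LINT \<xi>|sphere_measure. wave_element l \<xi>) = abs_sphere_L2 (\<lambda>x. LINT \<xi>|sphere_measure. wave_kernel l x \<xi>)"
    unfolding wave_element_def by (rule separable_kernel_integral[OF k s, symmetric])
  also have "\<dots> = abs_sphere_L2 (\<lambda>_. 0)"
    by (rule abs_sphere_L2_eqI[OF separable_kernel_integral_square_integrable[OF k s] square_integrable_sphere_zero])
       (rule AE_I2, simp add: z)
  finally show ?thesis by (simp add: zero_sphere_L2.abs_eq)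
qed

section \<open>Finite-dimensional range and partitions of the sphere\<close>

lemma span_orthonormal_upto:
  fixes B :: "'k::real_inner set"
  assumes "finite B"
  obtains d e where "orthonormal_upto d e" "\<And>x. x \<in> span B \<Longrightarrow> x = (\<Sum>i<d. inner x (e i) *\<^sub>R e i)"
proof -
  obtain C where C: "finite C" "span C = span B" "pairwise orthogonal C"
    using basis_orthogonal[OF assms] by blast
  \<comment> \<open>The orthogonal generating set may contain 0, which must go before the vectors
    are normalized.\<close>
  obtain n and f :: "nat \<Rightarrow> 'k" where f: "bij_betw f {0..<n} (C - {0})"
    using ex_bij_betw_nat_finite[of "C - {0}"] C(1) by auto
  define e where "e i = f i /\<^sub>R norm (f i)" for i
  have fC: "f i \<in> C" "f i \<noteq> 0" if "i < n" for i using f that by (auto simp: bij_betw_def)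
  have inj: "f i \<noteq> f j" if "i < n" "j < n" "i \<noteq> j" for i j
    using f that by (auto simp: bij_betw_def inj_on_def)
  have on: "orthonormal_upto n e"
    unfolding orthonormal_upto_def
  proof (intro allI impI)
    fix i j assume ij: "i < n" "j < n"
    show "inner (e i) (e j) = (if i = j then 1 else 0)"
    proof (cases "i = j")
      case True
      then show ?thesis using fC(2)[OF ij(1)] by (simp add: e_def dot_square_norm power2_eq_square)
    next
      case False
      then have "inner (f i) (f j) = 0"
        using C(3) fC[OF ij(1)] fC[OF ij(2)] inj[OF ij False] by (auto simp: pairwise_def orthogonal_def)
      then show ?thesis using False by (simp add: e_def)
    qed
  qed
  define P where "P x = (\<Sum>i<n. inner x (e i) *\<^sub>R e i)" for x
  have lP: "linear P" unfolding P_def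
    by (intro linearI) (simp_all add: inner_add_left scaleR_add_left sum.distrib scaleR_sum_right)
  have PC: "P c = c" if c: "c \<in> C" for c
  proof (cases "c = 0")
    case True
    then show ?thesis by (simp add: P_def)
  next
    case False
    then have "c \<in> f ` {0..<n}" using f c by (simp add: bij_betw_def)
    then obtain j where j: "j < n" "c = f j" by auto
    have ce: "c = norm (f j) *\<^sub>R e j" using False j by (simp add: e_def)
    have "P (e j) = (\<Sum>i<n. (if i = j then e j else 0))"
      unfolding P_def using on j by (intro sum.cong) (auto simp: orthonormal_upto_def)
    then have "P (e j) = e j" using j by simp
    then show ?thesis by (subst (1 2) ce) (simp add: linear_scale[OF lP])
  qed
  have "P x = x" if "x \<in> span C" for x
    using that
  proof (induction rule: span_induct_alt)
    case base
    show ?case by (simp add: linear_0[OF lP])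
  next
    case (step c x y)
    then show ?case by (simp add: linear_add[OF lP] linear_scale[OF lP] PC)
  qed
  then show thesis using that[OF on] C(2) by (simp add: P_def)
qed

lemma wave_element_span:
  obtains d e where "orthonormal_upto d e" "\<And>\<xi>. wave_element l \<xi> = (\<Sum>i<d. inner (wave_element l \<xi>) (e i) *\<^sub>R e i)"
proof -
  obtain d a b where k: "\<forall>i<d::nat. continuous_on UNIV (a i)" "\<forall>i<d. continuous_on UNIV (b i)"
    "\<And>x \<xi>. wave_kernel l x \<xi> = (\<Sum>i<d. b i \<xi> * a i x)" using wave_kernelE[of l] by blast
  let ?B = "(\<lambda>i. abs_sphere_L2 (a i)) ` {..<d}"
  have sp: "wave_element l \<xi> \<in> span ?B" for \<xi>
    unfolding wave_element_def separable_kernel_abs[OF k]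
    by (intro span_sum span_scale span_base) auto
  obtain d' e where "orthonormal_upto d' e" "\<And>x. x \<in> span ?B \<Longrightarrow> x = (\<Sum>i<d'. inner x (e i) *\<^sub>R e i)"
    using span_orthonormal_upto[of ?B] by blast
  then show thesis using that sp by blast
qed

text \<open>Finitely many balls with the radius from uniform continuity cover the sphere; successive
  differences make them disjoint.\<close>

lemma sphere_approx_partition:
  fixes \<phi> :: "real^3 \<Rightarrow> 'k::real_normed_vector"
  assumes L: "sets L = sets sphere_measure" and cont: "continuous_on (sphere 0 1) \<phi>"
    and le: "\<And>x. x \<in> sphere 0 1 \<Longrightarrow> norm (\<phi> x) \<le> 1" and \<delta>: "0 < \<delta>"
  shows "\<exists>m A c. approx_partition L \<phi> \<delta> m A c"
proof -
  let ?S = "sphere 0 1 :: (real^3) set"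
  have "uniformly_continuous_on ?S \<phi>" using cont by (rule compact_uniformly_continuous) simp
  then obtain \<rho> where \<rho>: "0 < \<rho>" "\<And>x y. x \<in> ?S \<Longrightarrow> y \<in> ?S \<Longrightarrow> dist x y < \<rho> \<Longrightarrow> dist (\<phi> x) (\<phi> y) < \<delta>"
    unfolding uniformly_continuous_on_def using \<delta> by metis
  have "?S \<subseteq> (\<Union>c\<in>?S. ball c \<rho>)"
    using centre_in_ball[of _ \<rho>] \<rho>(1) by blast
  then obtain C where C: "C \<subseteq> ?S" "finite C" "?S \<subseteq> (\<Union>c\<in>C. ball c \<rho>)"
    by (rule compactE_image[of ?S ?S "\<lambda>c. ball c \<rho>", rotated 2]) auto
  obtain xs where xs: "set xs = C" using finite_list[OF C(2)] by blast
  define B where "B i = ball (xs ! i) \<rho> \<inter> ?S" for i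
  define A where "A = disjointed B"
  have AB: "A i \<subseteq> B i" for i unfolding A_def by (rule disjointed_subset)
  have B: "B i \<in> sets L" for i
    unfolding L sets_sphere_measure by (auto simp: B_def sets_restrict_space Int_commute)
  have "approx_partition L \<phi> \<delta> (length xs) A (\<lambda>i. \<phi> (xs ! i))"
    unfolding approx_partition_def
  proof (intro conjI allI impI ballI)
    show "disjoint_family_on A {..<length xs}"
      using disjoint_family_disjointed[of B] unfolding A_def by (rule disjoint_family_on_mono[rotated]) simp
    show "A i \<in> sets L" for i unfolding A_def disjointed_def using B by auto
    have "(\<Union>i<length xs. A i) = (\<Union>i<length xs. B i)"
      unfolding A_def using finite_UN_disjointed_eq[of B "length xs"] by (simp add: atLeast0LessThan)
    also have "\<dots> = ?S"
    proof
      show "?S \<subseteq> (\<Union>i<length xs. B i)"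
      proof
        fix x assume x: "x \<in> ?S"
        then obtain c where "c \<in> C" "x \<in> ball c \<rho>" using C(3) by blast
        then obtain i where "i < length xs" "x \<in> ball (xs ! i) \<rho>" using xs by (metis in_set_conv_nth)
        then show "x \<in> (\<Union>i<length xs. B i)" using x by (auto simp: B_def)
      qed
    qed (auto simp: B_def)
    also have "?S = space L" using sets_eq_imp_space_eq[OF L] by simp
    finally show "(\<Union>i<length xs. A i) = space L" .
    fix i assume i: "i < length xs"
    then have xi: "xs ! i \<in> ?S" using xs C(1) nth_mem by blast
    then show "norm (\<phi> (xs ! i)) \<le> 1" by (rule le)
    fix x assume "x \<in> A i"
    then have "x \<in> B i" using AB by blast
    then have "dist (\<phi> x) (\<phi> (xs ! i)) < \<delta>"
      by (intro \<rho>(2) xi) (auto simp: B_def dist_commute)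
    then show "norm (\<phi> x - \<phi> (xs ! i)) \<le> \<delta>" by (simp add: dist_norm)
  qed
  then show ?thesis by blast
qed

lemma integral_scale_measure:
  fixes f :: "'a \<Rightarrow> 'b::{banach, second_countable_topology}"
  assumes "0 \<le> r" and f: "f \<in> borel_measurable M"
  shows "(LINT x|scale_measure (ennreal r) M. f x) = r *\<^sub>R (LINT x|M. f x)"
proof -
  have "scale_measure (ennreal r) M = density M (\<lambda>_. ennreal r)"
    by (rule measure_eqI) (auto simp: emeasure_density nn_integral_cmult_indicator)
  then show ?thesis using assms by (simp add: integral_density)
qed

text \<open>The covariance operator is used only through these second moments of projections: they
  fix the quadratic terms by polarization, and the subspace that carries \<open>Z\<close>.\<close>

lemma inner_covariance_operator:
  fixes X :: "'a \<Rightarrow> 'k::{real_inner, banach, second_countable_topology}"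
  assumes [measurable]: "X \<in> borel_measurable M" and i: "integrable M (\<lambda>\<omega>. (norm (X \<omega>))\<^sup>2)"
  shows "inner (covariance_operator M X u) u = (LINT \<omega>|M. (inner (X \<omega>) u)\<^sup>2)"
proof -
  have int: "integrable M (\<lambda>\<omega>. inner (X \<omega>) u *\<^sub>R X \<omega>)"
  proof (rule Bochner_Integration.integrable_bound)
    show "integrable M (\<lambda>\<omega>. norm u * (norm (X \<omega>))\<^sup>2)" using i by simp
    have "norm (inner x u *\<^sub>R x) \<le> norm u * (norm x)\<^sup>2" for x :: 'k
      using mult_right_mono[OF Cauchy_Schwarz_ineq2[of x u] norm_ge_zero[of x]]
      by (simp add: power2_eq_square mult_ac)
    then show "AE \<omega> in M. norm (inner (X \<omega>) u *\<^sub>R X \<omega>) \<le> norm (norm u * (norm (X \<omega>))\<^sup>2)"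
      by (auto intro!: AE_I2 order_trans[OF _ abs_ge_self])
  qed measurable
  have "inner (covariance_operator M X u) u = (LINT \<omega>|M. inner (inner (X \<omega>) u *\<^sub>R X \<omega>) u)"
    unfolding covariance_operator_def by (rule integral_inner_left[symmetric]) (rule int)
  then show ?thesis by (simp add: power2_eq_square)
qed

theorem theorem2p11:
  fixes M :: "'a measure" and M' :: "'b measure"
    and \<nu> :: "real \<Rightarrow> real" and N :: "real \<Rightarrow> 'a \<Rightarrow> (real^3) measure"
    and Z :: "'b \<Rightarrow> sphere_L2" and l :: nat and t :: real
  assumes "prob_space M" and "prob_space M'"
    and "\<And>s. s > 0 \<Longrightarrow> \<nu> s > 0"
    and "\<And>s. s > 0 \<Longrightarrow>
           poisson_random_measure M (N s) (scale_measure (ennreal (\<nu> s)) sphere_measure)"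
    and "l \<ge> 1" and "t > 0"
    and "gaussian_element M' Z" and "centred_square_integrable M' Z"
    and "covariance_operator M' Z = covariance_operator M (\<lambda>\<omega>. poisson_wave l (\<nu> t) (N t \<omega>))"
  shows "d3 M (\<lambda>\<omega>. poisson_wave l (\<nu> t) (N t \<omega>)) M' Z
           \<le> ennreal ((1 / 4 + sqrt pi) * sqrt (4 * pi / \<nu> t))"
proof -
  note M = assms(1) and M' = assms(2) and gauss = assms(7) and centred = assms(8)
  define r where "r = \<nu> t"
  define \<Lambda> where "\<Lambda> = scale_measure (ennreal r) sphere_measure"
  have r: "0 < r" using assms(3,6) by (simp add: r_def)
  have prm: "poisson_random_measure M (N t) \<Lambda>" unfolding \<Lambda>_def r_def by (rule assms(4)[OF assms(6)])
  have s\<Lambda>: "sets \<Lambda> = sets sphere_measure" by (simp add: \<Lambda>_def)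
  have sp\<Lambda>: "space \<Lambda> = sphere 0 1" using sets_eq_imp_space_eq[OF s\<Lambda>] by simp
  define \<phi> where "\<phi> = wave_element l"
  have fin\<Lambda>: "finite_measure \<Lambda>" by (rule prm_finite_intensity[OF M prm])
  have \<phi>b: "\<phi> \<in> borel_measurable sphere_measure"
    unfolding \<phi>_def by (rule borel_measurable_sphere[OF continuous_wave_element])
  then have \<phi>m: "\<phi> \<in> borel_measurable \<Lambda>" unfolding measurable_cong_sets[OF s\<Lambda> refl] .
  have \<phi>1: "norm (\<phi> x) \<le> 1" if "x \<in> space \<Lambda>" for x
    using that norm_wave_element[of x l] by (simp add: sp\<Lambda> \<phi>_def)
  have part: "\<exists>m A c. approx_partition \<Lambda> \<phi> \<delta> m A c" if "0 < \<delta>" for \<delta>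
    by (rule sphere_approx_partition[OF s\<Lambda> _ _ that])
       (use \<phi>1 sp\<Lambda> continuous_on_subset[OF continuous_wave_element] in \<open>auto simp: \<phi>_def\<close>)
  have \<phi>0: "(LINT x|\<Lambda>. \<phi> x) = 0"
    unfolding \<Lambda>_def using r integral_wave_element[OF assms(5)] \<phi>b by (subst integral_scale_measure) (auto simp: \<phi>_def)
  note ctx = M prm \<phi>m \<phi>1 part \<phi>0
  let ?I = "poisson_integral (N t) \<phi>"
  let ?T = "\<lambda>\<omega>. poisson_wave l (\<nu> t) (N t \<omega>)"
  have T: "?T \<omega> = (1 / sqrt r) *\<^sub>R ?I \<omega>" if "\<omega> \<in> space M" for \<omega>
    unfolding r_def[symmetric] poisson_integral_def \<phi>_def
    using prm_finite[OF M prm that] prm_sets[OF M prm that] s\<Lambda> by (intro poisson_wave_eq) auto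
  have Im: "?I \<in> borel_measurable M" by (rule pint_measurable[OF ctx])
  have "covariance_operator M ?T = covariance_operator M (\<lambda>\<omega>. (1 / sqrt r) *\<^sub>R ?I \<omega>)"
    unfolding covariance_operator_def by (intro ext Bochner_Integration.integral_cong) (simp_all add: T)
  then have covT: "covariance_operator M' Z = covariance_operator M (\<lambda>\<omega>. (1 / sqrt r) *\<^sub>R ?I \<omega>)"
    using assms(9) by simp
  have cov: "(LINT \<omega>|M'. (inner (Z \<omega>) u)\<^sup>2) = (LINT x|\<Lambda>. (inner (\<phi> x) u)\<^sup>2) / r" for u
  proof -
    have "(LINT \<omega>|M'. (inner (Z \<omega>) u)\<^sup>2) = inner (covariance_operator M' Z u) u"
      by (rule inner_covariance_operator[symmetric]) (use centred in \<open>auto simp: centred_square_integrable_def\<close>)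
    also have "\<dots> = (LINT \<omega>|M. (inner ((1 / sqrt r) *\<^sub>R ?I \<omega>) u)\<^sup>2)"
      unfolding covT
      by (rule inner_covariance_operator) (use Im pint_integrable2[OF ctx] in \<open>auto simp: power_mult_distrib power_divide\<close>)
    also have "\<dots> = (LINT \<omega>|M. (inner (?I \<omega>) u)\<^sup>2) / r"
      using r by (simp add: power_divide)
    also have "(LINT \<omega>|M. (inner (?I \<omega>) u)\<^sup>2) = (LINT x|\<Lambda>. (inner (\<phi> x) u)\<^sup>2)"
      by (rule pint_inner_second_moment[OF ctx])
    finally show ?thesis .
  qed
  obtain d e where e: "orthonormal_upto d e" and sp: "\<And>\<xi>. \<phi> \<xi> = (\<Sum>i<d. inner (\<phi> \<xi>) (e i) *\<^sub>R e i)"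
    using wave_element_span[of l] unfolding \<phi>_def by blast
  \<comment> \<open>A vector orthogonal to all \<open>e i\<close> is orthogonal to all values of
    \<open>\<phi>\<close>, so by \<open>cov\<close> the projection of \<open>Z\<close> on it has
    second moment 0: \<open>Z\<close> inherits the finite-dimensional range from the
    covariance.\<close>
  have spanZ: "AE \<omega> in M'. Z \<omega> = (\<Sum>i<d. inner (Z \<omega>) (e i) *\<^sub>R e i)"
  proof (rule AE_in_span_orthonormal[OF e])
    fix u assume u: "\<And>i. i < d \<Longrightarrow> inner (e i) u = 0"
    have "inner (\<phi> x) u = 0" for x
      by (subst sp) (simp add: inner_sum_left u)
    then have "(LINT \<omega>|M'. (inner (Z \<omega>) u)\<^sup>2) = 0" by (simp add: cov)
    moreover have "integrable M' (\<lambda>\<omega>. (inner (Z \<omega>) u)\<^sup>2)"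
      using gaussian_real_moments[OF M', of "\<lambda>\<omega>. inner (Z \<omega>) u" 2] gauss by (simp add: gaussian_element_def)
    ultimately show "AE \<omega> in M'. inner (Z \<omega>) u = 0"
      by (simp add: integral_nonneg_eq_0_iff_AE)
  qed
  have span\<phi>: "AE x in \<Lambda>. \<phi> x = (\<Sum>i<d. inner (\<phi> x) (e i) *\<^sub>R e i)"
    by (rule AE_I2) (rule sp)
  have mass: "measure \<Lambda> (space \<Lambda>) = r * (4 * pi)"
    unfolding sp\<Lambda> using r by (simp add: \<Lambda>_def measure_def emeasure_sphere_measure_space enn2real_mult)
  \<comment> \<open>The mass is \<open>4 * pi * r\<close>, so the left side is
    \<open>(2 / 3 * pi) / sqrt r\<close>. The right side is
    \<open>2 * (1 / 4 + sqrt pi) * sqrt pi / sqrt r\<close>, which is at least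
    \<open>2 * pi / sqrt r\<close>.\<close>
  have const: "measure \<Lambda> (space \<Lambda>) / (6 * (r * sqrt r)) \<le> (1 / 4 + sqrt pi) * sqrt (4 * pi / r)"
  proof -
    have "measure \<Lambda> (space \<Lambda>) / (6 * (r * sqrt r)) = (2 / 3 * pi) / sqrt r"
      using r unfolding mass by (simp add: field_simps)
    also have "2 / 3 * pi \<le> 2 * (sqrt pi * sqrt pi)" by simp
    also have "\<dots> \<le> 2 * ((1 / 4 + sqrt pi) * sqrt pi)" by (intro mult_left_mono mult_right_mono) auto
    also have "2 * ((1 / 4 + sqrt pi) * sqrt pi) / sqrt r = (1 / 4 + sqrt pi) * sqrt (4 * pi / r)"
      by (simp add: real_sqrt_divide real_sqrt_mult)
    finally show ?thesis using r by (simp add: divide_right_mono)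
  qed
  show ?thesis
    unfolding d3_def
  proof (rule SUP_least)
    fix h :: "sphere_L2 \<Rightarrow> real" assume "h \<in> {h \<in> Cb3. Cb3_norm h \<le> 1}"
    then have h: "h \<in> Cb3" "Cb3_norm h \<le> 1" by auto
    have "(LINT \<omega>|M. h (?T \<omega>)) = (LINT \<omega>|M. h ((1 / sqrt r) *\<^sub>R ?I \<omega>))"
      by (rule Bochner_Integration.integral_cong) (simp_all add: T)
    then have "\<bar>(LINT \<omega>|M. h (?T \<omega>)) - (LINT \<omega>|M'. h (Z \<omega>))\<bar> \<le> measure \<Lambda> (space \<Lambda>) / (6 * (r * sqrt r))"
      using poisson_gaussian_smooth_distance[OF ctx M' gauss centred e spanZ span\<phi> r cov h] by simp
    also note const
    finally show "ennreal \<bar>(LINT \<omega>|M. h (?T \<omega>)) - (LINT \<omega>|M'. h (Z \<omega>))\<bar> \<le> ennreal ((1 / 4 + sqrt pi) * sqrt (4 * pi / \<nu> t))"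
      unfolding r_def by (rule ennreal_leI)
  qed
qed

end
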